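(* Let $c\in[0,1)$ and let $r=r_n$ be integers with $2\le r\le n$ and $r/n\to c$ as $n\to\infty$. For each $n$ let $\mathbf Y=(Y_\ell)_{1\le \ell\le M}$ be independent random variables with zero mean and unit variance such that, for every $\varepsilon>0$, $$\frac{r^4}{n^2N}\sum_{\ell=1}^M \mathbb E\big[Y_\ell^2\,\mathbf 1(|Y_\ell|>\varepsilon K_n)\big]\to 0\quad (n\to\infty),\qquad K_n=\frac{\sqrt{nN}}{r^4}.$$ Then the expected empirical spectral distribution of $n^{-1/2}H_n(\mathbf Y)$ converges weakly, as $n\to\infty$, to $\nu_{\mathrm{sc},(1-c)^2}$.
   Context: For integers $2\le r\le n$ put $M=\binom nr$, $N=\binom{n-2}{r-2}$, and let $e_1,\dots,e_M$ be an enumeration of the $r$-element subsets of $\{1,\dots,n\}$. Let $\mathbf a_\ell\in\{0,1\}^n$ be the indicator vector of $e_\ell$ and $Q_\ell=\mathbf a_\ell\mathbf a_\ell^\top-\mathrm{diag}(\mathbf a_\ell)$. For $\mathbf x\in\mathbb R^M$ let $H_n(\mathbf x)=N^{-1/2}\sum_{\ell=1}^M x_\ell Q_\ell$ (an $n\times n$ real symmetric matrix). When $\mathbf Y$ has independent zero mean unit variance entries, $H_n(\mathbf Y)$ is called a generalised hypergraph adjacency matrix (GHAM). For an $n\times n$ symmetric matrix $A$ with eigenvalues $\lambda_1,\dots,\lambda_n$, the empirical spectral distribution is $\mu_A=\frac1n\sum_i\delta_{\lambda_i}$; for random $A$ the expected empirical spectral distribution $\bar\mu_A$ is defined by $\int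 f\,d\bar\mu_A=\mathbb E\int f\,d\mu_A$ for bounded measurable $f$. $\nu_{\mathrm{sc},\sigma^2}$ is the semi-circle law with variance $\sigma^2$, with density $\frac{1}{2\pi\sigma^2}\sqrt{4\sigma^2-x^2}$ on $[-2\sigma,2\sigma]$. *)

theory Defs
  imports
    "HOL-Probability.Probability"
    "Jordan_Normal_Form.Char_Poly"
begin

hide_const (open) Finite_Cartesian_Product.vec Finite_Cartesian_Product.mat

definition ind_vec :: "nat \<Rightarrow> nat set \<Rightarrow> real Matrix.vec" where
  \<comment> \<open>vertices are \<open>1, \<dots>, n\<close>, while vector and matrix indices start at 0\<close>
  "ind_vec n A = Matrix.vec n (\<lambda>i. if Suc i \<in> A then 1 else 0)"

definition outer_prod :: "real Matrix.vec \<Rightarrow> real Matrix.vec \<Rightarrow> real Matrix.mat" where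
  "outer_prod v w = Matrix.mat (dim_vec v) (dim_vec w) (\<lambda>(i, j). vec_index v i * vec_index w j)"

definition edge_mat :: "nat \<Rightarrow> nat set \<Rightarrow> real Matrix.mat" where
  "edge_mat n A = outer_prod (ind_vec n A) (ind_vec n A) - mat_diag n (\<lambda>i. vec_index (ind_vec n A) i)"

definition num_edges :: "nat \<Rightarrow> nat \<Rightarrow> nat" where
  "num_edges n r = n choose r"

definition num_edges_pair :: "nat \<Rightarrow> nat \<Rightarrow> nat" where
  "num_edges_pair n r = (n - 2) choose (r - 2)"

definition enumerates_edges :: "nat \<Rightarrow> nat \<Rightarrow> (nat \<Rightarrow> nat set) \<Rightarrow> bool" where
  "enumerates_edges n r e \<longleftrightarrow>
     bij_betw e {1..num_edges n r} {A. A \<subseteq> {1..n} \<and> card A = r}"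

text \<open>Matrices of type \<open>real mat\<close> do not form a type-class monoid,
  so the sum over the edges is taken entrywise.\<close>

definition H_mat :: "nat \<Rightarrow> nat \<Rightarrow> (nat \<Rightarrow> nat set) \<Rightarrow> (nat \<Rightarrow> real) \<Rightarrow> real Matrix.mat" where
  "H_mat n r e x = (1 / sqrt (real (num_edges_pair n r))) \<cdot>\<^sub>m
     Matrix.mat n n (\<lambda>ij. \<Sum>l = 1..num_edges n r. x l * (edge_mat n (e l) $$ ij))"

text \<open>For a real symmetric \<open>n \<times> n\<close> matrix the characteristic polynomial splits over the reals,
  so \<open>proots (char_poly A)\<close> is the multiset of its \<open>n\<close> eigenvalues. For \<open>n \<ge> 1\<close>,
  \<open>pmf_of_multiset\<close> gives each of them (with multiplicity) mass \<open>1/n\<close>. The \<open>distr\<close> only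
  changes the \<open>\<sigma>\<close>-algebra from the discrete to the Borel one.\<close>

definition esd :: "real Matrix.mat \<Rightarrow> real measure" where
  "esd A = distr (measure_pmf (pmf_of_multiset (proots (char_poly A)))) borel (\<lambda>x. x)"

text \<open>The monadic bind of the Giry monad is the mixture of the random measures \<open>esd (A \<omega>)\<close>:
  it satisfies \<open>\<integral>f d(expected_esd P A) = E \<integral>f d(esd (A \<omega>))\<close> for bounded measurable \<open>f\<close>
  (cf. \<open>integral_bind\<close>), provided \<open>\<lambda>\<omega>. esd (A \<omega>)\<close> is a measurable kernel. That is the case when
  \<open>A\<close> is symmetric with measurable entries.\<close>

definition expected_esd :: "'a measure \<Rightarrow> ('a \<Rightarrow> real Matrix.mat) \<Rightarrow> real measure" where
  "expected_esd P A = Giry_Monad.bind P (\<lambda>\<omega>. esd (A \<omega>))"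

text \<open>The argument is the variance \<open>v = \<sigma>\<^sup>2\<close>, so that the support \<open>[-2\<sigma>, 2\<sigma>]\<close> is
  \<open>[-2 * sqrt v, 2 * sqrt v]\<close>. The cutoff to the support is needed since \<open>sqrt\<close> of a negative
  number is negative rather than 0.\<close>

definition semicircle :: "real \<Rightarrow> real measure" where
  "semicircle v = density lborel (\<lambda>x. ennreal
     (indicator {- 2 * sqrt v .. 2 * sqrt v} x * (1 / (2 * pi * v) * sqrt (4 * v - x\<^sup>2))))"

definition K_trunc :: "nat \<Rightarrow> nat \<Rightarrow> real" where
  "K_trunc n r = sqrt (real n * real (num_edges_pair n r)) / real r ^ 4"

end

theory Submission
  imports Defs "HOL-Real_Asymp.Real_Asymp"
begin

text \<open>Write \<open>A\<close> for the random matrix \<open>n\<^sup>-\<^sup>1\<^sup>/\<^sup>2 H\<close>, \<open>G = (z - A)\<^sup>-\<^sup>1\<close> with \<open>\<eta> = Im z > 0\<close>, and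
\<open>s(z) = E tr G / n\<close>, the Cauchy transform of the expected spectral distribution. Convergence of
Cauchy transforms in the upper half plane implies weak convergence
(\<open>weak_conv_of_cauchy_transform\<close>), and the Cauchy transform \<open>g\<close> of the semicircle law of variance
\<open>v\<close> solves \<open>z g - 1 = v g\<^sup>2\<close> (\<open>semicircle_cauchy_equation\<close>). Among the solutions in the closed lower
half plane this equation is stable (\<open>quadratic_root_stability\<close>): if \<open>z s - 1 - v s\<^sup>2\<close> is small,
then \<open>s\<close> is close to \<open>g\<close>. So everything comes down to the approximate equation
\<open>z s - 1 \<approx> (1 - c)\<^sup>2 s\<^sup>2\<close>, proved in \<open>self_consistent_equation\<close>.

The entries of \<open>H\<close> have unit variance but are strongly dependent: two entries that share one
vertex have correlation close to \<open>c\<close>, two that share none have correlation close to \<open>c\<^sup>2\<close>. To leading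
order these correlations are those of a random perturbation with entries \<open>b\<^sub>i + b\<^sub>j\<close>, that is, of
a matrix of rank two. Compressing \<open>A\<close> with \<open>P = I - J/n\<close>, where \<open>J\<close> is the all-ones
matrix, removes them, and the compression changes \<open>A\<close> by two symmetric rank one matrices, each of
which moves \<open>tr G\<close> by at most \<open>1/\<eta>\<close> (\<open>trace_resolvent_centering\<close>). What is left behaves like a
Wigner matrix with entry variance \<open>1 - 2c + c\<^sup>2 = (1 - c)\<^sup>2\<close>.

For the compressed matrix \<open>PAP = \<Sum>\<^sub>l Y\<^sub>l B\<^sub>l\<close> one has \<open>z tr G - n = \<Sum>\<^sub>l Y\<^sub>l tr (B\<^sub>l G)\<close>. As a function
of \<open>Y\<^sub>l\<close> alone, \<open>f = tr (B\<^sub>l G)\<close> is smooth with derivative \<open>tr (B\<^sub>l G B\<^sub>l G)\<close>, and for a variable of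
mean 0 and variance 1 the Gaussian integration by parts \<open>E Y f(Y) = E f'(Y)\<close> holds up to a Taylor
error: of second order below the truncation level \<open>\<epsilon> K\<^sub>n\<close>, of first order above it, where the
Lindeberg condition takes over (\<open>stein_one_variable\<close>, \<open>expected_resolvent_equation\<close>). The level
\<open>K\<^sub>n\<close> is tied to the size of the coefficients, \<open>|B\<^sub>l| \<le> 2 r / \<surd>(n N) \<le> 2 / K\<^sub>n\<close> in Frobenius norm.
That \<open>K\<^sub>n\<close> tends to infinity is itself a consequence of the Lindeberg condition (\<open>K_large\<close>).

It remains to compute \<open>\<Sum>\<^sub>l tr (B\<^sub>l G B\<^sub>l G)\<close>. It is a sum over four vertices of products of two entries
of \<open>P G P\<close>, weighted with the number of edges containing these vertices. This weight depends only
on the number of coincidences, and as \<open>P G P\<close> has vanishing row and column sums, only the pattern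
that produces \<open>(tr G)\<^sup>2\<close> is of leading order (\<open>sum_edge_entry_products\<close>, \<open>contraction_total\<close>,
\<open>quadratic_term\<close>). Finally \<open>E (tr G / n)\<^sup>2\<close> is replaced by \<open>s\<^sup>2\<close>, since \<open>tr G / n\<close> is Lipschitz in each
\<open>Y\<^sub>l\<close> with a small constant and a function on a product space with coordinatewise Lipschitz
constants \<open>L\<^sub>l\<close> has variance at most \<open>\<Sum>\<^sub>l L\<^sub>l\<^sup>2\<close> (\<open>variance_lipschitz_PiM\<close>, \<open>stieltjes_concentration\<close>).\<close>

section \<open>Traces and the Frobenius norm\<close>

definition mat_trace :: "complex Matrix.mat \<Rightarrow> complex" where
  "mat_trace A = (\<Sum>i<dim_row A. A $$ (i, i))"

definition frob :: "complex Matrix.mat \<Rightarrow> real" where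
  "frob A = L2_set (\<lambda>p. cmod (A $$ p)) ({..<dim_row A} \<times> {..<dim_col A})"

lemma frob_nonneg [simp]: "0 \<le> frob A"
  by (simp add: frob_def L2_set_nonneg)

lemma frob_square: "(frob A)\<^sup>2 = (\<Sum>i<dim_row A. \<Sum>j<dim_col A. (cmod (A $$ (i, j)))\<^sup>2)"
  by (simp add: frob_def L2_set_def sum_nonneg sum.cartesian_product)

lemma mat_mult_entry:
  assumes "A \<in> carrier_mat n m" "B \<in> carrier_mat m k" "i < n" "j < k"
  shows "(A * B) $$ (i, j) = (\<Sum>l<m. A $$ (i, l) * B $$ (l, j))"
  using assms by (auto simp: scalar_prod_def atLeast0LessThan intro!: sum.cong)

lemma mat_trace_mult:
  assumes "A \<in> carrier_mat n m" "B \<in> carrier_mat m n"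
  shows "mat_trace (A * B) = (\<Sum>i<n. \<Sum>j<m. A $$ (i, j) * B $$ (j, i))"
  using assms by (auto simp: mat_trace_def mat_mult_entry[OF assms] simp del: index_mult_mat(1) intro!: sum.cong)

lemma mat_trace_mult_commute:
  assumes "A \<in> carrier_mat n m" "B \<in> carrier_mat m n"
  shows "mat_trace (A * B) = mat_trace (B * A)"
  unfolding mat_trace_mult[OF assms] mat_trace_mult[OF assms(2,1)]
  by (subst sum.swap) (simp add: mult.commute)

lemma mat_trace_diff:
  assumes "A \<in> carrier_mat n n" "B \<in> carrier_mat n n"
  shows "mat_trace (A - B) = mat_trace A - mat_trace B"
  using assms by (auto simp: mat_trace_def sum_subtractf)

lemma mat_trace_smult: "A \<in> carrier_mat n n \<Longrightarrow> mat_trace (c \<cdot>\<^sub>m A) = c * mat_trace A"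
  by (auto simp: mat_trace_def sum_distrib_left)

lemma norm_mat_trace_mult_le:
  assumes A: "A \<in> carrier_mat n m" and B: "B \<in> carrier_mat m n"
  shows "cmod (mat_trace (A * B)) \<le> frob A * frob B"
proof -
  have "cmod (mat_trace (A * B)) \<le> (\<Sum>i<n. \<Sum>j<m. cmod (A $$ (i, j)) * cmod (B $$ (j, i)))"
    unfolding mat_trace_mult[OF assms]
    by (intro order.trans[OF norm_sum] sum_mono) (simp add: norm_mult)
  also have "\<dots> = (\<Sum>p\<in>{..<n} \<times> {..<m}. \<bar>cmod (A $$ p)\<bar> * \<bar>cmod (B $$ prod.swap p)\<bar>)"
    by (simp add: sum.cartesian_product case_prod_beta prod.swap_def)
  also have "\<dots> \<le> L2_set (\<lambda>p. cmod (A $$ p)) ({..<n} \<times> {..<m})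
      * L2_set (\<lambda>p. cmod (B $$ prod.swap p)) ({..<n} \<times> {..<m})"
    by (rule L2_set_mult_ineq)
  also have "L2_set (\<lambda>p. cmod (B $$ prod.swap p)) ({..<n} \<times> {..<m}) = frob B"
    unfolding frob_def L2_set_def using B
    by (intro arg_cong[where f = sqrt] sum.reindex_bij_witness[of _ prod.swap prod.swap]) auto
  finally show ?thesis using A by (simp add: frob_def)
qed

lemma frob_mult_le:
  assumes A: "A \<in> carrier_mat n m" and B: "B \<in> carrier_mat m k"
  shows "frob (A * B) \<le> frob A * frob B"
proof (rule power2_le_imp_le)
  have "(frob (A * B))\<^sup>2 = (\<Sum>i<n. \<Sum>j<k. (cmod (\<Sum>l<m. A $$ (i, l) * B $$ (l, j)))\<^sup>2)"
    using A B by (simp add: frob_square mat_mult_entry[OF A B] del: index_mult_mat(1))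
  also have "\<dots> \<le> (\<Sum>i<n. \<Sum>j<k. (\<Sum>l<m. (cmod (A $$ (i, l)))\<^sup>2) * (\<Sum>l<m. (cmod (B $$ (l, j)))\<^sup>2))"
  proof (intro sum_mono)
    fix i j
    have "(cmod (\<Sum>l<m. A $$ (i, l) * B $$ (l, j)))\<^sup>2 \<le> (\<Sum>l<m. cmod (A $$ (i, l)) * cmod (B $$ (l, j)))\<^sup>2"
      by (intro power_mono order.trans[OF norm_sum]) (auto simp: norm_mult)
    also have "\<dots> \<le> (\<Sum>l<m. (cmod (A $$ (i, l)))\<^sup>2) * (\<Sum>l<m. (cmod (B $$ (l, j)))\<^sup>2)"
      by (rule Cauchy_Schwarz_ineq_sum)
    finally show "(cmod (\<Sum>l<m. A $$ (i, l) * B $$ (l, j)))\<^sup>2 \<le> \<dots>" .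
  qed
  also have "\<dots> = (\<Sum>i<n. (\<Sum>l<m. (cmod (A $$ (i, l)))\<^sup>2)) * (\<Sum>j<k. \<Sum>l<m. (cmod (B $$ (l, j)))\<^sup>2)"
    by (rule sum_product [symmetric])
  also have "(\<Sum>i<n. (\<Sum>l<m. (cmod (A $$ (i, l)))\<^sup>2)) = (frob A)\<^sup>2"
    using A by (simp add: frob_square)
  also have "(\<Sum>j<k. \<Sum>l<m. (cmod (B $$ (l, j)))\<^sup>2) = (frob B)\<^sup>2"
    using B by (subst sum.swap) (simp add: frob_square)
  finally show "(frob (A * B))\<^sup>2 \<le> (frob A * frob B)\<^sup>2" by (simp add: power_mult_distrib)
qed simp

lemma frob_transpose [simp]: "frob (A\<^sup>T) = frob A"
proof -
  have "(frob (A\<^sup>T))\<^sup>2 = (frob A)\<^sup>2"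
    unfolding frob_square by (subst sum.swap) simp
  thus ?thesis by simp
qed

lemma frob_smult: "frob (c \<cdot>\<^sub>m A) = cmod c * frob A"
proof -
  have "(frob (c \<cdot>\<^sub>m A))\<^sup>2 = (cmod c * frob A)\<^sup>2"
    unfolding frob_square power_mult_distrib
    by (simp add: norm_mult power_mult_distrib sum_distrib_left)
  thus ?thesis by simp
qed

lemma frob_add_le:
  assumes "A \<in> carrier_mat n m" "B \<in> carrier_mat n m"
  shows "frob (A + B) \<le> frob A + frob B"
proof -
  have "frob (A + B) \<le> L2_set (\<lambda>p. cmod (A $$ p) + cmod (B $$ p)) ({..<n} \<times> {..<m})"
    unfolding frob_def using assms by (auto intro!: L2_set_mono norm_triangle_ineq)
  also have "\<dots> \<le> frob A + frob B"
    using assms by (auto simp: frob_def intro!: L2_set_triangle_ineq)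
  finally show ?thesis .
qed

lemma frob_diff_le:
  assumes "A \<in> carrier_mat n m" "B \<in> carrier_mat n m"
  shows "frob (A - B) \<le> frob A + frob B"
proof -
  have "A - B = A + (-1) \<cdot>\<^sub>m B" using assms by auto
  thus ?thesis using frob_add_le[of A n m "(-1) \<cdot>\<^sub>m B"] assms by (simp add: frob_smult)
qed

lemma frob_one: "frob (1\<^sub>m n) = sqrt n"
proof -
  have "(frob (1\<^sub>m n))\<^sup>2 = real n"
    unfolding frob_square by (simp add: if_distrib[of cmod] if_distrib[of "\<lambda>x. x\<^sup>2"] cong: if_cong)
  thus ?thesis by (metis frob_nonneg real_sqrt_unique)
qed

section \<open>Resolvents\<close>

text \<open>Real symmetric matrices are kept as complex matrices, since they only occur together with their
resolvents at non-real points.\<close>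

definition symmat :: "nat \<Rightarrow> complex Matrix.mat \<Rightarrow> bool" where
  "symmat n A \<longleftrightarrow> A \<in> carrier_mat n n \<and> (\<forall>i<n. \<forall>j<n. A $$ (i, j) \<in> \<real> \<and> A $$ (j, i) = A $$ (i, j))"

text \<open>The inverse of \<open>z - A\<close>, by Cramer's rule. This formula makes the entries rational functions of
\<open>z\<close> and of the entries of \<open>A\<close>, from which their measurability is read off.\<close>

definition resolvent :: "complex Matrix.mat \<Rightarrow> complex \<Rightarrow> complex Matrix.mat" where
  "resolvent A z = (let Z = z \<cdot>\<^sub>m 1\<^sub>m (dim_row A) - A in inverse (Determinant.det Z) \<cdot>\<^sub>m adj_mat Z)"

lemma symmatD: 
  assumes "symmat n A"
  shows "A \<in> carrier_mat n n" "\<And>i j. i < n \<Longrightarrow> j < n \<Longrightarrow> A $$ (i, j) \<in> \<real>"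
    "\<And>i j. i < n \<Longrightarrow> j < n \<Longrightarrow> A $$ (j, i) = A $$ (i, j)" "A\<^sup>T = A"
  using assms by (auto simp: symmat_def)

text \<open>If \<open>(z - A) w = v\<close> with \<open>A\<close> Hermitian, then \<open>w\<^sup>* A w\<close> is real, so the imaginary part of \<open>w\<^sup>* v\<close>
only sees \<open>z\<close>. Invertibility of \<open>z - A\<close>, the norm bound \<open>1/|Im z|\<close> for the resolvent and the rank
one perturbation bound all come from this identity. Vectors and matrices are functions here, so
that it applies to the columns of a matrix equation.\<close>

lemma resolvent_quadratic_form:
  fixes A :: "nat \<Rightarrow> nat \<Rightarrow> complex" and v w :: "nat \<Rightarrow> complex"
  assumes herm: "\<And>i j. i < n \<Longrightarrow> j < n \<Longrightarrow> A j i = cnj (A i j)"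
    and eq: "\<And>i. i < n \<Longrightarrow> z * w i - (\<Sum>j<n. A i j * w j) = v i"
  shows "Im (\<Sum>i<n. cnj (w i) * v i) = Im z * (\<Sum>i<n. (cmod (w i))\<^sup>2)"
proof -
  define q where "q = (\<Sum>i<n. \<Sum>j<n. cnj (w i) * A i j * w j)"
  have "cnj q = (\<Sum>i<n. \<Sum>j<n. cnj (w j) * A j i * w i)"
    unfolding q_def by (auto simp: herm[symmetric] algebra_simps intro!: sum.cong)
  also have "\<dots> = q" unfolding q_def by (rule sum.swap)
  finally have q: "Im q = 0" by (simp add: complex_eq_iff)
  have "(\<Sum>i<n. cnj (w i) * v i) = (\<Sum>i<n. z * of_real ((cmod (w i))\<^sup>2) - (\<Sum>j<n. cnj (w i) * A i j * w j))"
    by (intro sum.cong)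
      (auto simp: eq[symmetric] algebra_simps sum_distrib_left complex_norm_square simp del: of_real_power)
  also have "\<dots> = z * of_real (\<Sum>i<n. (cmod (w i))\<^sup>2) - q"
    by (simp add: sum_subtractf q_def sum_distrib_left)
  finally show ?thesis using q by simp
qed

lemma resolvent_energy:
  fixes A :: "nat \<Rightarrow> nat \<Rightarrow> complex" and v w :: "nat \<Rightarrow> complex"
  assumes herm: "\<And>i j. i < n \<Longrightarrow> j < n \<Longrightarrow> A j i = cnj (A i j)"
    and eq: "\<And>i. i < n \<Longrightarrow> z * w i - (\<Sum>j<n. A i j * w j) = v i"
  shows "\<bar>Im z\<bar> * L2_set (\<lambda>i. cmod (w i)) {..<n} \<le> L2_set (\<lambda>i. cmod (v i)) {..<n}"
proof -
  define W where "W = L2_set (\<lambda>i. cmod (w i)) {..<n}"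
  define V where "V = L2_set (\<lambda>i. cmod (v i)) {..<n}"
  have W2: "W\<^sup>2 = (\<Sum>i<n. (cmod (w i))\<^sup>2)"
    by (simp add: W_def L2_set_def sum_nonneg)
  have "\<bar>Im z\<bar> * W\<^sup>2 \<le> cmod (\<Sum>i<n. cnj (w i) * v i)"
    using abs_Im_le_cmod[of "\<Sum>i<n. cnj (w i) * v i"] resolvent_quadratic_form[of n A z w v, OF herm eq]
    unfolding W2 by (simp add: abs_mult sum_nonneg)
  also have "\<dots> \<le> (\<Sum>i<n. \<bar>cmod (w i)\<bar> * \<bar>cmod (v i)\<bar>)"
    by (intro order.trans[OF norm_sum] sum_mono) (simp add: norm_mult)
  also have "\<dots> \<le> W * V" unfolding W_def V_def by (rule L2_set_mult_ineq)
  finally have *: "W * (\<bar>Im z\<bar> * W) \<le> W * V" by (simp add: power2_eq_square algebra_simps)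
  have "0 \<le> W" "0 \<le> V" by (simp_all add: W_def V_def L2_set_nonneg)
  with * show ?thesis unfolding W_def[symmetric] V_def[symmetric]
    by (cases "W = 0") (auto simp: mult_le_cancel_left)
qed

locale symmetric_resolvent =
  fixes n :: nat and A :: "complex Matrix.mat" and z :: complex
  assumes sym: "symmat n A" and z: "Im z \<noteq> 0"
begin

lemmas carrA [simp] = symmatD(1)[OF sym]

abbreviation "Z \<equiv> z \<cdot>\<^sub>m 1\<^sub>m n - A"
abbreviation "G \<equiv> resolvent A z"

lemma carrZ [simp]: "Z \<in> carrier_mat n n" by (intro minus_carrier_mat) simp

lemma dimA [simp]: "dim_row A = n" "dim_col A = n"
  using carrA by (blast dest: carrier_matD)+

lemma Z_entry: "i < n \<Longrightarrow> j < n \<Longrightarrow> Z $$ (i, j) = (if i = j then z else 0) - A $$ (i, j)"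
  by simp

lemma herm: "i < n \<Longrightarrow> j < n \<Longrightarrow> A $$ (j, i) = cnj (A $$ (i, j))"
  using symmatD(2,3)[OF sym, of i j] by (simp add: Reals_cnj_iff)

lemma ZX_entry:
  assumes "X \<in> carrier_mat n k" "i < n" "j < k"
  shows "(Z * X) $$ (i, j) = z * X $$ (i, j) - (\<Sum>l<n. A $$ (i, l) * X $$ (l, j))"
proof -
  have "(Z * X) $$ (i, j) = (\<Sum>l<n. ((if i = l then z else 0) - A $$ (i, l)) * X $$ (l, j))"
    unfolding mat_mult_entry[OF carrZ assms] using assms by (intro sum.cong) (auto simp: Z_entry)
  also have "\<dots> = (\<Sum>l<n. (if i = l then z * X $$ (l, j) else 0)) - (\<Sum>l<n. A $$ (i, l) * X $$ (l, j))"
    unfolding sum_subtractf[symmetric] by (intro sum.cong) (auto simp: algebra_simps)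
  also have "(\<Sum>l<n. (if i = l then z * X $$ (l, j) else 0)) = z * X $$ (i, j)"
    using assms by simp
  finally show ?thesis .
qed

lemma det_nonzero: "Determinant.det Z \<noteq> 0"
proof
  assume "Determinant.det Z = 0"
  then obtain v where v: "v \<in> carrier_vec n" "v \<noteq> 0\<^sub>v n" "Z *\<^sub>v v = 0\<^sub>v n"
    using det_0_iff_vec_prod_zero_field[OF carrZ] by auto
  have "\<bar>Im z\<bar> * L2_set (\<lambda>i. cmod (vec_index v i)) {..<n} \<le> L2_set (\<lambda>i. cmod 0) {..<n}"
  proof (rule resolvent_energy[where A = "\<lambda>i j. A $$ (i, j)"])
    fix i assume i: "i < n"
    have "vec_index (Z *\<^sub>v v) i = (\<Sum>l<n. ((if i = l then z else 0) - A $$ (i, l)) * vec_index v l)"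
      using i v(1) carrA by (auto simp: scalar_prod_def atLeast0LessThan intro!: sum.cong)
    also have "\<dots> = (\<Sum>l<n. (if i = l then z * vec_index v l else 0)) - (\<Sum>l<n. A $$ (i, l) * vec_index v l)"
      unfolding sum_subtractf[symmetric] by (intro sum.cong) (auto simp: algebra_simps)
    finally show "z * vec_index v i - (\<Sum>j<n. A $$ (i, j) * vec_index v j) = 0"
      using i v(3) by simp
  qed (rule herm)
  hence "\<bar>Im z\<bar> * L2_set (\<lambda>i. cmod (vec_index v i)) {..<n} \<le> 0" by (simp add: L2_set_def)
  hence "L2_set (\<lambda>i. cmod (vec_index v i)) {..<n} = 0"
    using z L2_set_nonneg[of "\<lambda>i. cmod (vec_index v i)" "{..<n}"] by (simp add: mult_le_0_iff)
  hence "\<forall>i<n. vec_index v i = 0" by (simp add: L2_set_eq_0_iff)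
  with v(1,2) show False by (metis eq_vecI carrier_vecD index_zero_vec)
qed

lemma carrG [simp]: "G \<in> carrier_mat n n"
  using adj_mat(1)[OF carrZ] carrA by (simp add: resolvent_def Let_def)

lemma Z_mult_G: "Z * G = 1\<^sub>m n"
proof -
  have "Z * G = inverse (Determinant.det Z) \<cdot>\<^sub>m (Z * adj_mat Z)"
    using adj_mat(1)[OF carrZ] carrA
    by (simp add: resolvent_def Let_def mult_smult_distrib[OF carrZ])
  also have "\<dots> = 1\<^sub>m n" unfolding adj_mat(2)[OF carrZ]
    using det_nonzero by (auto simp: one_mat_def)
  finally show ?thesis .
qed

lemma G_mult_Z: "G * Z = 1\<^sub>m n"
  by (rule mat_mult_left_right_inverse[OF carrZ carrG Z_mult_G])

text \<open>The operator norm of the resolvent is at most \<open>1/|Im z|\<close>; in this form, column by column, no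
operator norm has to be introduced.\<close>

lemma frob_G_mult_le:
  assumes X: "X \<in> carrier_mat n k"
  shows "\<bar>Im z\<bar> * frob (G * X) \<le> frob X"
proof (rule power2_le_imp_le)
  let ?Y = "G * X"
  have Y: "?Y \<in> carrier_mat n k" by (rule mult_carrier_mat[OF carrG X])
  have ZY: "Z * ?Y = X"
    using X assoc_mult_mat[OF carrZ carrG X] by (simp add: Z_mult_G)
  have col: "\<bar>Im z\<bar>\<^sup>2 * (\<Sum>i<n. (cmod (?Y $$ (i, j)))\<^sup>2) \<le> (\<Sum>i<n. (cmod (X $$ (i, j)))\<^sup>2)" if "j < k" for j
  proof -
    have "\<bar>Im z\<bar> * L2_set (\<lambda>i. cmod (?Y $$ (i, j))) {..<n} \<le> L2_set (\<lambda>i. cmod (X $$ (i, j))) {..<n}"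
      by (rule resolvent_energy[where A = "\<lambda>i j. A $$ (i, j)"])
        (use that ZX_entry[OF Y] ZY in \<open>auto intro: herm\<close>)
    hence "(\<bar>Im z\<bar> * L2_set (\<lambda>i. cmod (?Y $$ (i, j))) {..<n})\<^sup>2 \<le> (L2_set (\<lambda>i. cmod (X $$ (i, j))) {..<n})\<^sup>2"
      by (intro power_mono) (auto simp: L2_set_nonneg)
    thus ?thesis unfolding power_mult_distrib by (simp add: L2_set_def sum_nonneg)
  qed
  have "(\<bar>Im z\<bar> * frob ?Y)\<^sup>2 = (\<Sum>j<k. \<bar>Im z\<bar>\<^sup>2 * (\<Sum>i<n. (cmod (?Y $$ (i, j)))\<^sup>2))"
    unfolding power_mult_distrib frob_square carrier_matD[OF Y]
    by (subst sum.swap) (simp add: sum_distrib_left)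
  also have "\<dots> \<le> (\<Sum>j<k. \<Sum>i<n. (cmod (X $$ (i, j)))\<^sup>2)"
    by (intro sum_mono col) auto
  also have "\<dots> = (frob X)\<^sup>2" using X by (subst sum.swap) (simp add: frob_square)
  finally show "(\<bar>Im z\<bar> * frob ?Y)\<^sup>2 \<le> (frob X)\<^sup>2" .
qed simp

text \<open>\<open>G\<close> is complex symmetric but not Hermitian, which is why transposes rather than adjoints occur
in the sequel.\<close>

lemma G_transpose: "G\<^sup>T = G"
proof -
  have "Z\<^sup>T = Z"
    using symmatD(3)[OF sym] carrA by (auto simp: Z_entry)
  hence "G\<^sup>T * Z = 1\<^sub>m n"
    using arg_cong[OF Z_mult_G, of transpose_mat] transpose_mult[OF carrZ carrG] by simp
  hence "G\<^sup>T * (Z * G) = G"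
    using assoc_mult_mat[of "G\<^sup>T" n n Z n G n] carrG by (simp add: left_mult_one_mat[OF carrG])
  thus ?thesis using carrG by (simp add: Z_mult_G)
qed

lemma frob_mult_G_le:
  assumes X: "X \<in> carrier_mat k n"
  shows "\<bar>Im z\<bar> * frob (X * G) \<le> frob X"
  using frob_G_mult_le[of "X\<^sup>T" k] X transpose_mult[OF X carrG] frob_transpose[of "X * G"]
  by (simp add: G_transpose)

lemma frob_G_le: "\<bar>Im z\<bar> * frob G \<le> sqrt n"
  using frob_G_mult_le[of "1\<^sub>m n" n] carrG by (simp add: frob_one)

end

lemma resolvent_diff:
  assumes A: "symmat n A" and B: "symmat n B" and z: "Im z \<noteq> 0"
  shows "resolvent A z - resolvent B z = resolvent A z * (A - B) * resolvent B z"
proof -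
  interpret A: symmetric_resolvent n A z using A z by unfold_locales
  interpret B: symmetric_resolvent n B z using B z by unfold_locales
  have AB: "A - B = B.Z - A.Z"
    using A.carrA B.carrA by (intro eq_matI) (auto simp: A.Z_entry B.Z_entry)
  have "A.G * (A - B) * B.G = (A.G * B.Z - A.G * A.Z) * B.G"
    unfolding AB by (subst mult_minus_distrib_mat[OF A.carrG B.carrZ A.carrZ]) simp
  also have "\<dots> = A.G * B.Z * B.G - A.G * A.Z * B.G"
    by (rule minus_mult_distrib_mat[OF mult_carrier_mat[OF A.carrG B.carrZ] mult_carrier_mat[OF A.carrG A.carrZ] B.carrG])
  also have "A.G * B.Z * B.G = A.G"
    by (simp add: assoc_mult_mat[OF A.carrG B.carrZ B.carrG] B.Z_mult_G right_mult_one_mat[OF A.carrG])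
  also have "A.G * A.Z * B.G = B.G" by (simp add: A.G_mult_Z left_mult_one_mat[OF B.carrG])
  finally show ?thesis ..
qed

text \<open>For a perturbation of the form \<open>V V\<^sup>T\<close> both resolvents act on \<open>V\<close>, so the trace is
controlled by \<open>|V|\<^sup>2\<close>. Bounding \<open>G (V V\<^sup>T) G'\<close> by its Frobenius norm instead would cost a factor
\<open>\<surd>n\<close> when the trace is taken.\<close>

lemma (in symmetric_resolvent) trace_resolvent_gram_le:
  assumes V: "V \<in> carrier_mat n k" and B: "symmat n B"
  shows "(Im z)\<^sup>2 * cmod (mat_trace (resolvent A z * (V * V\<^sup>T) * resolvent B z)) \<le> (frob V)\<^sup>2"
proof -
  interpret B: symmetric_resolvent n B z using B z by unfold_locales
  have GV: "G * V \<in> carrier_mat n k" by (rule mult_carrier_mat[OF carrG V])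
  have VT: "V\<^sup>T \<in> carrier_mat k n" using V by simp
  have VG: "V\<^sup>T * B.G \<in> carrier_mat k n" by (rule mult_carrier_mat[OF VT B.carrG])
  have "G * (V * V\<^sup>T) * B.G = (G * V) * (V\<^sup>T * B.G)"
    unfolding assoc_mult_mat[OF carrG V VT, symmetric]
    by (rule assoc_mult_mat[OF GV VT B.carrG])
  hence "(Im z)\<^sup>2 * cmod (mat_trace (G * (V * V\<^sup>T) * B.G))
      \<le> \<bar>Im z\<bar>\<^sup>2 * (frob (G * V) * frob (V\<^sup>T * B.G))"
    using norm_mat_trace_mult_le[OF GV VG] by (simp add: mult_left_mono)
  also have "\<dots> = (\<bar>Im z\<bar> * frob (G * V)) * (\<bar>Im z\<bar> * frob (V\<^sup>T * B.G))"
    by (simp add: power2_eq_square algebra_simps)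
  also have "\<dots> \<le> frob V * frob V"
    using frob_G_mult_le[OF V] B.frob_mult_G_le[OF VT] by (intro mult_mono) auto
  finally show ?thesis by (simp add: power2_eq_square)
qed

text \<open>The bound does not depend on \<open>t\<close> or \<open>V\<close>. With \<open>w = G V\<close> and \<open>\<beta> = V\<^sup>T G V\<close> the difference of the
traces is \<open>t w\<^sup>T w / (1 - t \<beta>)\<close>. Here \<open>|w\<^sup>T w|\<close> is at most \<open>S = |w|\<^sup>2\<close>, while \<open>Im \<beta> = - S Im z\<close>, so
the denominator has absolute value at least \<open>|t| S |Im z|\<close>.\<close>

lemma trace_resolvent_rank_one:
  assumes A: "symmat n A" and A': "symmat n A'" and z: "Im z \<noteq> 0"
    and V: "V \<in> carrier_mat n 1" "\<And>i. i < n \<Longrightarrow> V $$ (i, 0) \<in> \<real>"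
    and diff: "A' - A = of_real t \<cdot>\<^sub>m (V * V\<^sup>T)"
  shows "\<bar>Im z\<bar> * cmod (mat_trace (resolvent A' z) - mat_trace (resolvent A z)) \<le> 1"
proof -
  interpret A: symmetric_resolvent n A z using A z by unfold_locales
  interpret A': symmetric_resolvent n A' z using A' z by unfold_locales
  define W where "W = A.G * V"
  define W' where "W' = A'.G * V"
  define w where "w = (\<lambda>i. W $$ (i, 0))"
  define w' where "w' = (\<lambda>i. W' $$ (i, 0))"
  define v where "v = (\<lambda>i. V $$ (i, 0))"
  define \<beta> where "\<beta> = (\<Sum>i<n. w i * v i)"
  define S where "S = (\<Sum>i<n. (cmod (w i))\<^sup>2)"
  define D where "D = mat_trace (A'.G) - mat_trace (A.G)"
  have W: "W \<in> carrier_mat n 1" unfolding W_def by (rule mult_carrier_mat[OF A.carrG V(1)])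
  have W': "W' \<in> carrier_mat n 1" unfolding W'_def by (rule mult_carrier_mat[OF A'.carrG V(1)])
  have VT: "V\<^sup>T \<in> carrier_mat 1 n" using V by simp
  have WT: "W\<^sup>T \<in> carrier_mat 1 n" using W by simp
  have VTG: "V\<^sup>T * A.G = W\<^sup>T"
    using transpose_mult[OF A.carrG V(1)] by (simp add: W_def A.G_transpose)
  have "A'.G - A.G = A'.G * (of_real t \<cdot>\<^sub>m (V * V\<^sup>T)) * A.G"
    using resolvent_diff[OF A' A z] diff by simp
  also have "\<dots> = of_real t \<cdot>\<^sub>m (A'.G * (V * V\<^sup>T) * A.G)"
    by (simp add: mult_smult_distrib[OF A'.carrG mult_carrier_mat[OF V(1) VT]]
        mult_smult_assoc_mat[OF mult_carrier_mat[OF A'.carrG mult_carrier_mat[OF V(1) VT]] A.carrG])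
  also have "A'.G * (V * V\<^sup>T) * A.G = W' * W\<^sup>T"
    unfolding assoc_mult_mat[OF A'.carrG V(1) VT, symmetric] W'_def[symmetric] VTG[symmetric]
    by (rule assoc_mult_mat[OF W' VT A.carrG])
  finally have GG: "A'.G - A.G = of_real t \<cdot>\<^sub>m (W' * W\<^sup>T)" .
  have D: "D = of_real t * (\<Sum>i<n. w' i * w i)"
    unfolding D_def mat_trace_diff[OF A'.carrG A.carrG, symmetric] GG
      mat_trace_smult[OF mult_carrier_mat[OF W' WT]] mat_trace_mult[OF W' WT]
    using W by (simp add: w_def w'_def)
  have "W' - W = (A'.G - A.G) * V"
    unfolding W'_def W_def by (rule minus_mult_distrib_mat[symmetric, OF A'.carrG A.carrG V(1)])
  also have "\<dots> = of_real t \<cdot>\<^sub>m (W' * W\<^sup>T * V)"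
    unfolding GG by (rule mult_smult_assoc_mat[OF mult_carrier_mat[OF W' WT] V(1)])
  also have "W' * W\<^sup>T * V = W' * (W\<^sup>T * V)"
    by (rule assoc_mult_mat[OF W' WT V(1)])
  finally have WW: "W' - W = of_real t \<cdot>\<^sub>m (W' * (W\<^sup>T * V))" .
  have "(W\<^sup>T * V) $$ (0, 0) = \<beta>"
    using W by (subst mat_mult_entry[OF WT V(1)]) (auto simp: \<beta>_def w_def v_def)
  hence "(W' * (W\<^sup>T * V)) $$ (i, 0) = w' i * \<beta>" if "i < n" for i
    using that by (subst mat_mult_entry[OF W' mult_carrier_mat[OF WT V(1)]])
      (auto simp: w'_def simp del: index_mult_mat(1))
  moreover have "(W' - W) $$ (i, 0) = w' i - w i" if "i < n" for i
    using that W W' by (auto simp: w_def w'_def)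
  moreover have "(of_real t \<cdot>\<^sub>m (W' * (W\<^sup>T * V))) $$ (i, 0) = of_real t * (W' * (W\<^sup>T * V)) $$ (i, 0)"
    if "i < n" for i
    using that W' V(1) by (intro index_smult_mat) auto
  ultimately have w: "w i = (1 - of_real t * \<beta>) * w' i" if "i < n" for i
    using that WW by (simp add: algebra_simps)
  have "(1 - of_real t * \<beta>) * D = of_real t * (\<Sum>i<n. w i * w i)"
  proof -
    have "(1 - of_real t * \<beta>) * D = of_real t * (\<Sum>i<n. (1 - of_real t * \<beta>) * w' i * w i)"
      unfolding D by (simp add: sum_distrib_left mult_ac)
    also have "(\<Sum>i<n. (1 - of_real t * \<beta>) * w' i * w i) = (\<Sum>i<n. w i * w i)"
      by (intro sum.cong refl) (simp add: w)
    finally show ?thesis .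
  qed
  moreover have "cmod (\<Sum>i<n. w i * w i) \<le> S"
    unfolding S_def by (intro order.trans[OF norm_sum] sum_mono) (simp add: norm_mult power2_eq_square)
  ultimately have 1: "cmod (1 - of_real t * \<beta>) * cmod D \<le> \<bar>t\<bar> * S"
    unfolding norm_mult[symmetric] by (simp add: norm_mult mult_left_mono)
  have "A.Z * W = V"
    unfolding W_def using assoc_mult_mat[OF A.carrZ A.carrG V(1)] V by (simp add: A.Z_mult_G)
  hence "Im (\<Sum>i<n. cnj (w i) * v i) = Im z * S"
    unfolding S_def
    by (intro resolvent_quadratic_form[where A = "\<lambda>i j. A $$ (i, j)"])
      (use A.ZX_entry[OF W] in \<open>auto intro: A.herm simp: w_def v_def\<close>)
  moreover have "(\<Sum>i<n. cnj (w i) * v i) = cnj \<beta>"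
    using V(2) by (auto simp: \<beta>_def v_def Reals_cnj_iff intro!: sum.cong)
  ultimately have "Im \<beta> = - (Im z * S)" by simp
  hence "Im (1 - of_real t * \<beta>) = t * (Im z * S)" by simp
  hence "\<bar>t\<bar> * S * \<bar>Im z\<bar> \<le> cmod (1 - of_real t * \<beta>)"
    using abs_Im_le_cmod[of "1 - of_real t * \<beta>"] by (simp add: abs_mult S_def sum_nonneg mult_ac)
  hence 2: "\<bar>t\<bar> * S * \<bar>Im z\<bar> * cmod D \<le> \<bar>t\<bar> * S" using 1 by (meson mult_right_mono norm_ge_zero order_trans)
  show ?thesis
  proof (cases "\<bar>t\<bar> * S = 0")
    case True
    hence "t = 0 \<or> (\<forall>i<n. w i = 0)" by (auto simp: S_def sum_nonneg_eq_0_iff)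
    hence "D = 0" by (auto simp: D)
    thus ?thesis by (simp add: D_def)
  next
    case False
    hence "0 < \<bar>t\<bar> * S" by (simp add: S_def sum_nonneg less_le)
    moreover have "(\<bar>t\<bar> * S) * (\<bar>Im z\<bar> * cmod D) \<le> (\<bar>t\<bar> * S) * 1" using 2 by (simp add: mult_ac)
    ultimately show ?thesis unfolding D_def using mult_le_cancel_left_pos by blast
  qed
qed

section \<open>The trace of the resolvent and the eigenvalues\<close>

lemma poly_char_poly:
  fixes A :: "complex Matrix.mat"
  assumes "A \<in> carrier_mat n n"
  shows "poly (char_poly A) z = Determinant.det (z \<cdot>\<^sub>m 1\<^sub>m n - A)"
proof -
  have "- char_matrix A z = z \<cdot>\<^sub>m 1\<^sub>m n - A"
    using assms by (intro eq_matI) (auto simp: char_matrix_def)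
  thus ?thesis using char_poly_matrix[OF assms] by simp
qed

text \<open>The diagonal cofactors of \<open>z - A\<close> are characteristic polynomials of principal submatrices, and
their sum is the derivative of the characteristic polynomial.\<close>

lemma mat_trace_resolvent_pderiv:
  assumes A: "A \<in> carrier_mat n n"
  shows "mat_trace (resolvent A z) = poly (pderiv (char_poly A)) z / poly (char_poly A) z"
proof -
  let ?Z = "z \<cdot>\<^sub>m 1\<^sub>m n - A"
  have Z: "?Z \<in> carrier_mat n n" by (rule minus_carrier_mat[OF A])
  have "cofactor ?Z i i = poly (char_poly (mat_delete A i i)) z" if "i < n" for i
  proof -
    have d: "mat_delete A i i \<in> carrier_mat (n - 1) (n - 1)" by (rule mat_delete_carrier[OF A])
    have "mat_delete ?Z i i = z \<cdot>\<^sub>m 1\<^sub>m (n - 1) - mat_delete A i i"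
      using A that by (intro eq_matI) (auto simp: mat_delete_def)
    thus ?thesis by (simp add: cofactor_def poly_char_poly[OF d])
  qed
  hence "mat_trace (adj_mat ?Z) = (\<Sum>i<n. poly (char_poly (mat_delete A i i)) z)"
    using A by (auto simp: mat_trace_def adj_mat_def)
  also have "\<dots> = poly (pderiv (char_poly A)) z"
    by (simp add: pderiv_char_poly[OF A] poly_sum)
  finally show ?thesis
    using A adj_mat(1)[OF Z] by (simp add: resolvent_def Let_def mat_trace_smult poly_char_poly[OF A] divide_inverse mult.commute)
qed

lemma log_deriv_prod_list:
  fixes z :: "'a :: field_char_0"
  assumes "\<forall>a\<in>set as. z \<noteq> a"
  shows "poly (pderiv (\<Prod>a\<leftarrow>as. [:- a, 1:])) z / poly (\<Prod>a\<leftarrow>as. [:- a, 1:]) z = (\<Sum>a\<leftarrow>as. 1 / (z - a))"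
  using assms
proof (induction as)
  case (Cons a as)
  have nz: "poly (\<Prod>a\<leftarrow>as. [:- a, 1:]) z \<noteq> 0"
    using Cons.prems by (auto simp: poly_prod_list prod_list_zero_iff o_def)
  have "z - a \<noteq> 0" using Cons.prems by auto
  with nz Cons show ?case
    by (simp add: pderiv_mult pderiv_pCons divide_simps del: mult_pCons_left) (auto simp: algebra_simps)
qed auto

lemma map_poly_prod_list_linear:
  "map_poly complex_of_real (\<Prod>b\<leftarrow>bs. [:- b, 1:]) = (\<Prod>b\<leftarrow>bs. [:- complex_of_real b, 1:])"
proof -
  interpret h: map_poly_comm_ring_hom complex_of_real ..
  show ?thesis by (induction bs) (simp_all add: h.hom_mult map_poly_pCons del: mult_pCons_left)
qed

text \<open>A complex root of the characteristic polynomial off the real axis would make \<open>z - A\<close> singular at a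
point where the resolvent exists.\<close>

lemma symmetric_char_poly_splits:
  assumes R: "R \<in> carrier_mat n n" and sym: "\<And>i j. i < n \<Longrightarrow> j < n \<Longrightarrow> R $$ (j, i) = R $$ (i, j)"
  obtains bs :: "real list" where "char_poly R = (\<Prod>b\<leftarrow>bs. [:- b, 1:])" "length bs = n"
proof -
  let ?A = "map_mat complex_of_real R"
  have A: "?A \<in> carrier_mat n n" using R by simp
  have S: "symmat n ?A" using R sym by (auto simp: symmat_def)
  obtain as where as: "char_poly ?A = (\<Prod>a\<leftarrow>as. [:- a, 1:])" "length as = n"
    using char_poly_factorized[OF A] by auto
  have real: "Im a = 0" if "a \<in> set as" for a
  proof (rule ccontr)
    assume "Im a \<noteq> 0"
    then interpret symmetric_resolvent n ?A a using S by unfold_locales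
    have "poly (char_poly ?A) a = 0"
      unfolding as(1) using that by (auto simp: poly_prod_list prod_list_zero_iff image_iff)
    thus False using det_nonzero poly_char_poly[OF A] by simp
  qed
  define bs where "bs = map Re as"
  have as_bs: "as = map complex_of_real bs"
    unfolding bs_def using real by (auto simp: complex_eq_iff intro!: nth_equalityI)
  have "map_poly complex_of_real (char_poly R) = char_poly ?A"
    by (rule of_real_hom.char_poly_hom[OF R, symmetric])
  also have "\<dots> = map_poly complex_of_real (\<Prod>b\<leftarrow>bs. [:- b, 1:])"
    unfolding as(1) map_poly_prod_list_linear as_bs by (simp add: o_def)
  finally have "char_poly R = (\<Prod>b\<leftarrow>bs. [:- b, 1:])"
    by (metis (no_types, lifting) coeff_map_poly of_real_0 of_real_eq_iff poly_eqI)
  moreover have "length bs = n" using as(2) by (simp add: bs_def)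
  ultimately show thesis by (rule that)
qed

lemma proots_prod_list_linear: "proots (\<Prod>b\<leftarrow>bs. [:- b, 1:]) = mset (bs :: real list)"
proof (induction bs)
  case (Cons b bs)
  have "(\<Prod>b\<leftarrow>bs. [:- b, 1:]) \<noteq> 0" by (auto simp: prod_list_zero_iff)
  thus ?case using Cons by (simp add: proots_mult del: mult_pCons_left)
qed simp

lemma size_proots_symmetric:
  fixes R :: "real Matrix.mat"
  assumes R: "R \<in> carrier_mat n n" and sym: "\<And>i j. i < n \<Longrightarrow> j < n \<Longrightarrow> R $$ (j, i) = R $$ (i, j)"
  shows "size (proots (char_poly R)) = n"
  using symmetric_char_poly_splits[of R n, OF assms] by (metis proots_prod_list_linear size_mset)

theorem mat_trace_resolvent_eigenvalues:
  assumes R: "R \<in> carrier_mat n n" and sym: "\<And>i j. i < n \<Longrightarrow> j < n \<Longrightarrow> R $$ (j, i) = R $$ (i, j)"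
    and z: "Im z \<noteq> 0"
  shows "mat_trace (resolvent (map_mat complex_of_real R) z) = (\<Sum>x\<in>#proots (char_poly R). 1 / (z - of_real x))"
proof -
  obtain bs where bs: "char_poly R = (\<Prod>b\<leftarrow>bs. [:- b, 1:])" "length bs = n"
    using symmetric_char_poly_splits[of R n, OF R sym] by auto
  have A: "map_mat complex_of_real R \<in> carrier_mat n n" using R by simp
  have cp: "char_poly (map_mat complex_of_real R) = (\<Prod>a\<leftarrow>map complex_of_real bs. [:- a, 1:])"
    unfolding of_real_hom.char_poly_hom[OF R] bs(1) map_poly_prod_list_linear by (simp add: o_def)
  have "mat_trace (resolvent (map_mat complex_of_real R) z) = (\<Sum>a\<leftarrow>map complex_of_real bs. 1 / (z - a))"
    unfolding mat_trace_resolvent_pderiv[OF A] cp using z by (intro log_deriv_prod_list) auto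
  thus ?thesis
    unfolding bs(1) proots_prod_list_linear by (simp add: o_def sum_mset_sum_list[symmetric])
qed

section \<open>Measurability of resolvents\<close>

lemma borel_measurable_det:
  fixes f :: "'b \<Rightarrow> complex Matrix.mat"
  assumes "\<And>x. f x \<in> carrier_mat n n"
    and "\<And>i j. i < n \<Longrightarrow> j < n \<Longrightarrow> (\<lambda>x. f x $$ (i, j)) \<in> borel_measurable M"
  shows "(\<lambda>x. Determinant.det (f x)) \<in> borel_measurable M"
proof -
  have eq: "(\<lambda>x. Determinant.det (f x)) =
      (\<lambda>x. \<Sum>p | p permutes {0..<n}. signof p * (\<Prod>i = 0..<n. f x $$ (i, p i)))"
    using det_def'[OF assms(1)] by simp
  show ?thesis unfolding eq
    by (intro borel_measurable_sum borel_measurable_times borel_measurable_prod borel_measurable_const assms(2))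
       (auto dest: permutes_in_image)
qed

lemma borel_measurable_resolvent:
  fixes f :: "'b \<Rightarrow> complex Matrix.mat"
  assumes car: "\<And>x. f x \<in> carrier_mat n n"
    and f: "\<And>i j. i < n \<Longrightarrow> j < n \<Longrightarrow> (\<lambda>x. f x $$ (i, j)) \<in> borel_measurable M"
    and g: "g \<in> borel_measurable M"
    and i: "i < n" and j: "j < n"
  shows "(\<lambda>x. resolvent (f x) (g x) $$ (i, j)) \<in> borel_measurable M"
proof -
  let ?Z = "\<lambda>x. g x \<cdot>\<^sub>m 1\<^sub>m n - f x"
  have Z: "?Z x \<in> carrier_mat n n" for x by (rule minus_carrier_mat[OF car])
  have mZ: "(\<lambda>x. ?Z x $$ (i, j)) \<in> borel_measurable M" if "i < n" "j < n" for i j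
  proof -
    have "(\<lambda>x. ?Z x $$ (i, j)) = (\<lambda>x. g x * (if i = j then 1 else 0) - f x $$ (i, j))"
      using that carrier_matD[OF car] by (auto simp: fun_eq_iff)
    also have "\<dots> \<in> borel_measurable M"
      by (intro borel_measurable_diff borel_measurable_times g f that borel_measurable_const)
    finally show ?thesis .
  qed
  have del: "(\<lambda>x. Determinant.det (mat_delete (?Z x) j i)) \<in> borel_measurable M"
  proof (rule borel_measurable_det)
    show "mat_delete (?Z x) j i \<in> carrier_mat (n - 1) (n - 1)" for x
      by (rule mat_delete_carrier[OF Z])
    fix a b assume ab: "a < n - 1" "b < n - 1"
    have "mat_delete (?Z x) j i $$ (a, b) = ?Z x $$ (insert_index j a, insert_index i b)" for x
      using mat_delete_index[of "?Z x" "n - 1" j i a b] Z[of x] i j ab by simp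
    thus "(\<lambda>x. mat_delete (?Z x) j i $$ (a, b)) \<in> borel_measurable M"
      using ab i j by (auto simp: insert_index_def intro!: mZ)
  qed
  have "resolvent (f x) (g x) $$ (i, j) =
      inverse (Determinant.det (?Z x)) * ((-1) ^ (j + i) * Determinant.det (mat_delete (?Z x) j i))" for x
  proof -
    have "dim_row (f x) = n" using car by auto
    thus ?thesis using i j Z[of x] car[of x] by (auto simp: resolvent_def Let_def adj_mat_def cofactor_def)
  qed
  thus ?thesis
    by (simp del: inverse_eq_divide) (intro borel_measurable_times borel_measurable_const borel_measurable_inverse
        borel_measurable_det[OF Z mZ] del)
qed

section \<open>Counting edges through given vertices\<close>

definition edge_sets :: "nat \<Rightarrow> nat \<Rightarrow> nat set set" where
  "edge_sets n r = {E. E \<subseteq> {1..n} \<and> card E = r}"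

lemma finite_edge_sets [simp]: "finite (edge_sets n r)"
  by (rule finite_subset[of _ "Pow {1..n}"]) (auto simp: edge_sets_def)

lemma card_edge_sets: "card (edge_sets n r) = n choose r"
  using n_subsets[of "{1..n}" r] by (simp add: edge_sets_def)

lemma card_edge_sets_superset:
  assumes S: "S \<subseteq> {1..n}"
  shows "card {E \<in> edge_sets n r. S \<subseteq> E} = (if card S \<le> r then (n - card S) choose (r - card S) else 0)"
proof (cases "card S \<le> r")
  case True
  have fS: "finite S" using S finite_subset by blast
  have "bij_betw (\<lambda>E. E - S) {E \<in> edge_sets n r. S \<subseteq> E} {B. B \<subseteq> {1..n} - S \<and> card B = r - card S}"
  proof (rule bij_betw_byWitness[where f' = "\<lambda>B. B \<union> S"])
    show "(\<lambda>B. B \<union> S) ` {B. B \<subseteq> {1..n} - S \<and> card B = r - card S} \<subseteq> {E \<in> edge_sets n r. S \<subseteq> E}"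
    proof clarify
      fix B assume B: "B \<subseteq> {1..n} - S" "card B = r - card S"
      have "finite B" using B(1) finite_subset by blast
      hence "card (B \<union> S) = r" using B True fS by (subst card_Un_disjoint) auto
      thus "B \<union> S \<in> edge_sets n r \<and> S \<subseteq> B \<union> S" using B S by (auto simp: edge_sets_def)
    qed
  qed (use fS in \<open>auto simp: edge_sets_def card_Diff_subset\<close>)
  hence "card {E \<in> edge_sets n r. S \<subseteq> E} = card ({1..n} - S) choose (r - card S)"
    using bij_betw_same_card n_subsets[of "{1..n} - S"] by fastforce
  thus ?thesis using True S fS by (simp add: card_Diff_subset)
next
  case False
  have "{E \<in> edge_sets n r. S \<subseteq> E} = {}"
  proof (safe, simp)
    fix E assume E: "E \<in> edge_sets n r" "S \<subseteq> E"
    hence "finite E" using finite_subset[of E "{1..n}"] by (auto simp: edge_sets_def)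
    with E card_mono[of E S] False show False by (auto simp: edge_sets_def)
  qed
  thus ?thesis using False by simp
qed

text \<open>The correlation of two entries of \<open>H\<close> whose index pairs share exactly one vertex: it is the
proportion, among the \<open>N\<close> edges through two given vertices, of those that contain a third one.\<close>

definition corr1 :: "nat \<Rightarrow> nat \<Rightarrow> real" where
  "corr1 n r = (real r - 2) / (real n - 2)"

text \<open>The correlation of two entries of \<open>H\<close> with disjoint index pairs.\<close>

definition corr2 :: "nat \<Rightarrow> nat \<Rightarrow> real" where
  "corr2 n r = (real r - 2) * (real r - 3) / ((real n - 2) * (real n - 3))"

lemma superset_count_2:
  assumes "2 \<le> r" "S \<subseteq> {1..n}" "card S = 2"
  shows "card {E \<in> edge_sets n r. S \<subseteq> E} = num_edges_pair n r"
  using assms by (simp add: card_edge_sets_superset num_edges_pair_def)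

lemma binomial_ratio: "real (b choose a) = real (Suc b choose Suc a) * ((real a + 1) / (real b + 1))"
proof -
  have "(real a + 1) * real (Suc b choose Suc a) = (real b + 1) * real (b choose a)"
    using arg_cong[OF Suc_times_binomial[of a b], of real] by (simp only: of_nat_mult of_nat_Suc add.commute)
  moreover have "real b + 1 > 0" by linarith
  ultimately show ?thesis by (simp add: divide_simps mult.commute del: binomial_Suc_Suc)
qed

lemma superset_count_3:
  assumes "2 \<le> r" "r \<le> n" "4 \<le> n" "S \<subseteq> {1..n}" "card S = 3"
  shows "real (card {E \<in> edge_sets n r. S \<subseteq> E}) = num_edges_pair n r * corr1 n r"
proof (cases "r = 2")
  case False
  define a b where "a = r - 3" and "b = n - 3"
  have ab: "r = a + 3" "n = b + 3" using False assms by (auto simp: a_def b_def)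
  have "real (b choose a) = real (Suc b choose Suc a) * ((real a + 1) / (real b + 1))"
    by (rule binomial_ratio)
  thus ?thesis
    using assms by (simp add: card_edge_sets_superset num_edges_pair_def corr1_def ab numeral_eq_Suc add.commute)
qed (use assms in \<open>simp add: card_edge_sets_superset corr1_def\<close>)

lemma superset_count_4:
  assumes "2 \<le> r" "r \<le> n" "4 \<le> n" "S \<subseteq> {1..n}" "card S = 4"
  shows "real (card {E \<in> edge_sets n r. S \<subseteq> E}) = num_edges_pair n r * corr2 n r"
proof (cases "r \<le> 3")
  case True
  hence "r = 2 \<or> r = 3" using assms by auto
  thus ?thesis using assms by (auto simp: card_edge_sets_superset corr2_def)
next
  case False
  define a b where "a = r - 4" and "b = n - 4"
  have ab: "r = a + 4" "n = b + 4" using False assms by (auto simp: a_def b_def)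
  have "real (b choose a) = real (Suc (Suc b) choose Suc (Suc a)) * ((real a + 2) * (real a + 1) / ((real b + 2) * (real b + 1)))"
    unfolding binomial_ratio[of b a] binomial_ratio[of "Suc b" "Suc a"]
    by (simp add: add.commute mult.assoc times_divide_times_eq del: binomial_Suc_Suc)
  moreover have "num_edges_pair n r = Suc (Suc b) choose Suc (Suc a)" "card {E \<in> edge_sets n r. S \<subseteq> E} = b choose a"
    using assms by (simp_all add: card_edge_sets_superset num_edges_pair_def ab numeral_eq_Suc del: binomial_Suc_Suc)
  moreover have "corr2 n r = (real a + 2) * (real a + 1) / ((real b + 2) * (real b + 1))"
    by (simp add: corr2_def ab add.commute)
  ultimately show ?thesis by simp
qed

definition edge_entry :: "nat set \<Rightarrow> nat \<Rightarrow> nat \<Rightarrow> complex" where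
  "edge_entry E i j = (if i \<noteq> j \<and> Suc i \<in> E \<and> Suc j \<in> E then 1 else 0)"

text \<open>The number of edges containing \<open>i\<close>, \<open>j\<close>, \<open>k\<close>, \<open>m\<close> is \<open>N\<close>, \<open>N corr1\<close> or \<open>N corr2\<close> according to whether
two, three or four of these vertices are distinct. The right-hand side writes this function of the
coincidences as a combination of indicators. Its last coefficient, which belongs to equal pairs, is
what is left of the variance once the first two terms have been removed by centering.\<close>

lemma sum_edge_entry_products:
  assumes r: "2 \<le> r" "r \<le> n" "4 \<le> n" and i: "i < n" "j < n" "k < n" "m < n"
  shows "(\<Sum>E\<in>edge_sets n r. edge_entry E i j * edge_entry E k m) = 
    of_nat (num_edges_pair n r) * (if i \<noteq> j \<and> k \<noteq> m then
      of_real (corr2 n r) + of_real (corr1 n r - corr2 n r) *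
        (of_bool (j = k) + of_bool (j = m) + of_bool (i = k) + of_bool (i = m))
      + of_real (1 - 2 * corr1 n r + corr2 n r) * (of_bool (j = k \<and> i = m) + of_bool (j = m \<and> i = k)) else 0)"
proof (cases "i \<noteq> j \<and> k \<noteq> m")
  case True
  let ?S = "{Suc i, Suc j, Suc k, Suc m}"
  have S: "?S \<subseteq> {1..n}" using i by auto
  have "(\<Sum>E\<in>edge_sets n r. edge_entry E i j * edge_entry E k m)
      = (\<Sum>E\<in>edge_sets n r. if ?S \<subseteq> E then 1 else 0)"
    using True by (intro sum.cong) (auto simp: edge_entry_def)
  also have "\<dots> = of_nat (card {E \<in> edge_sets n r. ?S \<subseteq> E})"
    by (simp add: sum.If_cases Int_def)
  finally have *: "(\<Sum>E\<in>edge_sets n r. edge_entry E i j * edge_entry E k m) 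
      = of_real (real (card {E \<in> edge_sets n r. ?S \<subseteq> E}))" by simp
  consider "j = k" "i = m" | "j = m" "i = k"
    | "j = k" "i \<noteq> m" "j \<noteq> m" "i \<noteq> k" | "j \<noteq> k" "i = m" "j \<noteq> m" "i \<noteq> k"
    | "j \<noteq> k" "i \<noteq> m" "j = m" "i \<noteq> k" | "j \<noteq> k" "i \<noteq> m" "j \<noteq> m" "i = k"
    | "j \<noteq> k" "i \<noteq> m" "j \<noteq> m" "i \<noteq> k"
    using True by metis
  thus ?thesis
  proof cases
    case 1
    hence c: "card ?S = 2" using True by (auto simp: card_insert_if)
    show ?thesis unfolding * superset_count_2[OF r(1) S c] using 1 True by simp
  next
    case 2
    hence c: "card ?S = 2" using True by (auto simp: card_insert_if)
    show ?thesis unfolding * superset_count_2[OF r(1) S c] using 2 True by simp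
  next
    case 3
    hence c: "card ?S = 3" using True by (auto simp: card_insert_if)
    show ?thesis unfolding * superset_count_3[OF r S c] using 3 True by simp
  next
    case 4
    hence c: "card ?S = 3" using True by (auto simp: card_insert_if)
    show ?thesis unfolding * superset_count_3[OF r S c] using 4 True by simp
  next
    case 5
    hence c: "card ?S = 3" using True by (auto simp: card_insert_if)
    show ?thesis unfolding * superset_count_3[OF r S c] using 5 True by simp
  next
    case 6
    hence c: "card ?S = 3" using True by (auto simp: card_insert_if)
    show ?thesis unfolding * superset_count_3[OF r S c] using 6 True by simp
  next
    case 7
    hence c: "card ?S = 4" using True by (auto simp: card_insert_if)
    show ?thesis unfolding * superset_count_4[OF r S c] using 7 True by simp
  qed
next
  case False
  hence 0: "edge_entry E i j * edge_entry E k m = 0" for E by (auto simp: edge_entry_def)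
  show ?thesis unfolding if_not_P[OF False] 0 by (simp only: sum.neutral_const mult_zero_right)
qed

section \<open>Contractions of a matrix with vanishing row and column sums\<close>

lemma sum_off: 
  fixes f :: "nat \<Rightarrow> 'b :: ab_group_add"
  assumes "j < n" shows "(\<Sum>i<n. if i \<noteq> j then f i else 0) = (\<Sum>i<n. f i) - f j"
proof -
  have "(\<Sum>i<n. f i) = f j + (\<Sum>i\<in>{..<n} - {j}. f i)" using assms by (simp add: sum.remove)
  also have "(\<Sum>i\<in>{..<n} - {j}. f i) = (\<Sum>i<n. if i \<noteq> j then f i else 0)"
    by (intro sum.mono_neutral_cong_left) auto
  finally show ?thesis by simp
qed

lemma sum4_reorder:
  fixes f :: "nat \<Rightarrow> nat \<Rightarrow> nat \<Rightarrow> nat \<Rightarrow> complex"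
  shows "(\<Sum>i<n. \<Sum>j<n. \<Sum>k<n. \<Sum>m<n. f i j k m) = (\<Sum>j<n. \<Sum>k<n. \<Sum>m<n. \<Sum>i<n. f i j k m)"
proof -
  have "(\<Sum>i<n. \<Sum>j<n. \<Sum>k<n. \<Sum>m<n. f i j k m) = (\<Sum>j<n. \<Sum>i<n. \<Sum>k<n. \<Sum>m<n. f i j k m)"
    by (rule sum.swap)
  also have "\<dots> = (\<Sum>j<n. \<Sum>k<n. \<Sum>i<n. \<Sum>m<n. f i j k m)"
    by (intro sum.cong refl sum.swap)
  also have "\<dots> = (\<Sum>j<n. \<Sum>k<n. \<Sum>m<n. \<Sum>i<n. f i j k m)"
    by (intro sum.cong refl sum.swap)
  finally show ?thesis .
qed

text \<open>The indices come from \<open>tr (Q W Q W) = \<Sum> Q\<^sub>i\<^sub>j W\<^sub>j\<^sub>k Q\<^sub>k\<^sub>m W\<^sub>m\<^sub>i\<close>, and the condition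
\<open>i \<noteq> j \<and> k \<noteq> m\<close> from the zero diagonal of \<open>Q\<close>. Each name below lists the coincidences that are
imposed. A free index would sum to zero by the hypotheses, so summing over it only leaves the
excluded term with the opposite sign; therefore every pattern collapses to a quadratic expression
in the entries of \<open>W\<close>, and \<open>(tr W)\<^sup>2\<close> is the only one that is not bounded by \<open>|W|\<^sup>2\<close>.\<close>

context
  fixes n :: nat and W :: "nat \<Rightarrow> nat \<Rightarrow> complex"
  assumes row0: "\<And>i. i < n \<Longrightarrow> (\<Sum>j<n. W i j) = 0"
    and col0: "\<And>j. j < n \<Longrightarrow> (\<Sum>i<n. W i j) = 0"
begin

lemma row_off: "j < n \<Longrightarrow> m < n \<Longrightarrow> (\<Sum>i<n. if i \<noteq> j then W m i else 0) = - W m j"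
  by (simp add: sum_off row0)

lemma col_off: "k < n \<Longrightarrow> j < n \<Longrightarrow> (\<Sum>m<n. if m \<noteq> k then W m j else 0) = - W k j"
  by (simp add: sum_off col0)

lemma contraction_free:
  "(\<Sum>i<n. \<Sum>j<n. \<Sum>k<n. \<Sum>m<n. if i \<noteq> j \<and> k \<noteq> m then W j k * W m i else 0) = (\<Sum>j<n. \<Sum>k<n. W j k * W k j)"
proof -
  have "(\<Sum>m<n. \<Sum>i<n. if i \<noteq> j \<and> k \<noteq> m then W j k * W m i else 0) = W j k * W k j" if "j < n" "k < n" for j k
  proof -
    have "(\<Sum>m<n. \<Sum>i<n. if i \<noteq> j \<and> k \<noteq> m then W j k * W m i else 0)
       = (\<Sum>m<n. if m \<noteq> k then W j k * (\<Sum>i<n. if i \<noteq> j then W m i else 0) else 0)"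
      by (auto simp: sum_distrib_left intro!: sum.cong)
    also have "\<dots> = (\<Sum>m<n. - W j k * (if m \<noteq> k then W m j else 0))"
      using that by (intro sum.cong) (auto simp: row_off)
    also have "\<dots> = W j k * W k j" using col_off[OF that(2,1)] by (simp add: sum_distrib_left[symmetric] sum_negf)
    finally show ?thesis .
  qed
  thus ?thesis by (subst sum4_reorder) simp
qed

lemma sum_off_off: "j < n \<Longrightarrow> (\<Sum>m<n. \<Sum>i<n. if i \<noteq> j \<and> m \<noteq> j then W m i else 0) = W j j"
proof -
  assume j: "j < n"
  have "(\<Sum>m<n. \<Sum>i<n. if i \<noteq> j \<and> m \<noteq> j then W m i else 0) = (\<Sum>m<n. if m \<noteq> j then (\<Sum>i<n. if i \<noteq> j then W m i else 0) else 0)"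
    by (auto intro!: sum.cong)
  also have "\<dots> = (\<Sum>m<n. - (if m \<noteq> j then W m j else 0))"
    using j by (intro sum.cong) (auto simp: row_off)
  also have "\<dots> = W j j" using j by (simp only: sum_negf col_off) simp
  finally show ?thesis .
qed

lemma mult_if: "(if c then a * b else 0) = a * (if c then b else (0 :: complex))"
  by simp

lemma contraction_jk:
  "(\<Sum>i<n. \<Sum>j<n. \<Sum>k<n. \<Sum>m<n. if i \<noteq> j \<and> k \<noteq> m \<and> j = k then W j k * W m i else 0) = (\<Sum>j<n. W j j * W j j)"
proof -
  have "(\<Sum>m<n. \<Sum>i<n. if i \<noteq> j \<and> k \<noteq> m \<and> j = k then W j k * W m i else 0)
      = (if k = j then W j j * W j j else 0)" if "j < n" for j k
  proof (cases "k = j")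
    case True
    have "(\<Sum>m<n. \<Sum>i<n. if i \<noteq> j \<and> k \<noteq> m \<and> j = k then W j k * W m i else 0)
        = W j j * (\<Sum>m<n. \<Sum>i<n. if i \<noteq> j \<and> m \<noteq> j then W m i else 0)"
      unfolding mult_if sum_distrib_left True by (intro sum.cong refl) auto
    thus ?thesis using that True by (simp add: sum_off_off)
  qed simp
  thus ?thesis by (subst sum4_reorder) simp
qed

lemma contraction_jm:
  "(\<Sum>i<n. \<Sum>j<n. \<Sum>k<n. \<Sum>m<n. if i \<noteq> j \<and> k \<noteq> m \<and> j = m then W j k * W m i else 0) = (\<Sum>j<n. W j j * W j j)"
proof -
  have inner: "(\<Sum>i<n. if i \<noteq> j \<and> k \<noteq> m \<and> j = m then W j k * W m i else 0)
      = (if m = j then - W j j * (if k \<noteq> j then W j k else 0) else 0)" if "j < n" for j k m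
  proof (cases "m = j \<and> k \<noteq> j")
    case True
    have "(\<Sum>i<n. if i \<noteq> j \<and> k \<noteq> m \<and> j = m then W j k * W m i else 0)
        = W j k * (\<Sum>i<n. if i \<noteq> j then W j i else 0)"
      unfolding mult_if sum_distrib_left using True by (intro sum.cong refl) auto
    thus ?thesis using that True by (simp add: row_off)
  qed auto
  have "(\<Sum>k<n. \<Sum>m<n. \<Sum>i<n. if i \<noteq> j \<and> k \<noteq> m \<and> j = m then W j k * W m i else 0) = W j j * W j j" if "j < n" for j
  proof -
    have "(\<Sum>k<n. \<Sum>m<n. \<Sum>i<n. if i \<noteq> j \<and> k \<noteq> m \<and> j = m then W j k * W m i else 0)
      = (\<Sum>k<n. - W j j * (if k \<noteq> j then W j k else 0))"
      unfolding inner[OF that] using that by simp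
    also have "\<dots> = - W j j * - W j j"
      unfolding sum_distrib_left[symmetric] row_off[OF that that] ..
    finally show ?thesis by simp
  qed
  thus ?thesis by (subst sum4_reorder) simp
qed

lemma contraction_ik:
  "(\<Sum>i<n. \<Sum>j<n. \<Sum>k<n. \<Sum>m<n. if i \<noteq> j \<and> k \<noteq> m \<and> i = k then W j k * W m i else 0) = (\<Sum>j<n. W j j * W j j)"
proof -
  have inner: "(\<Sum>m<n. if i \<noteq> j \<and> k \<noteq> m \<and> i = k then W j k * W m i else 0)
      = (if k = i then - W i i * (if j \<noteq> i then W j i else 0) else 0)" if "i < n" for i j k
  proof (cases "k = i \<and> i \<noteq> j")
    case True
    have "(\<Sum>m<n. if i \<noteq> j \<and> k \<noteq> m \<and> i = k then W j k * W m i else 0)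
        = W j i * (\<Sum>m<n. if m \<noteq> i then W m i else 0)"
      unfolding mult_if sum_distrib_left using True by (intro sum.cong refl) auto
    thus ?thesis using that True by (simp add: col_off)
  qed auto
  have "(\<Sum>j<n. \<Sum>k<n. \<Sum>m<n. if i \<noteq> j \<and> k \<noteq> m \<and> i = k then W j k * W m i else 0) = W i i * W i i" if "i < n" for i
  proof -
    have "(\<Sum>j<n. \<Sum>k<n. \<Sum>m<n. if i \<noteq> j \<and> k \<noteq> m \<and> i = k then W j k * W m i else 0)
      = (\<Sum>j<n. - W i i * (if j \<noteq> i then W j i else 0))"
      unfolding inner[OF that] using that by simp
    also have "\<dots> = - W i i * - W i i"
      unfolding sum_distrib_left[symmetric] col_off[OF that that] ..
    finally show ?thesis by simp
  qed
  thus ?thesis by simp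
qed

lemma contraction_im:
  "(\<Sum>i<n. \<Sum>j<n. \<Sum>k<n. \<Sum>m<n. if i \<noteq> j \<and> k \<noteq> m \<and> i = m then W j k * W m i else 0) = (\<Sum>j<n. W j j * W j j)"
proof -
  have inner: "(\<Sum>m<n. if i \<noteq> j \<and> k \<noteq> m \<and> i = m then W j k * W m i else 0)
      = W i i * (if k \<noteq> i \<and> j \<noteq> i then W j k else 0)" if "i < n" for i j k
  proof -
    have "(\<Sum>m<n. if i \<noteq> j \<and> k \<noteq> m \<and> i = m then W j k * W m i else 0)
      = (\<Sum>m<n. if m = i then W i i * (if k \<noteq> i \<and> j \<noteq> i then W j k else 0) else 0)"
      by (intro sum.cong refl) auto
    thus ?thesis using that by simp
  qed
  have "(\<Sum>j<n. \<Sum>k<n. \<Sum>m<n. if i \<noteq> j \<and> k \<noteq> m \<and> i = m then W j k * W m i else 0) = W i i * W i i" if "i < n" for i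
    unfolding inner[OF that] sum_distrib_left[symmetric] using sum_off_off[OF that] by simp
  thus ?thesis by simp
qed

text \<open>The pattern that produces the leading term: the two factors decouple into \<open>W\<^sub>j\<^sub>j W\<^sub>i\<^sub>i\<close>.\<close>

lemma contraction_jk_im:
  "(\<Sum>i<n. \<Sum>j<n. \<Sum>k<n. \<Sum>m<n. if i \<noteq> j \<and> k \<noteq> m \<and> j = k \<and> i = m then W j k * W m i else 0)
    = (\<Sum>j<n. W j j)\<^sup>2 - (\<Sum>j<n. W j j * W j j)"
proof -
  have inner: "(\<Sum>k<n. \<Sum>m<n. if i \<noteq> j \<and> k \<noteq> m \<and> j = k \<and> i = m then W j k * W m i else 0)
      = W i i * (if j \<noteq> i then W j j else 0)" if "i < n" "j < n" for i j
  proof -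
    have "(\<Sum>m<n. if i \<noteq> j \<and> k \<noteq> m \<and> j = k \<and> i = m then W j k * W m i else 0)
      = (\<Sum>m<n. if m = i then (if k = j then W i i * (if j \<noteq> i then W j j else 0) else 0) else 0)" for k
      by (intro sum.cong refl) auto
    thus ?thesis using that by simp
  qed
  have "(\<Sum>j<n. \<Sum>k<n. \<Sum>m<n. if i \<noteq> j \<and> k \<noteq> m \<and> j = k \<and> i = m then W j k * W m i else 0)
      = W i i * (\<Sum>j<n. W j j) - W i i * W i i" if "i < n" for i
  proof -
    have "(\<Sum>j<n. \<Sum>k<n. \<Sum>m<n. if i \<noteq> j \<and> k \<noteq> m \<and> j = k \<and> i = m then W j k * W m i else 0)
      = (\<Sum>j<n. W i i * (if j \<noteq> i then W j j else 0))"
      by (intro sum.cong inner) (auto simp: that)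
    also have "\<dots> = W i i * ((\<Sum>j<n. W j j) - W i i)"
      unfolding sum_distrib_left[symmetric] sum_off[OF that] ..
    finally show ?thesis by (simp add: algebra_simps)
  qed
  thus ?thesis by (simp add: sum_subtractf sum_distrib_right[symmetric] power2_eq_square)
qed

lemma contraction_jm_ik:
  "(\<Sum>i<n. \<Sum>j<n. \<Sum>k<n. \<Sum>m<n. if i \<noteq> j \<and> k \<noteq> m \<and> j = m \<and> i = k then W j k * W m i else 0)
    = (\<Sum>i<n. \<Sum>j<n. W j i * W j i) - (\<Sum>j<n. W j j * W j j)"
proof -
  have inner: "(\<Sum>k<n. \<Sum>m<n. if i \<noteq> j \<and> k \<noteq> m \<and> j = m \<and> i = k then W j k * W m i else 0)
      = (if j \<noteq> i then W j i * W j i else 0)" if "i < n" "j < n" for i j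
  proof -
    have "(\<Sum>m<n. if i \<noteq> j \<and> k \<noteq> m \<and> j = m \<and> i = k then W j k * W m i else 0)
      = (\<Sum>m<n. if m = j then (if k = i then (if j \<noteq> i then W j i * W j i else 0) else 0) else 0)" for k
      by (intro sum.cong refl) auto
    thus ?thesis using that by simp
  qed
  have "(\<Sum>j<n. \<Sum>k<n. \<Sum>m<n. if i \<noteq> j \<and> k \<noteq> m \<and> j = m \<and> i = k then W j k * W m i else 0)
      = (\<Sum>j<n. W j i * W j i) - W i i * W i i" if "i < n" for i
  proof -
    have "(\<Sum>j<n. \<Sum>k<n. \<Sum>m<n. if i \<noteq> j \<and> k \<noteq> m \<and> j = m \<and> i = k then W j k * W m i else 0)
      = (\<Sum>j<n. if j \<noteq> i then W j i * W j i else 0)"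
      by (intro sum.cong inner) (auto simp: that)
    thus ?thesis unfolding sum_off[OF that] .
  qed
  thus ?thesis by (simp add: sum_subtractf)
qed

lemma contraction_total:
  fixes a b c :: complex
  shows "(\<Sum>i<n. \<Sum>j<n. \<Sum>k<n. \<Sum>m<n. (if i \<noteq> j \<and> k \<noteq> m then
      a + b * (of_bool (j = k) + of_bool (j = m) + of_bool (i = k) + of_bool (i = m))
      + c * (of_bool (j = k \<and> i = m) + of_bool (j = m \<and> i = k)) else 0) * (W j k * W m i))
    = a * (\<Sum>j<n. \<Sum>k<n. W j k * W k j) + 4 * b * (\<Sum>j<n. W j j * W j j)
      + c * ((\<Sum>j<n. W j j)\<^sup>2 + (\<Sum>i<n. \<Sum>j<n. W j i * W j i) - 2 * (\<Sum>j<n. W j j * W j j))"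
proof -
  have split: "(if i \<noteq> j \<and> k \<noteq> m then
      a + b * (of_bool (j = k) + of_bool (j = m) + of_bool (i = k) + of_bool (i = m))
      + c * (of_bool (j = k \<and> i = m) + of_bool (j = m \<and> i = k)) else 0) * (W j k * W m i)
    = a * (if i \<noteq> j \<and> k \<noteq> m then W j k * W m i else 0)
      + b * (if i \<noteq> j \<and> k \<noteq> m \<and> j = k then W j k * W m i else 0)
      + b * (if i \<noteq> j \<and> k \<noteq> m \<and> j = m then W j k * W m i else 0)
      + b * (if i \<noteq> j \<and> k \<noteq> m \<and> i = k then W j k * W m i else 0)
      + b * (if i \<noteq> j \<and> k \<noteq> m \<and> i = m then W j k * W m i else 0)
      + c * (if i \<noteq> j \<and> k \<noteq> m \<and> j = k \<and> i = m then W j k * W m i else 0)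
      + c * (if i \<noteq> j \<and> k \<noteq> m \<and> j = m \<and> i = k then W j k * W m i else 0)" for i j k m
    by (cases "i = j"; cases "k = m"; cases "j = k"; cases "j = m"; cases "i = k"; cases "i = m")
      (simp_all add: algebra_simps)
  show ?thesis
    unfolding split sum.distrib sum_distrib_left[symmetric] contraction_free contraction_jk contraction_jm
      contraction_ik contraction_im contraction_jk_im contraction_jm_ik
    by (simp add: algebra_simps)
qed

end

section \<open>Variance bound and approximate integration by parts on product spaces\<close>

lemma (in prob_space) integrable_of_square:
  fixes X :: "'a \<Rightarrow> real"
  assumes "X \<in> borel_measurable M" "integrable M (\<lambda>x. (X x)\<^sup>2)"
  shows "integrable M X" "expectation (\<lambda>x. \<bar>X x\<bar>) \<le> (1 + expectation (\<lambda>x. (X x)\<^sup>2)) / 2"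
proof -
  have le: "\<bar>X x\<bar> \<le> (1 + (X x)\<^sup>2) / 2" for x
    using zero_le_power2[of "\<bar>X x\<bar> - 1"] by (simp add: power2_diff)
  have i: "integrable M (\<lambda>x. (1 + (X x)\<^sup>2) / 2)" using assms by simp
  show "integrable M X"
    by (rule Bochner_Integration.integrable_bound[OF i]) (use assms le in \<open>auto intro!: AE_I2\<close>)
  hence "expectation (\<lambda>x. \<bar>X x\<bar>) \<le> expectation (\<lambda>x. (1 + (X x)\<^sup>2) / 2)"
    using i le by (intro integral_mono) auto
  also have "\<dots> = (1 + expectation (\<lambda>x. (X x)\<^sup>2)) / 2" using assms by (simp add: prob_space)
  finally show "expectation (\<lambda>x. \<bar>X x\<bar>) \<le> (1 + expectation (\<lambda>x. (X x)\<^sup>2)) / 2" .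
qed

lemma (in prob_space) variance_le_of_dist:
  fixes X :: "'a \<Rightarrow> real"
  assumes X: "integrable M X" "integrable M (\<lambda>x. (X x)\<^sup>2)"
  shows "expectation (\<lambda>x. (X x)\<^sup>2) - (expectation X)\<^sup>2 \<le> expectation (\<lambda>x. (X x - c)\<^sup>2)"
proof -
  have "expectation (\<lambda>x. (X x - c)\<^sup>2) = expectation (\<lambda>x. (X x)\<^sup>2) - 2 * c * expectation X + c\<^sup>2"
    using X by (simp add: power2_diff prob_space mult.commute mult.left_commute)
  moreover have "0 \<le> (expectation X - c)\<^sup>2" by simp
  ultimately show ?thesis by (simp add: power2_diff algebra_simps)
qed

lemma abs_square_le: "\<bar>x\<bar> \<le> C \<Longrightarrow> \<bar>x\<^sup>2\<bar> \<le> C\<^sup>2" for x C :: real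
  using power_mono[of "\<bar>x\<bar>" C 2] by simp

text \<open>A law for every index of the type, so that the product over any set of indices is available, in
particular in an induction on this set.\<close>

locale product_real_prob =
  fixes \<mu> :: "'i \<Rightarrow> real measure"
  assumes prob [simp]: "\<And>i. prob_space (\<mu> i)"
    and sets_mu [simp, measurable_cong]: "\<And>i. sets (\<mu> i) = sets borel"
begin

lemma space_mu [simp]: "space (\<mu> i) = UNIV"
  using sets_eq_imp_space_eq[OF sets_mu] by simp

lemma prob_mu_UNIV [simp]: "measure (\<mu> i) UNIV = 1"
  using prob_space.prob_space[OF prob, of i] by simp

lemma product_sigma: "product_sigma_finite \<mu>"
  using prob by (simp add: product_sigma_finite_def prob_space_imp_sigma_finite)

lemmas integral_insert = product_sigma_finite.product_integral_insert[OF product_sigma]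

lemma prob_PiM [simp]: "prob_space (PiM I \<mu>)"
  by (rule prob_space_PiM) (rule prob)

lemma measurable_upd_PiM:
  assumes "F \<in> borel_measurable (PiM (insert l J) \<mu>)"
  shows "(\<lambda>p. F ((fst p)(l := snd p))) \<in> borel_measurable (PiM J \<mu> \<Otimes>\<^sub>M \<mu> l)"
  using measurable_compose[OF measurable_add_dim assms] unfolding case_prod_beta .

lemma measurable_slice_PiM:
  assumes "F \<in> borel_measurable (PiM (insert l J) \<mu>)" "y \<in> space (PiM J \<mu>)"
  shows "(\<lambda>t. F (y(l := t))) \<in> borel_measurable (\<mu> l)"
  using measurable_compose[OF measurable_Pair1'[OF assms(2)] measurable_upd_PiM[OF assms(1)]]
  unfolding fst_conv snd_conv .

lemma space_PiM_mu: "space (PiM I \<mu>) = extensional I"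
  by (simp add: space_PiM PiE_UNIV_domain PiE_def)

text \<open>The Efron--Stein inequality for functions that are Lipschitz in each coordinate, by induction on the
coordinates. Averaging over one coordinate keeps the Lipschitz constants of the others, and what is
lost in the second moment is the expected conditional variance. The latter is at most the mean
square distance to the value at 0, hence at most \<open>L\<^sup>2\<close> for a coordinate with second moment at
most 1.\<close>

theorem variance_lipschitz_PiM:
  fixes F :: "('i \<Rightarrow> real) \<Rightarrow> real"
  assumes "finite I"
    and sq: "\<And>i. i \<in> I \<Longrightarrow> integrable (\<mu> i) (\<lambda>t. t\<^sup>2)" "\<And>i. i \<in> I \<Longrightarrow> (\<integral>t. t\<^sup>2 \<partial>\<mu> i) \<le> 1"
    and "F \<in> borel_measurable (PiM I \<mu>)" "\<And>y. y \<in> extensional I \<Longrightarrow> \<bar>F y\<bar> \<le> C"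
    and "\<And>y i s t. y \<in> extensional I \<Longrightarrow> i \<in> I \<Longrightarrow> \<bar>F (y(i := s)) - F (y(i := t))\<bar> \<le> L i * \<bar>s - t\<bar>"
  shows "(\<integral>y. (F y)\<^sup>2 \<partial>PiM I \<mu>) - (\<integral>y. F y \<partial>PiM I \<mu>)\<^sup>2 \<le> (\<Sum>i\<in>I. (L i)\<^sup>2)"
  using assms
proof (induction I arbitrary: F rule: finite_induct)
  case empty
  thus ?case by (simp add: PiM_empty lebesgue_integral_count_space_finite)
next
  case (insert l J)
  interpret J: prob_space "PiM J \<mu>" by simp
  interpret lJ: prob_space "PiM (insert l J) \<mu>" by simp
  interpret l: prob_space "\<mu> l" by simp
  define g where "g = (\<lambda>y. \<integral>t. F (y(l := t)) \<partial>\<mu> l)"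
  have ext: "y(l := t) \<in> extensional (insert l J)" if "y \<in> extensional J" for y t
    using that by (auto simp: extensional_def)
  have mF: "(\<lambda>t. F (y(l := t))) \<in> borel_measurable (\<mu> l)" if "y \<in> extensional J" for y
    using that by (intro measurable_slice_PiM[OF insert.prems(3)]) (simp add: space_PiM_mu)
  have iF: "integrable (\<mu> l) (\<lambda>t. F (y(l := t)))" "integrable (\<mu> l) (\<lambda>t. (F (y(l := t)))\<^sup>2)" if "y \<in> extensional J" for y
  proof -
    show "integrable (\<mu> l) (\<lambda>t. F (y(l := t)))"
      by (intro l.integrable_const_bound[where B = C] AE_I2 mF that)
        (simp only: real_norm_def insert.prems(4)[OF ext[OF that]])
    have "\<bar>(F (y(l := t)))\<^sup>2\<bar> \<le> C\<^sup>2" for t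
      by (rule abs_square_le[OF insert.prems(4)[OF ext[OF that]]])
    thus "integrable (\<mu> l) (\<lambda>t. (F (y(l := t)))\<^sup>2)"
      by (intro l.integrable_const_bound[where B = "C\<^sup>2"]) (use mF[OF that] in auto)
  qed
  have m: "(\<lambda>(y, t). F (y(l := t))) \<in> borel_measurable (PiM J \<mu> \<Otimes>\<^sub>M \<mu> l)"
    using measurable_upd_PiM[OF insert.prems(3)] unfolding case_prod_beta .
  have mg: "g \<in> borel_measurable (PiM J \<mu>)"
    unfolding g_def using l.borel_measurable_lebesgue_integral[OF m] by simp
  have gb: "\<bar>g y\<bar> \<le> C" if "y \<in> extensional J" for y
  proof -
    have "\<bar>g y\<bar> \<le> (\<integral>t. \<bar>F (y(l := t))\<bar> \<partial>\<mu> l)" unfolding g_def by (rule integral_abs_bound)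
    also have "\<dots> \<le> (\<integral>t. C \<partial>\<mu> l)"
      by (intro integral_mono integrable_abs iF(1)[OF that] insert.prems(4)[OF ext[OF that]]) simp
    finally show ?thesis by (simp add: l.prob_space)
  qed
  have gL: "\<bar>g (y(i := s)) - g (y(i := t))\<bar> \<le> L i * \<bar>s - t\<bar>" if y: "y \<in> extensional J" and i: "i \<in> J" for y i s t
  proof -
    have e: "y(i := u) \<in> extensional J" for u using y i by (auto simp: extensional_def)
    have il: "i \<noteq> l" using i insert.hyps by auto
    have "\<bar>g (y(i := s)) - g (y(i := t))\<bar> = \<bar>\<integral>u. F ((y(i := s))(l := u)) - F ((y(i := t))(l := u)) \<partial>\<mu> l\<bar>"
      unfolding g_def using iF(1)[OF e] by simp
    also have "\<dots> \<le> (\<integral>u. \<bar>F ((y(i := s))(l := u)) - F ((y(i := t))(l := u))\<bar> \<partial>\<mu> l)"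
      by (rule integral_abs_bound)
    also have "\<dots> \<le> (\<integral>u. L i * \<bar>s - t\<bar> \<partial>\<mu> l)"
    proof (intro integral_mono)
      fix u
      have "\<bar>F ((y(l := u))(i := s)) - F ((y(l := u))(i := t))\<bar> \<le> L i * \<bar>s - t\<bar>"
        using i by (intro insert.prems(5) ext[OF y]) auto
      thus "\<bar>F ((y(i := s))(l := u)) - F ((y(i := t))(l := u))\<bar> \<le> L i * \<bar>s - t\<bar>"
        using il by (simp add: fun_upd_twist)
    qed (use iF(1)[OF e] in auto)
    finally show ?thesis by (simp add: l.prob_space)
  qed
  have IH: "(\<integral>y. (g y)\<^sup>2 \<partial>PiM J \<mu>) - (\<integral>y. g y \<partial>PiM J \<mu>)\<^sup>2 \<le> (\<Sum>i\<in>J. (L i)\<^sup>2)"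
    using insert.prems by (intro insert.IH mg gb gL) auto
  have bd2: "\<bar>(F y)\<^sup>2\<bar> \<le> C\<^sup>2" if "y \<in> extensional (insert l J)" for y
    by (rule abs_square_le[OF insert.prems(4)[OF that]])
  have gb2: "\<bar>(g y)\<^sup>2\<bar> \<le> C\<^sup>2" if "y \<in> extensional J" for y
    by (rule abs_square_le[OF gb[OF that]])
  have int: "integrable (PiM (insert l J) \<mu>) F" "integrable (PiM (insert l J) \<mu>) (\<lambda>y. (F y)\<^sup>2)"
  proof -
    show "integrable (PiM (insert l J) \<mu>) F"
      by (rule lJ.integrable_const_bound[where B = C])
        (use insert.prems(3,4) in \<open>auto intro!: AE_I2 simp: space_PiM_mu\<close>)
    show "integrable (PiM (insert l J) \<mu>) (\<lambda>y. (F y)\<^sup>2)"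
      by (rule lJ.integrable_const_bound[where B = "C\<^sup>2"])
        (use insert.prems(3) bd2 in \<open>auto intro!: AE_I2 simp: space_PiM_mu\<close>)
  qed
  have intg: "integrable (PiM J \<mu>) (\<lambda>y. (g y)\<^sup>2)"
    using mg gb2 by (auto intro!: J.integrable_const_bound[where B = "C\<^sup>2"] AE_I2 simp: space_PiM_mu)
  have slice: "(\<integral>t. (F (y(l := t)))\<^sup>2 \<partial>\<mu> l) \<le> (g y)\<^sup>2 + (L l)\<^sup>2" if y: "y \<in> extensional J" for y
  proof -
    have "(\<integral>t. (F (y(l := t)))\<^sup>2 \<partial>\<mu> l) - (g y)\<^sup>2 \<le> (\<integral>t. (F (y(l := t)) - F (y(l := 0)))\<^sup>2 \<partial>\<mu> l)"
      unfolding g_def by (rule l.variance_le_of_dist) (rule iF[OF y])+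
    also have "\<dots> \<le> (\<integral>t. (L l)\<^sup>2 * t\<^sup>2 \<partial>\<mu> l)"
    proof (rule integral_mono)
      show "integrable (\<mu> l) (\<lambda>t. (F (y(l := t)) - F (y(l := 0)))\<^sup>2)"
        unfolding power2_diff using iF[OF y] by simp
      fix t
      have "\<bar>F (y(l := t)) - F (y(l := 0))\<bar> \<le> L l * \<bar>t - 0\<bar>"
        using insert.prems(5)[OF ext[OF y, of 0] insertI1, of t 0] by (simp only: fun_upd_upd)
      from power_mono[OF this abs_ge_zero, of 2]
      show "(F (y(l := t)) - F (y(l := 0)))\<^sup>2 \<le> (L l)\<^sup>2 * t\<^sup>2" by (simp add: power_mult_distrib)
    qed (use insert.prems(1) in simp)
    also have "\<dots> \<le> (L l)\<^sup>2" using insert.prems(2)[of l] by (simp add: mult_left_le)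
    finally show ?thesis by simp
  qed
  have m2: "(\<lambda>(y, t). (F (y(l := t)))\<^sup>2) \<in> borel_measurable (PiM J \<mu> \<Otimes>\<^sub>M \<mu> l)"
    using borel_measurable_power[OF m, of 2] unfolding case_prod_beta .
  have "(\<integral>y. (F y)\<^sup>2 \<partial>PiM (insert l J) \<mu>) = (\<integral>y. (\<integral>t. (F (y(l := t)))\<^sup>2 \<partial>\<mu> l) \<partial>PiM J \<mu>)"
    by (rule integral_insert[OF insert.hyps(1,2) int(2)])
  also have "\<dots> \<le> (\<integral>y. (g y)\<^sup>2 + (L l)\<^sup>2 \<partial>PiM J \<mu>)"
  proof (rule integral_mono)
    show "integrable (PiM J \<mu>) (\<lambda>y. \<integral>t. (F (y(l := t)))\<^sup>2 \<partial>\<mu> l)"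
    proof (rule J.integrable_const_bound[where B = "C\<^sup>2 + (L l)\<^sup>2"])
      show "AE y in PiM J \<mu>. norm (\<integral>t. (F (y(l := t)))\<^sup>2 \<partial>\<mu> l) \<le> C\<^sup>2 + (L l)\<^sup>2"
      proof (rule AE_I2)
        fix y assume "y \<in> space (PiM J \<mu>)"
        hence y: "y \<in> extensional J" by (simp add: space_PiM_mu)
        have "0 \<le> (\<integral>t. (F (y(l := t)))\<^sup>2 \<partial>\<mu> l)" by simp
        thus "norm (\<integral>t. (F (y(l := t)))\<^sup>2 \<partial>\<mu> l) \<le> C\<^sup>2 + (L l)\<^sup>2" using slice[OF y] gb2[OF y] by simp
      qed
    qed (use l.borel_measurable_lebesgue_integral[OF m2] in simp)
  qed (use intg slice in \<open>auto simp: space_PiM_mu\<close>)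
  also have "\<dots> = (\<integral>y. (g y)\<^sup>2 \<partial>PiM J \<mu>) + (L l)\<^sup>2" using intg by (simp add: J.prob_space)
  finally have "(\<integral>y. (F y)\<^sup>2 \<partial>PiM (insert l J) \<mu>) \<le> (\<integral>y. (g y)\<^sup>2 \<partial>PiM J \<mu>) + (L l)\<^sup>2" .
  moreover have "(\<integral>y. F y \<partial>PiM (insert l J) \<mu>) = (\<integral>y. g y \<partial>PiM J \<mu>)"
    unfolding g_def by (rule integral_insert[OF insert.hyps(1,2) int(1)])
  ultimately show ?case using IH insert.hyps by simp
qed

text \<open>Since the variable \<open>t\<close> has mean 0 and variance 1, \<open>E t f(t) - g(0) = E t (f(t) - f(0) - t g(0))\<close>.
Where \<open>|t| \<le> a\<close> the second order Taylor bound gives \<open>a B2 t\<^sup>2\<close>; elsewhere the two first order bounds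
give \<open>2 B1 t\<^sup>2\<close>, which is integrable without a third moment. Replacing \<open>g(0)\<close> by \<open>E g\<close> costs
\<open>2 B2 E |t| \<le> 2 B2\<close>.\<close>

lemma stein_one_variable:
  fixes f g :: "real \<Rightarrow> complex"
  assumes sq: "integrable (\<mu> l) (\<lambda>t. t\<^sup>2)" "(\<integral>t. t\<^sup>2 \<partial>\<mu> l) = 1" and mean: "(\<integral>t. t \<partial>\<mu> l) = 0"
    and f: "f \<in> borel_measurable borel" and g: "g \<in> borel_measurable borel"
    and 1: "\<And>t. cmod (f t - f 0) \<le> B1 * \<bar>t\<bar>" and 2: "\<And>t. cmod (f t - f 0 - t * g 0) \<le> B2 * t\<^sup>2"
    and 3: "cmod (g 0) \<le> B1" and 4: "\<And>t. cmod (g t - g 0) \<le> 2 * B2 * \<bar>t\<bar>"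
    and a: "0 < a"
  shows "cmod ((\<integral>t. t * f t \<partial>\<mu> l) - (\<integral>t. g t \<partial>\<mu> l))
    \<le> (a + 2) * B2 + 2 * B1 * (\<integral>t. t\<^sup>2 * indicator {y. \<bar>y\<bar> > a} t \<partial>\<mu> l)"
proof -
  interpret l: prob_space "\<mu> l" by simp
  have B2: "0 \<le> B2" using order.trans[OF norm_ge_zero 2[of 1]] by simp
  have B1: "0 \<le> B1" using order.trans[OF norm_ge_zero 3] .
  have i1: "integrable (\<mu> l) (\<lambda>t. t)" and abs: "(\<integral>t. \<bar>t\<bar> \<partial>\<mu> l) \<le> 1"
    using l.integrable_of_square[of "\<lambda>t. t"] sq by simp_all
  have mf [measurable]: "f \<in> borel_measurable (\<mu> l)" "g \<in> borel_measurable (\<mu> l)"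
    using f g by simp_all
  have ic: "integrable (\<mu> l) (\<lambda>t. complex_of_real t)" "integrable (\<mu> l) (\<lambda>t. complex_of_real (t\<^sup>2))"
    using i1 sq by (simp_all del: of_real_power)
  have ind: "integrable (\<mu> l) (\<lambda>t. t\<^sup>2 * indicator {y. \<bar>y\<bar> > a} t)"
    by (rule Bochner_Integration.integrable_bound[OF sq(1)]) (auto split: split_indicator)
  have ig: "integrable (\<mu> l) (\<lambda>t. g t - g 0)"
    by (rule Bochner_Integration.integrable_bound[of _ "\<lambda>t. 2 * B2 * \<bar>t\<bar>"]) (use i1 4 B2 in \<open>auto intro!: AE_I2\<close>)
  have hb: "cmod (t * (f t - f 0 - t * g 0)) \<le> a * B2 * t\<^sup>2 + 2 * B1 * (t\<^sup>2 * indicator {y. \<bar>y\<bar> > a} t)" for t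
  proof (cases "\<bar>t\<bar> > a")
    case False
    have "cmod (t * (f t - f 0 - t * g 0)) \<le> \<bar>t\<bar> * (B2 * t\<^sup>2)"
      unfolding norm_mult using 2[of t] by (simp add: mult_left_mono)
    also have "\<dots> \<le> a * (B2 * t\<^sup>2)" using False B2 by (intro mult_right_mono) auto
    finally show ?thesis using False by simp
  next
    case True
    have "cmod (f t - f 0 - t * g 0) \<le> B1 * \<bar>t\<bar> + \<bar>t\<bar> * B1"
      using 1[of t] mult_left_mono[OF 3, of "\<bar>t\<bar>"] norm_triangle_ineq4[of "f t - f 0" "t * g 0"]
      by (simp add: norm_mult mult.commute)
    hence "cmod (t * (f t - f 0 - t * g 0)) \<le> \<bar>t\<bar> * (B1 * \<bar>t\<bar> + \<bar>t\<bar> * B1)"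
      unfolding norm_mult by (simp add: mult_left_mono)
    also have "\<dots> = 2 * B1 * t\<^sup>2" by (simp add: power2_eq_square algebra_simps)
    also have "\<dots> \<le> a * B2 * t\<^sup>2 + 2 * B1 * t\<^sup>2" using a B2 by simp
    finally show ?thesis using True by simp
  qed
  have iR: "integrable (\<mu> l) (\<lambda>t. a * B2 * t\<^sup>2 + 2 * B1 * (t\<^sup>2 * indicator {y. \<bar>y\<bar> > a} t))"
    using sq(1) ind by simp
  have ih1: "integrable (\<mu> l) (\<lambda>t. t * (f t - f 0 - t * g 0))"
    by (rule Bochner_Integration.integrable_bound[OF iR])
      (use hb in \<open>auto intro!: AE_I2 intro: order.trans[OF _ abs_ge_self]\<close>)
  have "(\<integral>t. t * f t \<partial>\<mu> l) = (\<integral>t. (t * (f t - f 0 - t * g 0)) + (f 0 * complex_of_real t + g 0 * complex_of_real (t\<^sup>2)) \<partial>\<mu> l)"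
    by (intro Bochner_Integration.integral_cong refl) (simp add: algebra_simps power2_eq_square)
  also have "\<dots> = (\<integral>t. t * (f t - f 0 - t * g 0) \<partial>\<mu> l) + g 0"
    using ih1 ic sq(2) mean by (simp del: of_real_power)
  finally have e1: "(\<integral>t. t * f t \<partial>\<mu> l) = (\<integral>t. t * (f t - f 0 - t * g 0) \<partial>\<mu> l) + g 0" .
  have "(\<integral>t. g t \<partial>\<mu> l) = (\<integral>t. (g t - g 0) + g 0 \<partial>\<mu> l)" by simp
  also have "\<dots> = (\<integral>t. g t - g 0 \<partial>\<mu> l) + g 0" 
    by (subst Bochner_Integration.integral_add[OF ig]) (simp_all add: l.prob_space)
  finally have e2: "(\<integral>t. t * f t \<partial>\<mu> l) - (\<integral>t. g t \<partial>\<mu> l)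
      = (\<integral>t. t * (f t - f 0 - t * g 0) \<partial>\<mu> l) - (\<integral>t. g t - g 0 \<partial>\<mu> l)" using e1 by simp
  have u: "cmod (\<integral>t. t * (f t - f 0 - t * g 0) \<partial>\<mu> l)
      \<le> (\<integral>t. a * B2 * t\<^sup>2 + 2 * B1 * (t\<^sup>2 * indicator {y. \<bar>y\<bar> > a} t) \<partial>\<mu> l)"
    by (rule Bochner_Integration.integral_norm_bound_integral[OF ih1 iR]) (rule hb)
  have u': "(\<integral>t. a * B2 * t\<^sup>2 + 2 * B1 * (t\<^sup>2 * indicator {y. \<bar>y\<bar> > a} t) \<partial>\<mu> l)
      = a * B2 + 2 * B1 * (\<integral>t. t\<^sup>2 * indicator {y. \<bar>y\<bar> > a} t \<partial>\<mu> l)"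
    using sq ind by simp
  have v: "cmod (\<integral>t. g t - g 0 \<partial>\<mu> l) \<le> (\<integral>t. 2 * B2 * \<bar>t\<bar> \<partial>\<mu> l)"
    by (rule Bochner_Integration.integral_norm_bound_integral[OF ig]) (use i1 4 in auto)
  have v': "(\<integral>t. 2 * B2 * \<bar>t\<bar> \<partial>\<mu> l) \<le> 2 * B2"
    using abs B2 by (simp add: mult_left_le)
  have "cmod ((\<integral>t. t * (f t - f 0 - t * g 0) \<partial>\<mu> l) - (\<integral>t. g t - g 0 \<partial>\<mu> l))
      \<le> a * B2 + 2 * B1 * (\<integral>t. t\<^sup>2 * indicator {y. \<bar>y\<bar> > a} t \<partial>\<mu> l) + 2 * B2"
    using u u' v v' norm_triangle_ineq4[of "\<integral>t. t * (f t - f 0 - t * g 0) \<partial>\<mu> l" "\<integral>t. g t - g 0 \<partial>\<mu> l"]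
    by linarith
  thus ?thesis unfolding e2 by (simp only: distrib_right)
qed

text \<open>The one variable statement on every line parallel to the \<open>l\<close>-th axis, integrated over the other
coordinates. The function \<open>D\<close> plays the part of the \<open>l\<close>-th partial derivative of \<open>F\<close>.\<close>

theorem stein_PiM:
  fixes F D :: "('i \<Rightarrow> real) \<Rightarrow> complex"
  assumes I: "finite I" "l \<in> I"
    and sq: "integrable (\<mu> l) (\<lambda>t. t\<^sup>2)" "(\<integral>t. t\<^sup>2 \<partial>\<mu> l) = 1" and mean: "(\<integral>t. t \<partial>\<mu> l) = 0"
    and F: "F \<in> borel_measurable (PiM I \<mu>)" "\<And>y. y \<in> extensional I \<Longrightarrow> cmod (F y) \<le> C"
    and D: "D \<in> borel_measurable (PiM I \<mu>)" "\<And>y. y \<in> extensional I \<Longrightarrow> cmod (D y) \<le> B1"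
    and 1: "\<And>y t. y \<in> extensional I \<Longrightarrow> cmod (F (y(l := t)) - F (y(l := 0))) \<le> B1 * \<bar>t\<bar>"
    and 2: "\<And>y t. y \<in> extensional I \<Longrightarrow> cmod (F (y(l := t)) - F (y(l := 0)) - t * D (y(l := 0))) \<le> B2 * t\<^sup>2"
    and 4: "\<And>y t. y \<in> extensional I \<Longrightarrow> cmod (D (y(l := t)) - D (y(l := 0))) \<le> 2 * B2 * \<bar>t\<bar>"
    and a: "0 < a"
  shows "integrable (PiM I \<mu>) (\<lambda>y. y l * F y)"
    and "cmod ((\<integral>y. y l * F y \<partial>PiM I \<mu>) - (\<integral>y. D y \<partial>PiM I \<mu>))
    \<le> (a + 2) * B2 + 2 * B1 * (\<integral>t. t\<^sup>2 * indicator {y. \<bar>y\<bar> > a} t \<partial>\<mu> l)"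
proof -
  define J where "J = I - {l}"
  have IJ: "I = insert l J" "finite J" "l \<notin> J" using I by (auto simp: J_def)
  interpret J: prob_space "PiM J \<mu>" by simp
  interpret I: prob_space "PiM I \<mu>" by simp
  interpret l: prob_space "\<mu> l" by simp
  define b where "b = (a + 2) * B2 + 2 * B1 * (\<integral>t. t\<^sup>2 * indicator {y. \<bar>y\<bar> > a} t \<partial>\<mu> l)"
  have il: "integrable (\<mu> l) (\<lambda>t. t)" by (rule l.integrable_of_square(1)) (use sq in auto)
  have "distr (PiM I \<mu>) (\<mu> l) (\<lambda>y. y l) = \<mu> l"
    using I by (intro distr_PiM_component) auto
  hence "integrable (distr (PiM I \<mu>) (\<mu> l) (\<lambda>y. y l)) (\<lambda>t. t)" using il by simp
  hence iy: "integrable (PiM I \<mu>) (\<lambda>y. y l)"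
    using I(2) by (subst (asm) integrable_distr_eq) auto
  have my: "(\<lambda>y. complex_of_real (y l)) \<in> borel_measurable (PiM I \<mu>)" using iy by measurable
  show iF: "integrable (PiM I \<mu>) (\<lambda>y. y l * F y)"
  proof (rule Bochner_Integration.integrable_bound)
    show "integrable (PiM I \<mu>) (\<lambda>y. C * y l)" using iy by simp
    show "AE y in PiM I \<mu>. norm (y l * F y) \<le> norm (C * y l)"
    proof (rule AE_I2)
      fix y assume "y \<in> space (PiM I \<mu>)"
      hence "cmod (F y) \<le> C" using F(2) by (simp add: space_PiM_mu)
      thus "norm (y l * F y) \<le> norm (C * y l)"
        using mult_left_mono[of "cmod (F y)" C "\<bar>y l\<bar>"] order.trans[OF norm_ge_zero, of "F y" C]
        by (simp add: norm_mult abs_mult mult.commute[of C])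
    qed
  qed (use my F(1) in simp)
  have iD: "integrable (PiM I \<mu>) D"
    by (rule I.integrable_const_bound[where B = B1]) (use D in \<open>auto intro!: AE_I2 simp: space_PiM_mu\<close>)
  have mFD: "F \<in> borel_measurable (PiM (insert l J) \<mu>)" "D \<in> borel_measurable (PiM (insert l J) \<mu>)"
    using F D IJ by auto
  have ext: "y(l := t) \<in> extensional I" if "y \<in> extensional J" for y t
    using that IJ by (auto simp: extensional_def)
  have slice: "cmod ((\<integral>t. t * F (y(l := t)) \<partial>\<mu> l) - (\<integral>t. D (y(l := t)) \<partial>\<mu> l)) \<le> b" if y: "y \<in> extensional J" for y
    unfolding b_def
  proof (rule stein_one_variable[OF sq mean _ _ _ _ _ _ a])
    have y': "y \<in> space (PiM J \<mu>)" using y by (simp add: space_PiM_mu)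
    show "(\<lambda>t. F (y(l := t))) \<in> borel_measurable borel" "(\<lambda>t. D (y(l := t))) \<in> borel_measurable borel"
      using measurable_slice_PiM[OF mFD(1) y'] measurable_slice_PiM[OF mFD(2) y'] by simp_all
    show "cmod (D (y(l := 0))) \<le> B1" by (rule D(2)[OF ext[OF y]])
    fix t
    show "cmod (F (y(l := t)) - F (y(l := 0))) \<le> B1 * \<bar>t\<bar>"
      using 1[OF ext[OF y, of 0], of t] by simp
    show "cmod (F (y(l := t)) - F (y(l := 0)) - t * D (y(l := 0))) \<le> B2 * t\<^sup>2"
      using 2[OF ext[OF y, of 0], of t] by simp
    show "cmod (D (y(l := t)) - D (y(l := 0))) \<le> 2 * B2 * \<bar>t\<bar>"
      using 4[OF ext[OF y, of 0], of t] by simp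
  qed
  have iFD: "integrable (PiM (insert l J) \<mu>) (\<lambda>y. y l * F y - D y)" using iF iD IJ(1) by simp
  have "(\<integral>y. y l * F y \<partial>PiM I \<mu>) - (\<integral>y. D y \<partial>PiM I \<mu>) = (\<integral>y. y l * F y - D y \<partial>PiM I \<mu>)"
    using iF iD by simp
  also have "\<dots> = (\<integral>y. (\<integral>t. t * F (y(l := t)) - D (y(l := t)) \<partial>\<mu> l) \<partial>PiM J \<mu>)"
    using integral_insert[OF IJ(2,3) iFD] IJ(1) by simp
  finally have eq: "(\<integral>y. y l * F y \<partial>PiM I \<mu>) - (\<integral>y. D y \<partial>PiM I \<mu>)
      = (\<integral>y. (\<integral>t. t * F (y(l := t)) - D (y(l := t)) \<partial>\<mu> l) \<partial>PiM J \<mu>)" .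
  have s2: "cmod (\<integral>t. t * F (y(l := t)) - D (y(l := t)) \<partial>\<mu> l) \<le> b" if y: "y \<in> extensional J" for y
  proof -
    have y': "y \<in> space (PiM J \<mu>)" using y by (simp add: space_PiM_mu)
    have "integrable (\<mu> l) (\<lambda>t. D (y(l := t)))"
      by (rule l.integrable_const_bound[where B = B1])
        (use D(2)[OF ext[OF y]] measurable_slice_PiM[OF mFD(2) y'] in auto)
    moreover have "integrable (\<mu> l) (\<lambda>t. t * F (y(l := t)))"
    proof (rule Bochner_Integration.integrable_bound)
      show "integrable (\<mu> l) (\<lambda>t. C * t)" using il by simp
      show "AE t in \<mu> l. norm (t * F (y(l := t))) \<le> norm (C * t)"
      proof (rule AE_I2)
        fix t
        have C: "cmod (F (y(l := t))) \<le> C" by (rule F(2)[OF ext[OF y]])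
        show "norm (t * F (y(l := t))) \<le> norm (C * t)"
          using C order.trans[OF norm_ge_zero C]
          using mult_right_mono[OF C, of "\<bar>t\<bar>"] by (simp add: norm_mult abs_mult mult.commute)
      qed
    qed (use measurable_slice_PiM[OF mFD(1) y'] in simp)
    ultimately show ?thesis using slice[OF y] by simp
  qed
  have m: "(\<lambda>(y, t). t * F (y(l := t)) - D (y(l := t))) \<in> borel_measurable (PiM J \<mu> \<Otimes>\<^sub>M \<mu> l)"
  proof -
    have [measurable]: "(\<lambda>p. F ((fst p)(l := snd p))) \<in> borel_measurable (PiM J \<mu> \<Otimes>\<^sub>M \<mu> l)"
      "(\<lambda>p. D ((fst p)(l := snd p))) \<in> borel_measurable (PiM J \<mu> \<Otimes>\<^sub>M \<mu> l)"
      by (rule measurable_upd_PiM[OF mFD(1)], rule measurable_upd_PiM[OF mFD(2)])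
    show ?thesis unfolding case_prod_beta' by measurable
  qed
  define h where "h = (\<lambda>y. \<integral>t. t * F (y(l := t)) - D (y(l := t)) \<partial>\<mu> l)"
  have h: "integrable (PiM J \<mu>) h"
    unfolding h_def by (rule J.integrable_const_bound[where B = b])
      (use s2 l.borel_measurable_lebesgue_integral[OF m] in \<open>auto intro!: AE_I2 simp: space_PiM_mu\<close>)
  have "cmod (\<integral>y. h y \<partial>PiM J \<mu>) \<le> (\<integral>y. cmod (h y) \<partial>PiM J \<mu>)" by (rule integral_norm_bound)
  also have "\<dots> \<le> (\<integral>y. b \<partial>PiM J \<mu>)"
    using h s2 by (intro integral_mono) (auto simp: space_PiM_mu h_def)
  finally have "cmod (\<integral>y. (\<integral>t. t * F (y(l := t)) - D (y(l := t)) \<partial>\<mu> l) \<partial>PiM J \<mu>) \<le> (\<integral>y. b \<partial>PiM J \<mu>)"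
    unfolding h_def .
  thus "cmod ((\<integral>y. y l * F y \<partial>PiM I \<mu>) - (\<integral>y. D y \<partial>PiM I \<mu>))
    \<le> (a + 2) * B2 + 2 * B1 * (\<integral>t. t\<^sup>2 * indicator {y. \<bar>y\<bar> > a} t \<partial>\<mu> l)"
    unfolding eq b_def by (simp add: J.prob_space)
qed

end

section \<open>Matrices depending linearly on parameters\<close>

lemma norm_trace_mult_le_square:
  assumes "A \<in> carrier_mat n n" "B \<in> carrier_mat n n" "frob A \<le> k" "frob B \<le> k"
  shows "cmod (mat_trace (A * B)) \<le> k\<^sup>2"
proof -
  have "cmod (mat_trace (A * B)) \<le> frob A * frob B" by (rule norm_mat_trace_mult_le[OF assms(1,2)])
  also have "\<dots> \<le> k * k" using assms(3,4) order.trans[OF frob_nonneg assms(3)] by (intro mult_mono) auto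
  finally show ?thesis by (simp add: power2_eq_square)
qed

lemma norm_trace_mult_le_cube:
  assumes "A \<in> carrier_mat n n" "B \<in> carrier_mat n n" "C \<in> carrier_mat n n" "frob A \<le> k" "frob B \<le> k" "frob C \<le> k"
  shows "cmod (mat_trace (A * B * C)) \<le> k ^ 3"
proof -
  have k: "0 \<le> k" by (rule order.trans[OF frob_nonneg assms(4)])
  have "cmod (mat_trace (A * B * C)) \<le> frob (A * B) * frob C"
    by (rule norm_mat_trace_mult_le[OF mult_carrier_mat[OF assms(1,2)] assms(3)])
  also have "\<dots> \<le> (frob A * frob B) * frob C" by (intro mult_right_mono frob_mult_le[OF assms(1,2)]) simp
  also have "\<dots> \<le> (k * k) * k" using assms(4-6) k by (intro mult_mono) auto
  finally show ?thesis by (simp add: power3_eq_cube)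
qed

text \<open>For \<open>X = B G(t)\<close> and \<open>Y = B G(0)\<close> the hypothesis on \<open>X - Y\<close> is the resolvent identity. Iterating it
gives the Taylor expansion of \<open>tr (B G(t))\<close> in \<open>t\<close> with remainders expressed by products of \<open>X\<close> and
\<open>Y\<close>, so that nothing has to be differentiated.\<close>

lemma trace_second_order:
  assumes X: "X \<in> carrier_mat n n" and Y: "Y \<in> carrier_mat n n"
    and diff: "X - Y = of_real t \<cdot>\<^sub>m (X * Y)" and k: "frob X \<le> k" "frob Y \<le> k"
  shows "cmod (mat_trace X - mat_trace Y) \<le> k\<^sup>2 * \<bar>t\<bar>"
    and "cmod (mat_trace X - mat_trace Y - t * mat_trace (Y * Y)) \<le> k ^ 3 * t\<^sup>2"
    and "cmod (mat_trace (X * X) - mat_trace (Y * Y)) \<le> 2 * k ^ 3 * \<bar>t\<bar>"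
proof -
  have XY: "X * Y \<in> carrier_mat n n" "X * X \<in> carrier_mat n n" "Y * Y \<in> carrier_mat n n" "Y * X \<in> carrier_mat n n"
    using X Y by auto
  have d: "mat_trace X - mat_trace Y = of_real t * mat_trace (X * Y)"
    unfolding mat_trace_diff[OF X Y, symmetric] diff mat_trace_smult[OF XY(1)] ..
  show "cmod (mat_trace X - mat_trace Y) \<le> k\<^sup>2 * \<bar>t\<bar>"
    unfolding d using norm_trace_mult_le_square[OF X Y k] by (simp add: norm_mult mult.commute[of "k\<^sup>2"] mult_left_mono)
  have XYZ: "mat_trace (X * Z) - mat_trace (Y * Z) = of_real t * mat_trace (X * Y * Z)" if Z: "Z \<in> carrier_mat n n" for Z
  proof -
    have "mat_trace (X * Z) - mat_trace (Y * Z) = mat_trace ((X - Y) * Z)"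
      unfolding minus_mult_distrib_mat[OF X Y Z]
      by (rule mat_trace_diff[OF mult_carrier_mat[OF X Z] mult_carrier_mat[OF Y Z], symmetric])
    also have "\<dots> = of_real t * mat_trace (X * Y * Z)"
      unfolding diff mult_smult_assoc_mat[OF XY(1) Z] by (rule mat_trace_smult[OF mult_carrier_mat[OF XY(1) Z]])
    finally show ?thesis .
  qed
  have 3: "cmod (mat_trace (X * Y * Z)) \<le> k ^ 3" if "Z \<in> carrier_mat n n" "frob Z \<le> k" for Z
    by (rule norm_trace_mult_le_cube[OF X Y that(1) k that(2)])
  have "mat_trace X - mat_trace Y - t * mat_trace (Y * Y) = of_real t * (mat_trace (X * Y) - mat_trace (Y * Y))"
    unfolding d by (simp add: algebra_simps)
  also have "\<dots> = of_real (t\<^sup>2) * mat_trace (X * Y * Y)" unfolding XYZ[OF Y] by (simp add: power2_eq_square)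
  finally show "cmod (mat_trace X - mat_trace Y - t * mat_trace (Y * Y)) \<le> k ^ 3 * t\<^sup>2"
    using 3[OF Y k(2)] by (simp add: norm_mult mult.commute[of "k ^ 3"] mult_left_mono norm_power)
  have "mat_trace (X * X) - mat_trace (Y * Y)
      = (mat_trace (X * X) - mat_trace (Y * X)) + (mat_trace (X * Y) - mat_trace (Y * Y))"
    using mat_trace_mult_commute[OF X Y] by simp
  also have "\<dots> = of_real t * (mat_trace (X * Y * X) + mat_trace (X * Y * Y))"
    unfolding XYZ[OF X] XYZ[OF Y] by (simp add: algebra_simps)
  finally have "cmod (mat_trace (X * X) - mat_trace (Y * Y)) \<le> \<bar>t\<bar> * (k ^ 3 + k ^ 3)"
    using order.trans[OF norm_triangle_ineq add_mono[OF 3[OF X k(1)] 3[OF Y k(2)]]]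
    by (simp add: norm_mult mult_left_mono)
  thus "cmod (mat_trace (X * X) - mat_trace (Y * Y)) \<le> 2 * k ^ 3 * \<bar>t\<bar>" by (simp add: algebra_simps)
qed

lemma symmat_gram:
  assumes "V \<in> carrier_mat n k" "\<And>i j. i < n \<Longrightarrow> j < k \<Longrightarrow> V $$ (i, j) \<in> \<real>"
  shows "symmat n (V * V\<^sup>T)"
proof -
  have VT: "V\<^sup>T \<in> carrier_mat k n" using assms by simp
  have "(V * V\<^sup>T) $$ (i, j) = (\<Sum>l<k. V $$ (i, l) * V $$ (j, l))" if "i < n" "j < n" for i j
    unfolding mat_mult_entry[OF assms(1) VT that] using assms that by (intro sum.cong) auto
  thus ?thesis using assms mult_carrier_mat[OF assms(1) VT]
    by (auto simp: symmat_def mult.commute intro!: sum_in_Reals Reals_mult)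
qed

text \<open>Coefficient matrices that are differences of two Gram matrices, up to a scalar. The hypergraph
adjacency matrix of an edge has this form with Gram factors of squared norm \<open>r\<close>, which gives the
Lipschitz bound \<open>stieltjes_lipschitz\<close> without a loss in the dimension.\<close>

locale matrix_model =
  fixes n kV kU :: nat and I :: "'i set" and V U :: "'i \<Rightarrow> complex Matrix.mat" and c \<rho> :: real and z :: complex
  assumes n: "0 < n" and I: "finite I" and c: "0 \<le> c" and z: "0 < Im z"
    and V: "\<And>l. l \<in> I \<Longrightarrow> V l \<in> carrier_mat n kV" "\<And>l i j. l \<in> I \<Longrightarrow> i < n \<Longrightarrow> j < kV \<Longrightarrow> V l $$ (i, j) \<in> \<real>"
      "\<And>l. l \<in> I \<Longrightarrow> (frob (V l))\<^sup>2 \<le> \<rho>"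
    and U: "\<And>l. l \<in> I \<Longrightarrow> U l \<in> carrier_mat n kU" "\<And>l i j. l \<in> I \<Longrightarrow> i < n \<Longrightarrow> j < kU \<Longrightarrow> U l $$ (i, j) \<in> \<real>"
      "\<And>l. l \<in> I \<Longrightarrow> (frob (U l))\<^sup>2 \<le> \<rho>"
begin

definition coef :: "'i \<Rightarrow> complex Matrix.mat" where
  "coef l = of_real c \<cdot>\<^sub>m (V l * (V l)\<^sup>T - U l * (U l)\<^sup>T)"

definition model :: "('i \<Rightarrow> real) \<Rightarrow> complex Matrix.mat" where
  "model y = Matrix.mat n n (\<lambda>ij. \<Sum>l\<in>I. of_real (y l) * coef l $$ ij)"

definition res :: "('i \<Rightarrow> real) \<Rightarrow> complex Matrix.mat" where
  "res y = resolvent (model y) z"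

text \<open>An upper bound for the Frobenius norm of the coefficients.\<close>

definition scale :: real where "scale = 2 * c * \<rho>"

text \<open>The Cauchy transform at \<open>z\<close> of the spectral distribution of the model.\<close>

definition stieltjes :: "('i \<Rightarrow> real) \<Rightarrow> complex" where
  "stieltjes y = mat_trace (res y) / of_nat n"

lemma Imz: "Im z \<noteq> 0" "\<bar>Im z\<bar> = Im z" using z by auto

lemma VT: "l \<in> I \<Longrightarrow> (V l)\<^sup>T \<in> carrier_mat kV n" and UT: "l \<in> I \<Longrightarrow> (U l)\<^sup>T \<in> carrier_mat kU n"
  using V(1)[of l] U(1)[of l] by auto

lemma symmat_coef:
  assumes l: "l \<in> I"
  shows "symmat n (coef l)"
proof -
  note s = symmatD[OF symmat_gram[OF V(1,2)[OF l]]] symmatD[OF symmat_gram[OF U(1,2)[OF l]]]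
  have d: "dim_row (U l * (U l)\<^sup>T) = n" "dim_col (U l * (U l)\<^sup>T) = n"
    using s(5) by (blast dest: carrier_matD)+
  have "coef l $$ (i, j) = of_real c * ((V l * (V l)\<^sup>T) $$ (i, j) - (U l * (U l)\<^sup>T) $$ (i, j))"
    if "i < n" "j < n" for i j
    using that d by (simp add: coef_def del: index_mult_mat)
  moreover have "coef l \<in> carrier_mat n n"
    unfolding coef_def by (intro smult_carrier_mat minus_carrier_mat s(5))
  ultimately show ?thesis using s(2,3,6,7) by (simp add: symmat_def del: index_mult_mat)
qed

lemma coef_carrier: "l \<in> I \<Longrightarrow> coef l \<in> carrier_mat n n"
  by (rule symmatD(1)[OF symmat_coef])

lemma symmat_model: "symmat n (model y)"
  using symmatD(2,3)[OF symmat_coef]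
  by (auto simp: symmat_def model_def intro!: sum_in_Reals Reals_mult sum.cong)

lemma res: "symmetric_resolvent n (model y) z"
  using symmat_model Imz by unfold_locales auto

lemma res_carrier: "res y \<in> carrier_mat n n"
  unfolding res_def by (rule symmetric_resolvent.carrG[OF res])

lemma rho: "l \<in> I \<Longrightarrow> 0 \<le> \<rho>"
  using V(3)[of l] zero_le_power2[of "frob (V l)"] by linarith

lemma frob_coef: "l \<in> I \<Longrightarrow> frob (coef l) \<le> scale"
proof -
  assume l: "l \<in> I"
  have "frob (coef l) = c * frob (V l * (V l)\<^sup>T - U l * (U l)\<^sup>T)"
    using c by (simp add: coef_def frob_smult)
  also have "\<dots> \<le> c * (frob (V l * (V l)\<^sup>T) + frob (U l * (U l)\<^sup>T))"
    using c frob_diff_le[OF mult_carrier_mat[OF V(1)[OF l] VT[OF l]] mult_carrier_mat[OF U(1)[OF l] UT[OF l]]]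
    by (simp add: mult_left_mono)
  also have "\<dots> \<le> c * (\<rho> + \<rho>)"
    using frob_mult_le[OF V(1)[OF l] VT[OF l]] frob_mult_le[OF U(1)[OF l] UT[OF l]] V(3)[OF l] U(3)[OF l]
    by (intro mult_left_mono[OF _ c]) (simp add: power2_eq_square)
  finally show "frob (coef l) \<le> scale" by (simp add: scale_def)
qed

lemma model_update: 
  assumes l: "l \<in> I"
  shows "model (y(l := t)) - model (y(l := s)) = of_real (t - s) \<cdot>\<^sub>m coef l"
proof (rule eq_matI)
  fix i j assume "i < dim_row (of_real (t - s) \<cdot>\<^sub>m coef l)" "j < dim_col (of_real (t - s) \<cdot>\<^sub>m coef l)"
  hence ij: "i < n" "j < n" using coef_carrier[OF l] by auto
  have "(\<Sum>k\<in>I. of_real ((y(l := t)) k) * coef k $$ (i, j)) =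
      of_real t * coef l $$ (i, j) + (\<Sum>k\<in>I - {l}. of_real (y k) * coef k $$ (i, j))" for t
    using I l by (subst sum.remove[of _ l]) (auto intro!: sum.cong)
  thus "(model (y(l := t)) - model (y(l := s))) $$ (i, j) = (of_real (t - s) \<cdot>\<^sub>m coef l) $$ (i, j)"
    using ij coef_carrier[OF l] by (simp add: model_def algebra_simps)
qed (use coef_carrier[OF l] in \<open>auto simp: model_def\<close>)

lemma res_update:
  assumes l: "l \<in> I"
  shows "res (y(l := t)) - res (y(l := s)) = of_real (t - s) \<cdot>\<^sub>m (res (y(l := t)) * coef l * res (y(l := s)))"
  using resolvent_diff[OF symmat_model symmat_model Imz(1), of "y(l := t)" "y(l := s)"]
  unfolding res_def[symmetric] model_update[OF l]
    mult_smult_distrib[OF res_carrier coef_carrier[OF l]]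
    mult_smult_assoc_mat[OF mult_carrier_mat[OF res_carrier coef_carrier[OF l]] res_carrier] .

definition coefres :: "'i \<Rightarrow> ('i \<Rightarrow> real) \<Rightarrow> complex Matrix.mat" where
  "coefres l y = coef l * res y"

lemma coefres_carrier: "l \<in> I \<Longrightarrow> coefres l y \<in> carrier_mat n n"
  unfolding coefres_def by (rule mult_carrier_mat[OF coef_carrier res_carrier])

lemma frob_coefres: "l \<in> I \<Longrightarrow> frob (coefres l y) \<le> scale / Im z"
  using symmetric_resolvent.frob_mult_G_le[OF res coef_carrier, of l y] frob_coef[of l] z
  unfolding res_def[symmetric] coefres_def[symmetric]
  by (simp add: pos_le_divide_eq mult.commute)

text \<open>The resolvent identity for \<open>B\<^sub>l G\<close> when only the \<open>l\<close>-th parameter moves; this is the hypothesis of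
\<open>trace_second_order\<close>.\<close>

lemma coefres_update:
  assumes l: "l \<in> I"
  shows "coefres l (y(l := t)) - coefres l (y(l := s)) = of_real (t - s) \<cdot>\<^sub>m (coefres l (y(l := t)) * coefres l (y(l := s)))"
proof -
  let ?R = "res (y(l := t))" and ?S = "res (y(l := s))"
  have "coefres l (y(l := t)) - coefres l (y(l := s)) = coef l * (?R - ?S)"
    unfolding coefres_def by (rule mult_minus_distrib_mat[symmetric, OF coef_carrier[OF l] res_carrier res_carrier])
  also have "\<dots> = of_real (t - s) \<cdot>\<^sub>m (coef l * (?R * coef l * ?S))"
    unfolding res_update[OF l]
    by (rule mult_smult_distrib[OF coef_carrier[OF l]
          mult_carrier_mat[OF mult_carrier_mat[OF res_carrier coef_carrier[OF l]] res_carrier]])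
  also have "coef l * (?R * coef l * ?S) = coefres l (y(l := t)) * coefres l (y(l := s))"
    unfolding coefres_def
      assoc_mult_mat[OF res_carrier coef_carrier[OF l] res_carrier]
    by (rule assoc_mult_mat[symmetric, OF coef_carrier[OF l] res_carrier mult_carrier_mat[OF coef_carrier[OF l] res_carrier]])
  finally show ?thesis .
qed

text \<open>Taking the trace in \<open>A G = z G - 1\<close> and expanding \<open>A\<close> linearly in the parameters.\<close>

lemma trace_model_res:
  "(\<Sum>l\<in>I. of_real (y l) * mat_trace (coefres l y)) = z * mat_trace (res y) - of_nat n"
proof -
  interpret symmetric_resolvent n "model y" z by (rule res)
  have "(\<Sum>l\<in>I. of_real (y l) * mat_trace (coefres l y))
      = (\<Sum>l\<in>I. \<Sum>i<n. \<Sum>j<n. of_real (y l) * (coef l $$ (i, j) * res y $$ (j, i)))"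
    unfolding coefres_def using mat_trace_mult[OF coef_carrier res_carrier]
    by (simp add: sum_distrib_left)
  also have "\<dots> = (\<Sum>i<n. \<Sum>j<n. (\<Sum>l\<in>I. of_real (y l) * (coef l $$ (i, j) * res y $$ (j, i))))"
    by (subst sum.swap, intro sum.cong refl, rule sum.swap)
  also have "\<dots> = mat_trace (model y * res y)"
    unfolding mat_trace_mult[OF carrA res_carrier]
    by (intro sum.cong refl) (simp add: model_def sum_distrib_right mult.assoc)
  also have "model y * res y = z \<cdot>\<^sub>m res y - 1\<^sub>m n"
  proof -
    have "Z * res y = z \<cdot>\<^sub>m res y - model y * res y"
      by (subst minus_mult_distrib_mat[OF _ carrA res_carrier])
        (simp_all add: mult_smult_assoc_mat[OF one_carrier_mat res_carrier] left_mult_one_mat[OF res_carrier])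
    hence "1\<^sub>m n = z \<cdot>\<^sub>m res y - model y * res y" by (simp add: Z_mult_G res_def)
    thus ?thesis using res_carrier[of y] carrA mult_carrier_mat[OF carrA res_carrier, of y]
      by (intro eq_matI) auto
  qed
  also have "mat_trace (z \<cdot>\<^sub>m res y - 1\<^sub>m n) = z * mat_trace (res y) - of_nat n"
    using res_carrier[of y] by (simp add: mat_trace_diff[of _ n] mat_trace_smult[of _ n]) (simp add: mat_trace_def)
  finally show ?thesis .
qed

lemma norm_mat_trace_res: "cmod (mat_trace (res y)) \<le> real n / Im z"
proof -
  have "cmod (mat_trace (res y * 1\<^sub>m n)) \<le> frob (res y) * frob (1\<^sub>m n)"
    by (rule norm_mat_trace_mult_le[OF res_carrier one_carrier_mat])
  also have "frob (1\<^sub>m n) = sqrt (real n)" by (rule frob_one)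
  also have "frob (res y) * sqrt (real n) \<le> (sqrt (real n) / Im z) * sqrt (real n)"
    using symmetric_resolvent.frob_G_le[OF res, of y] z
    by (intro mult_right_mono) (simp_all add: res_def pos_le_divide_eq mult.commute)
  finally show ?thesis using right_mult_one_mat[OF res_carrier] by simp
qed

lemma norm_stieltjes: "cmod (stieltjes y) \<le> 1 / Im z"
  using norm_mat_trace_res[of y] n by (simp add: stieltjes_def norm_divide divide_simps mult.commute split: if_splits)

lemma stieltjes_lipschitz:
  assumes l: "l \<in> I"
  shows "cmod (stieltjes (y(l := t)) - stieltjes (y(l := s))) \<le> scale / (real n * (Im z)\<^sup>2) * \<bar>t - s\<bar>"
proof -
  let ?R = "res (y(l := t))" and ?S = "res (y(l := s))"
  define v where "v = mat_trace (?R * (V l * (V l)\<^sup>T) * ?S)"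
  define u where "u = mat_trace (?R * (U l * (U l)\<^sup>T) * ?S)"
  have VV: "V l * (V l)\<^sup>T \<in> carrier_mat n n" and UU: "U l * (U l)\<^sup>T \<in> carrier_mat n n"
    using mult_carrier_mat[OF V(1)[OF l] VT[OF l]] mult_carrier_mat[OF U(1)[OF l] UT[OF l]] by auto
  note cs = mult_carrier_mat[OF res_carrier VV] mult_carrier_mat[OF res_carrier UU]
  have "?R * coef l * ?S = of_real c \<cdot>\<^sub>m (?R * (V l * (V l)\<^sup>T) * ?S - ?R * (U l * (U l)\<^sup>T) * ?S)"
    unfolding coef_def mult_smult_distrib[OF res_carrier minus_carrier_mat[OF UU]]
      mult_minus_distrib_mat[OF res_carrier VV UU]
      mult_smult_assoc_mat[OF minus_carrier_mat[OF cs(2)] res_carrier] minus_mult_distrib_mat[OF cs res_carrier] ..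
  hence "mat_trace (?R * coef l * ?S) = of_real c * (v - u)"
    unfolding v_def u_def
    using mat_trace_diff[OF mult_carrier_mat[OF cs(1) res_carrier] mult_carrier_mat[OF cs(2) res_carrier]]
      mat_trace_smult[OF minus_carrier_mat[OF mult_carrier_mat[OF cs(2) res_carrier]]] by metis
  moreover have "mat_trace ?R - mat_trace ?S = of_real (t - s) * mat_trace (?R * coef l * ?S)"
    unfolding mat_trace_diff[OF res_carrier res_carrier, symmetric] res_update[OF l]
    by (rule mat_trace_smult[OF mult_carrier_mat[OF mult_carrier_mat[OF res_carrier coef_carrier[OF l]] res_carrier]])
  moreover have "cmod v \<le> \<rho> / (Im z)\<^sup>2"
    using symmetric_resolvent.trace_resolvent_gram_le[OF res V(1)[OF l] symmat_model, of "y(l := t)" "y(l := s)"] V(3)[OF l] z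
    by (simp add: v_def res_def pos_le_divide_eq mult.commute)
  moreover have "cmod u \<le> \<rho> / (Im z)\<^sup>2"
    using symmetric_resolvent.trace_resolvent_gram_le[OF res U(1)[OF l] symmat_model, of "y(l := t)" "y(l := s)"] U(3)[OF l] z
    by (simp add: u_def res_def pos_le_divide_eq mult.commute)
  ultimately have "cmod (mat_trace ?R - mat_trace ?S) \<le> \<bar>t - s\<bar> * (c * (\<rho> / (Im z)\<^sup>2 + \<rho> / (Im z)\<^sup>2))"
  proof -
    assume 1: "mat_trace (?R * coef l * ?S) = of_real c * (v - u)"
      and 2: "mat_trace ?R - mat_trace ?S = of_real (t - s) * mat_trace (?R * coef l * ?S)"
      and 3: "cmod v \<le> \<rho> / (Im z)\<^sup>2" "cmod u \<le> \<rho> / (Im z)\<^sup>2"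
    have "cmod (v - u) \<le> \<rho> / (Im z)\<^sup>2 + \<rho> / (Im z)\<^sup>2"
      using norm_triangle_ineq4[of v u] 3 by linarith
    thus ?thesis unfolding 2 1 norm_mult norm_of_real abs_of_nonneg[OF c] by (intro mult_left_mono c abs_ge_zero)
  qed
  hence "cmod (mat_trace ?R - mat_trace ?S) / real n \<le> \<bar>t - s\<bar> * (c * (\<rho> / (Im z)\<^sup>2 + \<rho> / (Im z)\<^sup>2)) / real n"
    by (intro divide_right_mono) auto
  thus ?thesis
    by (simp add: stieltjes_def scale_def diff_divide_distrib[symmetric] norm_divide field_simps)
qed

end

section \<open>Random parameters: resolvent equation and concentration\<close>

locale random_matrix_model = matrix_model n kV kU I V U c \<rho> z + product_real_prob \<mu>
  for n kV kU :: nat and I :: "'i set" and V U c \<rho> z and \<mu> :: "'i \<Rightarrow> real measure" +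
  assumes square_integrable: "\<And>l. l \<in> I \<Longrightarrow> integrable (\<mu> l) (\<lambda>t. t\<^sup>2)"
    and second_moment: "\<And>l. l \<in> I \<Longrightarrow> (\<integral>t. t\<^sup>2 \<partial>\<mu> l) = 1"
    and first_moment: "\<And>l. l \<in> I \<Longrightarrow> (\<integral>t. t \<partial>\<mu> l) = 0"
begin

sublocale PI: prob_space "PiM I \<mu>" by simp

lemma measurable_model_entry:
  "(\<lambda>y. model y $$ (i, j)) \<in> borel_measurable (PiM I \<mu>)" if "i < n" "j < n"
proof -
  have "(\<lambda>y. y l) \<in> borel_measurable (PiM I \<mu>)" if "l \<in> I" for l
    using measurable_component_singleton[OF that, of \<mu>] measurable_cong_sets[OF refl sets_mu] by blast
  hence "(\<lambda>y. complex_of_real (y l)) \<in> borel_measurable (PiM I \<mu>)" if "l \<in> I" for l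
  proof -
    assume "\<And>l. l \<in> I \<Longrightarrow> (\<lambda>y. y l) \<in> borel_measurable (PiM I \<mu>)"
    from this[OF that] show ?thesis by measurable
  qed
  hence "(\<lambda>y. \<Sum>l\<in>I. of_real (y l) * coef l $$ (i, j)) \<in> borel_measurable (PiM I \<mu>)"
    by (intro borel_measurable_sum borel_measurable_times borel_measurable_const)
  thus ?thesis using that by (simp add: model_def)
qed

lemma measurable_res_entry:
  "i < n \<Longrightarrow> j < n \<Longrightarrow> (\<lambda>y. res y $$ (i, j)) \<in> borel_measurable (PiM I \<mu>)"
  unfolding res_def
  by (rule borel_measurable_resolvent[where n = n])
    (use measurable_model_entry symmatD(1)[OF symmat_model] in auto)

lemma measurable_coefres_entry:
  assumes "l \<in> I" "i < n" "j < n"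
  shows "(\<lambda>y. coefres l y $$ (i, j)) \<in> borel_measurable (PiM I \<mu>)"
  unfolding coefres_def mat_mult_entry[OF coef_carrier[OF assms(1)] res_carrier assms(2,3)]
  by (intro borel_measurable_sum borel_measurable_times borel_measurable_const measurable_res_entry) (use assms in auto)

lemma measurable_stieltjes: "stieltjes \<in> borel_measurable (PiM I \<mu>)"
proof -
  have "stieltjes = (\<lambda>y. (\<Sum>i<n. res y $$ (i, i)) / of_nat n)"
    using carrier_matD(1)[OF res_carrier] by (simp add: fun_eq_iff stieltjes_def mat_trace_def)
  also have "\<dots> \<in> borel_measurable (PiM I \<mu>)"
    by (intro borel_measurable_divide borel_measurable_sum measurable_res_entry borel_measurable_const) auto
  finally show ?thesis .
qed

lemma integrable_stieltjes: "integrable (PiM I \<mu>) stieltjes"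
  by (rule PI.integrable_const_bound[where B = "1 / Im z"]) (use norm_stieltjes measurable_stieltjes in auto)

lemma measurable_trace_coefres:
  assumes "l \<in> I"
  shows "(\<lambda>y. mat_trace (coefres l y)) \<in> borel_measurable (PiM I \<mu>)"
    and "(\<lambda>y. mat_trace (coefres l y * coefres l y)) \<in> borel_measurable (PiM I \<mu>)"
proof -
  show "(\<lambda>y. mat_trace (coefres l y)) \<in> borel_measurable (PiM I \<mu>)"
    unfolding mat_trace_def carrier_matD(1)[OF coefres_carrier[OF assms]]
    by (intro borel_measurable_sum measurable_coefres_entry assms) auto
  show "(\<lambda>y. mat_trace (coefres l y * coefres l y)) \<in> borel_measurable (PiM I \<mu>)"
    unfolding mat_trace_mult[OF coefres_carrier[OF assms] coefres_carrier[OF assms]]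
    by (intro borel_measurable_sum borel_measurable_times measurable_coefres_entry assms) auto
qed

lemma norm_trace_coefres: "l \<in> I \<Longrightarrow> cmod (mat_trace (coefres l y * coefres l y)) \<le> (scale / Im z)\<^sup>2"
  by (rule norm_trace_mult_le_square[OF coefres_carrier coefres_carrier frob_coefres frob_coefres])

text \<open>Integration by parts in each term of \<open>trace_model_res\<close>. With \<open>\<kappa> = scale / Im z\<close>, a bound for
\<open>|B\<^sub>l G|\<close>, the function \<open>tr (B\<^sub>l G)\<close> has first order constant \<open>\<kappa>\<^sup>2\<close> and second order constant \<open>\<kappa>\<^sup>3\<close>.\<close>

theorem expected_resolvent_equation:
  assumes a: "0 < a"
  shows "cmod (z * PI.expectation stieltjes - 1
      - (\<Sum>l\<in>I. PI.expectation (\<lambda>y. mat_trace (coefres l y * coefres l y))) / of_nat n)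
    \<le> (\<Sum>l\<in>I. (a + 2) * (scale / Im z) ^ 3
        + 2 * (scale / Im z)\<^sup>2 * (\<integral>t. t\<^sup>2 * indicator {y. \<bar>y\<bar> > a} t \<partial>\<mu> l)) / n"
proof -
  let ?f = "\<lambda>l y. mat_trace (coefres l y)"
  let ?D = "\<lambda>l y. mat_trace (coefres l y * coefres l y)"
  have st: "integrable (PiM I \<mu>) (\<lambda>y. y l * ?f l y)"
    "cmod ((\<integral>y. y l * ?f l y \<partial>PiM I \<mu>) - (\<integral>y. ?D l y \<partial>PiM I \<mu>))
      \<le> (a + 2) * (scale / Im z) ^ 3 + 2 * (scale / Im z)\<^sup>2 * (\<integral>t. t\<^sup>2 * indicator {y. \<bar>y\<bar> > a} t \<partial>\<mu> l)"
    if l: "l \<in> I" for l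
  proof -
    have up: "coefres l (y(l := t)) - coefres l (y(l := 0)) 
        = of_real t \<cdot>\<^sub>m (coefres l (y(l := t)) * coefres l (y(l := 0)))" for y t
      using coefres_update[OF l, of y t 0] by simp
    note b = trace_second_order[OF coefres_carrier[OF l] coefres_carrier[OF l] up frob_coefres[OF l] frob_coefres[OF l]]
    have fb: "cmod (?f l y) \<le> scale * (sqrt n / Im z)" for y
    proof -
      have "cmod (?f l y) \<le> frob (coef l) * frob (res y)"
        unfolding coefres_def by (rule norm_mat_trace_mult_le[OF coef_carrier[OF l] res_carrier])
      also have "\<dots> \<le> scale * (sqrt n / Im z)"
        using symmetric_resolvent.frob_G_le[OF res, of y] frob_coef[OF l] z order.trans[OF frob_nonneg frob_coef[OF l]]
        by (intro mult_mono) (auto simp: res_def[symmetric] pos_le_divide_eq mult.commute)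
      finally show ?thesis .
    qed
    note s = stein_PiM[OF I l square_integrable[OF l] second_moment[OF l] first_moment[OF l]
        measurable_trace_coefres(1)[OF l] fb measurable_trace_coefres(2)[OF l] norm_trace_coefres[OF l] b a]
    show "integrable (PiM I \<mu>) (\<lambda>y. y l * ?f l y)" by (rule s(1))
    show "cmod ((\<integral>y. y l * ?f l y \<partial>PiM I \<mu>) - (\<integral>y. ?D l y \<partial>PiM I \<mu>))
      \<le> (a + 2) * (scale / Im z) ^ 3 + 2 * (scale / Im z)\<^sup>2 * (\<integral>t. t\<^sup>2 * indicator {y. \<bar>y\<bar> > a} t \<partial>\<mu> l)"
      by (rule s(2))
  qed
  have "z * stieltjes y - 1 = (\<Sum>l\<in>I. y l * ?f l y) / of_nat n" for y
    unfolding trace_model_res stieltjes_def using n by (simp add: diff_divide_distrib)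
  hence "PI.expectation (\<lambda>y. z * stieltjes y - 1) = (\<Sum>l\<in>I. PI.expectation (\<lambda>y. y l * ?f l y)) / of_nat n"
    using st(1) by simp
  moreover have "PI.expectation (\<lambda>y. z * stieltjes y - 1) = z * PI.expectation stieltjes - 1"
    using integrable_stieltjes by (simp add: PI.prob_space)
  ultimately have "z * PI.expectation stieltjes - 1 - (\<Sum>l\<in>I. PI.expectation (?D l)) / of_nat n
      = (\<Sum>l\<in>I. PI.expectation (\<lambda>y. y l * ?f l y) - PI.expectation (?D l)) / of_nat n"
    by (simp add: sum_subtractf diff_divide_distrib)
  also have "cmod \<dots> = cmod (\<Sum>l\<in>I. PI.expectation (\<lambda>y. y l * ?f l y) - PI.expectation (?D l)) / n"
    by (simp add: norm_divide)
  also have "\<dots> \<le> (\<Sum>l\<in>I. (a + 2) * (scale / Im z) ^ 3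
        + 2 * (scale / Im z)\<^sup>2 * (\<integral>t. t\<^sup>2 * indicator {y. \<bar>y\<bar> > a} t \<partial>\<mu> l)) / n"
    by (intro divide_right_mono order.trans[OF norm_sum] sum_mono st(2)) auto
  finally show ?thesis .
qed

text \<open>For a complex random variable \<open>s\<close>, \<open>E s\<^sup>2 - (E s)\<^sup>2 = E (s - E s)\<^sup>2\<close> is bounded by the sum of the
variances of the real and the imaginary part; both inherit the Lipschitz constants of \<open>s\<close>.\<close>

theorem stieltjes_concentration:
  "cmod (PI.expectation (\<lambda>y. (stieltjes y)\<^sup>2) - (PI.expectation stieltjes)\<^sup>2)
    \<le> 2 * (card I * (scale / (real n * (Im z)\<^sup>2))\<^sup>2)"
proof -
  define L where "L = scale / (real n * (Im z)\<^sup>2)"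
  define m where "m = PI.expectation stieltjes"
  have b: "\<bar>Re (stieltjes y)\<bar> \<le> 1 / Im z" "\<bar>Im (stieltjes y)\<bar> \<le> 1 / Im z" for y
    using norm_stieltjes[of y] abs_Re_le_cmod[of "stieltjes y"] abs_Im_le_cmod[of "stieltjes y"] by linarith+
  have lip: "\<bar>Re (stieltjes (y(i := s))) - Re (stieltjes (y(i := t)))\<bar> \<le> L * \<bar>s - t\<bar>"
    "\<bar>Im (stieltjes (y(i := s))) - Im (stieltjes (y(i := t)))\<bar> \<le> L * \<bar>s - t\<bar>" if "i \<in> I" for y i s t
    using stieltjes_lipschitz[OF that, of y s t] abs_Re_le_cmod[of "stieltjes (y(i := s)) - stieltjes (y(i := t))"]
      abs_Im_le_cmod[of "stieltjes (y(i := s)) - stieltjes (y(i := t))"]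
    unfolding L_def by simp_all
  have m1: "(\<lambda>y. Re (stieltjes y)) \<in> borel_measurable (PiM I \<mu>)" "(\<lambda>y. Im (stieltjes y)) \<in> borel_measurable (PiM I \<mu>)"
    using measurable_stieltjes by measurable
  have sm: "\<And>i. i \<in> I \<Longrightarrow> (\<integral>t. t\<^sup>2 \<partial>\<mu> i) \<le> 1" using second_moment by simp
  have v1: "PI.expectation (\<lambda>y. (Re (stieltjes y))\<^sup>2) - (PI.expectation (\<lambda>y. Re (stieltjes y)))\<^sup>2 \<le> (\<Sum>i\<in>I. L\<^sup>2)"
    by (rule variance_lipschitz_PiM[OF I square_integrable sm m1(1) b(1)]) (use lip in auto)
  have v2: "PI.expectation (\<lambda>y. (Im (stieltjes y))\<^sup>2) - (PI.expectation (\<lambda>y. Im (stieltjes y)))\<^sup>2 \<le> (\<Sum>i\<in>I. L\<^sup>2)"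
    by (rule variance_lipschitz_PiM[OF I square_integrable sm m1(2) b(2)]) (use lip in auto)
  have i2: "integrable (PiM I \<mu>) (\<lambda>y. (stieltjes y)\<^sup>2)"
  proof (rule PI.integrable_const_bound[where B = "(1 / Im z)\<^sup>2"])
    show "AE y in PiM I \<mu>. norm ((stieltjes y)\<^sup>2) \<le> (1 / Im z)\<^sup>2"
      unfolding norm_power by (intro AE_I2 power_mono norm_stieltjes) auto
  qed (use measurable_stieltjes in measurable)
  have ir: "integrable (PiM I \<mu>) (\<lambda>y. (Re (stieltjes y))\<^sup>2)" "integrable (PiM I \<mu>) (\<lambda>y. (Im (stieltjes y))\<^sup>2)"
    using m1 abs_square_le[OF b(1)] abs_square_le[OF b(2)]
    by (auto intro!: PI.integrable_const_bound[where B = "(1 / Im z)\<^sup>2"])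
  have nrm: "(cmod (stieltjes y - m))\<^sup>2 = (Re (stieltjes y))\<^sup>2 + (Im (stieltjes y))\<^sup>2
      - 2 * Re m * Re (stieltjes y) - 2 * Im m * Im (stieltjes y) + ((Re m)\<^sup>2 + (Im m)\<^sup>2)" for y
    unfolding cmod_power2 by (simp add: power2_diff algebra_simps)
  have re: "PI.expectation (\<lambda>y. Re (stieltjes y)) = Re m" "PI.expectation (\<lambda>y. Im (stieltjes y)) = Im m"
    using integrable_stieltjes by (simp_all add: m_def)
  have iri: "integrable (PiM I \<mu>) (\<lambda>y. Re (stieltjes y))" "integrable (PiM I \<mu>) (\<lambda>y. Im (stieltjes y))"
    using integrable_stieltjes by simp_all
  have "PI.expectation (\<lambda>y. (stieltjes y)\<^sup>2) - m\<^sup>2 = PI.expectation (\<lambda>y. (stieltjes y - m)\<^sup>2)"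
  proof -
    have "(stieltjes y - m)\<^sup>2 = (stieltjes y)\<^sup>2 - 2 * m * stieltjes y + m\<^sup>2" for y
      by (simp add: power2_diff)
    thus ?thesis using i2 integrable_stieltjes by (simp add: PI.prob_space m_def[symmetric] power2_eq_square)
  qed
  also have "cmod \<dots> \<le> PI.expectation (\<lambda>y. cmod ((stieltjes y - m)\<^sup>2))" by (rule integral_norm_bound)
  also have "\<dots> = PI.expectation (\<lambda>y. (cmod (stieltjes y - m))\<^sup>2)" by (simp add: norm_power)
  also have "\<dots> = PI.expectation (\<lambda>y. (Re (stieltjes y))\<^sup>2) + PI.expectation (\<lambda>y. (Im (stieltjes y))\<^sup>2)
      - (Re m)\<^sup>2 - (Im m)\<^sup>2"
    unfolding nrm using ir iri re by (simp add: PI.prob_space power2_eq_square)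
  also have "\<dots> \<le> 2 * (card I * L\<^sup>2)" using v1 v2 unfolding re by simp
  finally show ?thesis unfolding m_def L_def .
qed

end

section \<open>Centering\<close>

text \<open>The orthogonal projection onto the complement of the constant vectors.\<close>

definition centering :: "nat \<Rightarrow> complex Matrix.mat" where
  "centering n = Matrix.mat n n (\<lambda>(i, j). (if i = j then 1 else 0) - 1 / of_nat n)"

lemma centering_carrier [simp]: "centering n \<in> carrier_mat n n"
  by (simp add: centering_def)

lemma centering_transpose: "(centering n)\<^sup>T = centering n"
  by (rule eq_matI) (auto simp: centering_def)

lemma centering_mult_entry:
  assumes X: "X \<in> carrier_mat n k" and ij: "i < n" "j < k"
  shows "(centering n * X) $$ (i, j) = X $$ (i, j) - (\<Sum>l<n. X $$ (l, j)) / of_nat n"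
proof -
  have "(centering n * X) $$ (i, j) = (\<Sum>l<n. (if i = l then X $$ (l, j) else 0) - X $$ (l, j) / of_nat n)"
    unfolding mat_mult_entry[OF centering_carrier X ij]
    using ij by (intro sum.cong) (auto simp: centering_def algebra_simps)
  also have "\<dots> = X $$ (i, j) - (\<Sum>l<n. X $$ (l, j)) / of_nat n"
    using ij by (simp add: sum_subtractf sum_divide_distrib)
  finally show ?thesis .
qed

lemma centering_col_sum:
  assumes X: "X \<in> carrier_mat n k" and j: "j < k" and n: "0 < n"
  shows "(\<Sum>i<n. (centering n * X) $$ (i, j)) = 0"
proof -
  have "(\<Sum>i<n. (centering n * X) $$ (i, j)) = (\<Sum>i<n. X $$ (i, j) - (\<Sum>l<n. X $$ (l, j)) / of_nat n)"
    using centering_mult_entry[OF X _ j] by (intro sum.cong) auto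
  thus ?thesis using n by (simp add: sum_subtractf)
qed

text \<open>Subtracting the mean does not increase the sum of squares: the projection is a contraction.\<close>

lemma sum_centered_le:
  fixes x :: "nat \<Rightarrow> complex"
  assumes n: "0 < n"
  shows "(\<Sum>i<n. (cmod (x i - (\<Sum>l<n. x l) / of_nat n))\<^sup>2) \<le> (\<Sum>i<n. (cmod (x i))\<^sup>2)"
proof -
  define m where "m = (\<Sum>l<n. x l) / of_nat n"
  have Re: "(\<Sum>l<n. Re (x l)) = n * Re m" and Im: "(\<Sum>l<n. Im (x l)) = n * Im m"
    using n by (simp_all add: m_def Re_divide_of_nat Im_divide_of_nat)
  have "(cmod (x i - m))\<^sup>2 = (cmod (x i))\<^sup>2 - 2 * Re m * Re (x i) - 2 * Im m * Im (x i) + ((Re m)\<^sup>2 + (Im m)\<^sup>2)" for i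
    unfolding cmod_power2 by (simp add: power2_diff algebra_simps)
  hence "(\<Sum>i<n. (cmod (x i - m))\<^sup>2) = (\<Sum>i<n. (cmod (x i))\<^sup>2) - 2 * Re m * (\<Sum>i<n. Re (x i))
      - 2 * Im m * (\<Sum>i<n. Im (x i)) + n * ((Re m)\<^sup>2 + (Im m)\<^sup>2)"
    by (simp add: sum.distrib sum_subtractf sum_distrib_left)
  also have "\<dots> = (\<Sum>i<n. (cmod (x i))\<^sup>2) - n * ((Re m)\<^sup>2 + (Im m)\<^sup>2)"
    unfolding Re Im by (simp add: power2_eq_square algebra_simps)
  also have "\<dots> \<le> (\<Sum>i<n. (cmod (x i))\<^sup>2)" by simp
  finally show ?thesis by (simp add: m_def)
qed

lemma frob_centering_mult_le:
  assumes X: "X \<in> carrier_mat n k" and n: "0 < n"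
  shows "frob (centering n * X) \<le> frob X"
proof (rule power2_le_imp_le)
  have PX: "centering n * X \<in> carrier_mat n k" by (rule mult_carrier_mat[OF centering_carrier X])
  have "(frob (centering n * X))\<^sup>2 = (\<Sum>j<k. \<Sum>i<n. (cmod (X $$ (i, j) - (\<Sum>l<n. X $$ (l, j)) / of_nat n))\<^sup>2)"
    unfolding frob_square carrier_matD[OF PX]
    by (subst sum.swap, intro sum.cong refl) (simp add: centering_mult_entry[OF X] del: index_mult_mat)
  also have "\<dots> \<le> (\<Sum>j<k. \<Sum>i<n. (cmod (X $$ (i, j)))\<^sup>2)"
    by (intro sum_mono sum_centered_le n)
  also have "\<dots> = (frob X)\<^sup>2" using X by (subst sum.swap) (simp add: frob_square)
  finally show "(frob (centering n * X))\<^sup>2 \<le> (frob X)\<^sup>2" .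
qed simp

lemma frob_mult_centering_le:
  assumes X: "X \<in> carrier_mat k n" and n: "0 < n"
  shows "frob (X * centering n) \<le> frob X"
  using frob_centering_mult_le[of "X\<^sup>T" n k] X n transpose_mult[OF X centering_carrier] frob_transpose[of "X * centering n"]
  by (simp add: centering_transpose)

lemma centering_sandwich_sum:
  assumes X: "X \<in> carrier_mat n n" and ij: "i < n" "j < n"
  shows "(centering n * X * centering n) $$ (i, j)
    = (\<Sum>k<n. \<Sum>m<n. centering n $$ (i, m) * X $$ (m, k) * centering n $$ (k, j))"
proof -
  note PX = mult_carrier_mat[OF centering_carrier X]
  show ?thesis
    unfolding mat_mult_entry[OF PX centering_carrier ij]
    using mat_mult_entry[OF centering_carrier X ij(1)]
    by (intro sum.cong refl) (simp add: sum_distrib_right del: index_mult_mat)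
qed

lemma centering_sandwich_entry:
  assumes X: "X \<in> carrier_mat n n" and ij: "i < n" "j < n"
  shows "(centering n * X * centering n) $$ (i, j)
    = X $$ (i, j) - (\<Sum>l<n. X $$ (i, l)) / of_nat n - (\<Sum>l<n. X $$ (l, j)) / of_nat n
      + (\<Sum>l<n. \<Sum>m<n. X $$ (l, m)) / (of_nat n)\<^sup>2"
proof -
  note PX = mult_carrier_mat[OF centering_carrier X]
  have "(centering n * X * centering n) $$ (i, j)
      = (\<Sum>l<n. (centering n * X) $$ (i, l) * ((if l = j then 1 else 0) - 1 / of_nat n))"
    unfolding mat_mult_entry[OF PX centering_carrier ij] using ij by (intro sum.cong) (auto simp: centering_def)
  also have "\<dots> = (\<Sum>l<n. if l = j then (centering n * X) $$ (i, l) else 0) - (\<Sum>l<n. (centering n * X) $$ (i, l)) / of_nat n"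
    unfolding sum_divide_distrib sum_subtractf[symmetric]
    by (intro sum.cong) (auto simp: algebra_simps simp del: index_mult_mat)
  also have "(\<Sum>l<n. if l = j then (centering n * X) $$ (i, l) else 0) = (centering n * X) $$ (i, j)"
    using ij by simp
  also have "(\<Sum>l<n. (centering n * X) $$ (i, l)) = (\<Sum>l<n. X $$ (i, l)) - (\<Sum>l<n. \<Sum>m<n. X $$ (l, m)) / of_nat n"
  proof -
    have "(\<Sum>l<n. (centering n * X) $$ (i, l)) = (\<Sum>l<n. X $$ (i, l) - (\<Sum>m<n. X $$ (m, l)) / of_nat n)"
      using centering_mult_entry[OF X ij(1)] by (intro sum.cong) auto
    also have "\<dots> = (\<Sum>l<n. X $$ (i, l)) - (\<Sum>l<n. \<Sum>m<n. X $$ (m, l)) / of_nat n"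
      by (simp add: sum_subtractf sum_divide_distrib)
    finally show ?thesis unfolding sum.swap[of "\<lambda>l m. X $$ (m, l)"] .
  qed
  also have "(centering n * X) $$ (i, j) = X $$ (i, j) - (\<Sum>l<n. X $$ (l, j)) / of_nat n"
    by (rule centering_mult_entry[OF X ij])
  finally show ?thesis by (simp add: diff_divide_distrib power2_eq_square del: index_mult_mat)
qed

lemma centering_idem:
  assumes n: "0 < n" shows "centering n * centering n = centering n"
proof (rule eq_matI)
  fix i j assume "i < dim_row (centering n)" "j < dim_col (centering n)"
  hence ij: "i < n" "j < n" by (auto simp: centering_def)
  have "(\<Sum>l<n. centering n $$ (l, j)) = (\<Sum>l<n. (if l = j then 1 else 0) - 1 / of_nat n)"
    using ij by (intro sum.cong) (auto simp: centering_def)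
  also have "\<dots> = 0" using ij n by (simp add: sum_subtractf)
  finally show "(centering n * centering n) $$ (i, j) = centering n $$ (i, j)"
    unfolding centering_mult_entry[OF centering_carrier ij] by simp
qed (auto simp: centering_def)

lemma symmat_sandwich:
  assumes A: "symmat n A"
  shows "symmat n (centering n * A * centering n)"
proof -
  note a = symmatD[OF A]
  have "(\<Sum>l<n. A $$ (l, j)) = (\<Sum>l<n. A $$ (j, l))" if "j < n" for j
    using a(3) that by (intro sum.cong) auto
  moreover have "centering n * A * centering n \<in> carrier_mat n n"
    using mult_carrier_mat[OF mult_carrier_mat[OF centering_carrier a(1)] centering_carrier] .
  ultimately show ?thesis unfolding symmat_def
    using a(2,3) by (auto simp: centering_sandwich_entry[OF a(1)] simp del: index_mult_mat
        intro!: Reals_add Reals_diff Reals_divide sum_in_Reals Reals_power)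
qed

text \<open>By \<open>centering_sandwich_entry\<close>, \<open>A - P A P\<close> has entries \<open>b i + b j\<close>, where \<open>b\<close> is the vector of row
means corrected by half of the overall mean. Polarisation,
\<open>b i + b j = ((1 + b i) (1 + b j) - (1 - b i) (1 - b j)) / 2\<close>, writes this as a difference of two
real symmetric rank one matrices, and \<open>trace_resolvent_rank_one\<close> applies to each whatever the size
of \<open>b\<close>.\<close>

theorem trace_resolvent_centering:
  assumes A: "symmat n A" and z: "Im z \<noteq> 0" and n: "0 < n"
  shows "\<bar>Im z\<bar> * cmod (mat_trace (resolvent A z) - mat_trace (resolvent (centering n * A * centering n) z)) \<le> 2"
proof -
  let ?C = "centering n * A * centering n"
  define b where "b = (\<lambda>i. (\<Sum>l<n. A $$ (i, l)) / of_nat n - (\<Sum>l<n. \<Sum>m<n. A $$ (l, m)) / (of_nat n)\<^sup>2 / 2)"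
  define V where "V = Matrix.mat n 1 (\<lambda>(i, _). 1 + b i)"
  define W where "W = Matrix.mat n 1 (\<lambda>(i, _). 1 - b i)"
  note a = symmatD[OF A]
  have C: "symmat n ?C" by (rule symmat_sandwich[OF A])
  have bR: "b i \<in> \<real>" if "i < n" for i
    unfolding b_def using a(2) that
    by (intro Reals_diff Reals_divide sum_in_Reals Reals_power) auto
  have V: "V \<in> carrier_mat n 1" "\<And>i. i < n \<Longrightarrow> V $$ (i, 0) \<in> \<real>" using bR by (auto simp: V_def)
  have W: "W \<in> carrier_mat n 1" "\<And>i. i < n \<Longrightarrow> W $$ (i, 0) \<in> \<real>" using bR by (auto simp: W_def)
  have VV: "symmat n (V * V\<^sup>T)" by (rule symmat_gram[OF V(1)]) (use V(2) in auto)
  have WW: "symmat n (W * W\<^sup>T)" by (rule symmat_gram[OF W(1)]) (use W(2) in auto)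
  have VVe: "(V * V\<^sup>T) $$ (i, j) = (1 + b i) * (1 + b j)" if "i < n" "j < n" for i j
    using that by (subst mat_mult_entry[of _ n 1 _ n]) (auto simp: V_def)
  have WWe: "(W * W\<^sup>T) $$ (i, j) = (1 - b i) * (1 - b j)" if "i < n" "j < n" for i j
    using that by (subst mat_mult_entry[of _ n 1 _ n]) (auto simp: W_def)
  define B where "B = ?C + of_real (1 / 2) \<cdot>\<^sub>m (V * V\<^sup>T)"
  have dC: "dim_row ?C = n" "dim_col ?C = n" using symmatD(1)[OF C] by (blast dest: carrier_matD)+
  have dV: "dim_row (V * V\<^sup>T) = n" "dim_col (V * V\<^sup>T) = n" using symmatD(1)[OF VV] by (blast dest: carrier_matD)+
  have dW: "dim_row (W * W\<^sup>T) = n" "dim_col (W * W\<^sup>T) = n" using symmatD(1)[OF WW] by (blast dest: carrier_matD)+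
  have Be: "B $$ (i, j) = ?C $$ (i, j) + of_real (1 / 2) * (V * V\<^sup>T) $$ (i, j)" if "i < n" "j < n" for i j
    using that dC dV by (simp add: B_def del: index_mult_mat)
  have Bc: "B \<in> carrier_mat n n" unfolding B_def by (intro add_carrier_mat smult_carrier_mat symmatD(1)[OF VV])
  have B: "symmat n B"
    unfolding symmat_def using Bc symmatD(2,3)[OF C] symmatD(2,3)[OF VV]
    by (auto simp: Be simp del: index_mult_mat intro!: Reals_add Reals_mult)
  have 1: "B - ?C = of_real (1 / 2) \<cdot>\<^sub>m (V * V\<^sup>T)"
  proof (rule eq_matI)
    fix i j assume "i < dim_row (of_real (1 / 2) \<cdot>\<^sub>m (V * V\<^sup>T))" "j < dim_col (of_real (1 / 2) \<cdot>\<^sub>m (V * V\<^sup>T))"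
    hence ij: "i < n" "j < n" using dV by (simp_all del: index_mult_mat)
    have "(B - ?C) $$ (i, j) = B $$ (i, j) - ?C $$ (i, j)"
      using ij dC by (simp del: index_mult_mat)
    thus "(B - ?C) $$ (i, j) = (of_real (1 / 2) \<cdot>\<^sub>m (V * V\<^sup>T)) $$ (i, j)"
      using ij dV by (simp add: Be del: index_mult_mat)
  qed (use dC dV in \<open>simp_all del: index_mult_mat\<close>)
  have 2: "A - B = of_real (- 1 / 2) \<cdot>\<^sub>m (W * W\<^sup>T)"
  proof (rule eq_matI)
    fix i j assume "i < dim_row (of_real (- 1 / 2) \<cdot>\<^sub>m (W * W\<^sup>T))" "j < dim_col (of_real (- 1 / 2) \<cdot>\<^sub>m (W * W\<^sup>T))"
    hence ij: "i < n" "j < n" using dW by (simp_all del: index_mult_mat)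
    have "(A - B) $$ (i, j) = A $$ (i, j) - B $$ (i, j)"
      using ij Bc by (simp del: index_mult_mat)
    also have "\<dots> = A $$ (i, j) - ?C $$ (i, j) - 1 / 2 * ((1 + b i) * (1 + b j))"
      using ij by (simp add: Be VVe del: index_mult_mat)
    also have "A $$ (i, j) - ?C $$ (i, j) = b i + b j"
    proof -
      have "(\<Sum>l<n. A $$ (l, j)) = (\<Sum>l<n. A $$ (j, l))" using a(3) ij by (intro sum.cong) auto
      thus ?thesis unfolding centering_sandwich_entry[OF a(1) ij] b_def by simp
    qed
    finally show "(A - B) $$ (i, j) = (of_real (- 1 / 2) \<cdot>\<^sub>m (W * W\<^sup>T)) $$ (i, j)"
      using ij dW by (simp add: WWe del: index_mult_mat) (simp add: field_simps)
  qed (use Bc dW in \<open>simp_all del: index_mult_mat\<close>)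
  have "\<bar>Im z\<bar> * cmod (mat_trace (resolvent B z) - mat_trace (resolvent ?C z)) \<le> 1"
    by (rule trace_resolvent_rank_one[OF C B z V 1])
  moreover have "\<bar>Im z\<bar> * cmod (mat_trace (resolvent A z) - mat_trace (resolvent B z)) \<le> 1"
    by (rule trace_resolvent_rank_one[OF B A z W 2])
  moreover have "\<bar>Im z\<bar> * cmod (mat_trace (resolvent A z) - mat_trace (resolvent ?C z))
      \<le> \<bar>Im z\<bar> * (cmod (mat_trace (resolvent A z) - mat_trace (resolvent B z)) + cmod (mat_trace (resolvent B z) - mat_trace (resolvent ?C z)))"
    by (intro mult_left_mono) (metis norm_triangle_ineq diff_add_cancel add_diff_eq, simp)
  ultimately show ?thesis by (simp add: distrib_left)
qed

section \<open>The adjacency matrix of an edge\<close>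

definition adjacency :: "nat \<Rightarrow> nat set \<Rightarrow> complex Matrix.mat" where
  "adjacency n E = Matrix.mat n n (\<lambda>(i, j). edge_entry E i j)"

text \<open>A column vector, encoded as a matrix with one column so that it can serve as a Gram factor.\<close>

definition incidence_vec :: "nat \<Rightarrow> nat set \<Rightarrow> complex Matrix.mat" where
  "incidence_vec n E = Matrix.mat n 1 (\<lambda>(i, _). of_bool (Suc i \<in> E))"

definition incidence_diag :: "nat \<Rightarrow> nat set \<Rightarrow> complex Matrix.mat" where
  "incidence_diag n E = Matrix.mat n n (\<lambda>(i, j). of_bool (i = j \<and> Suc i \<in> E))"

lemma adjacency_carrier [simp]: "adjacency n E \<in> carrier_mat n n"
  and incidence_vec_carrier [simp]: "incidence_vec n E \<in> carrier_mat n 1"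
  and incidence_diag_carrier [simp]: "incidence_diag n E \<in> carrier_mat n n"
  by (simp_all add: adjacency_def incidence_vec_def incidence_diag_def)

lemma sum_indicator_edge:
  assumes "E \<subseteq> {1..n}"
  shows "(\<Sum>i<n. of_bool (Suc i \<in> E)) = real (card E)"
proof -
  have "(\<Sum>i<n. of_bool (Suc i \<in> E)) = real (card {i. i < n \<and> Suc i \<in> E})"
    by (simp add: sum.If_cases Int_def of_bool_def)
  also have "card {i. i < n \<and> Suc i \<in> E} = card E"
  proof (rule bij_betw_same_card[of Suc], rule bij_betwI[where g = "\<lambda>x. x - 1"])
    show "Suc \<in> {i. i < n \<and> Suc i \<in> E} \<rightarrow> E" by auto
    show "(\<lambda>x. x - 1) \<in> E \<rightarrow> {i. i < n \<and> Suc i \<in> E}" using assms by force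
  qed (use assms in force)+
  finally show ?thesis .
qed

lemma frob_incidence:
  assumes "E \<subseteq> {1..n}"
  shows "(frob (incidence_vec n E))\<^sup>2 = card E" "(frob (incidence_diag n E))\<^sup>2 = card E"
proof -
  have ob: "(cmod (of_bool b))\<^sup>2 = of_bool b" for b by (cases b) auto
  have "(frob (incidence_vec n E))\<^sup>2 = (\<Sum>i<n. of_bool (Suc i \<in> E))"
    unfolding frob_square by (auto simp: incidence_vec_def ob intro!: sum.cong)
  thus "(frob (incidence_vec n E))\<^sup>2 = card E" using sum_indicator_edge[OF assms] by simp
  have inner: "(\<Sum>j<n. (cmod (incidence_diag n E $$ (i, j)))\<^sup>2) = of_bool (Suc i \<in> E)" if "i < n" for i
  proof -
    have "(\<Sum>j<n. (cmod (incidence_diag n E $$ (i, j)))\<^sup>2) = (\<Sum>j<n. if j = i then of_bool (Suc i \<in> E) else 0)"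
      by (intro sum.cong refl) (use that in \<open>auto simp: incidence_diag_def\<close>)
    thus ?thesis unfolding sum.delta[OF finite_lessThan] using that by simp
  qed
  have "(frob (incidence_diag n E))\<^sup>2 = (\<Sum>i<n. \<Sum>j<n. (cmod (incidence_diag n E $$ (i, j)))\<^sup>2)"
    unfolding frob_square by (simp add: incidence_diag_def)
  also have "\<dots> = (\<Sum>i<n. of_bool (Suc i \<in> E))" by (intro sum.cong refl inner) auto
  finally show "(frob (incidence_diag n E))\<^sup>2 = card E" using sum_indicator_edge[OF assms] by simp
qed

text \<open>The matrix \<open>a a\<^sup>T - diag a\<close> as a difference of Gram matrices; \<open>diag a\<close> equals its own square since
\<open>a\<close> has entries 0 and 1.\<close>

lemma adjacency_gram:
  "incidence_vec n E * (incidence_vec n E)\<^sup>T - incidence_diag n E * (incidence_diag n E)\<^sup>T = adjacency n E"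
proof (rule eq_matI)
  fix i j assume "i < dim_row (adjacency n E)" "j < dim_col (adjacency n E)"
  hence ij: "i < n" "j < n" by (auto simp: adjacency_def)
  have 1: "(incidence_vec n E * (incidence_vec n E)\<^sup>T) $$ (i, j) = of_bool (Suc i \<in> E) * of_bool (Suc j \<in> E)"
    using ij by (subst mat_mult_entry[of _ n 1 _ n]) (auto simp: incidence_vec_def)
  have "(incidence_diag n E * (incidence_diag n E)\<^sup>T) $$ (i, j) = (\<Sum>l<n. if l = i then of_bool (i = j \<and> Suc i \<in> E) else 0)"
    using ij by (subst mat_mult_entry[of _ n n _ n]) (auto simp: incidence_diag_def intro!: sum.cong)
  hence 2: "(incidence_diag n E * (incidence_diag n E)\<^sup>T) $$ (i, j) = of_bool (i = j \<and> Suc i \<in> E)"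
    using ij by simp
  have "dim_row (incidence_diag n E * (incidence_diag n E)\<^sup>T) = n" "dim_col (incidence_diag n E * (incidence_diag n E)\<^sup>T) = n"
    by (auto simp: incidence_diag_def)
  thus "(incidence_vec n E * (incidence_vec n E)\<^sup>T - incidence_diag n E * (incidence_diag n E)\<^sup>T) $$ (i, j)
      = adjacency n E $$ (i, j)"
    using ij by (simp add: 1 2 adjacency_def edge_entry_def del: index_mult_mat)
qed (auto simp: adjacency_def incidence_diag_def)

lemma centered_gram:
  assumes V: "V \<in> carrier_mat n k"
  shows "(centering n * V) * (centering n * V)\<^sup>T = centering n * (V * V\<^sup>T) * centering n"
proof -
  have VT: "V\<^sup>T \<in> carrier_mat k n" using V by simp
  note P = centering_carrier[of n]
  have "(centering n * V)\<^sup>T = V\<^sup>T * centering n"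
    using transpose_mult[OF P V] by (simp add: centering_transpose)
  hence "(centering n * V) * (centering n * V)\<^sup>T = centering n * V * (V\<^sup>T * centering n)" by simp
  also have "\<dots> = centering n * V * V\<^sup>T * centering n"
    by (rule assoc_mult_mat[symmetric, OF mult_carrier_mat[OF P V] VT P])
  also have "centering n * V * V\<^sup>T = centering n * (V * V\<^sup>T)" by (rule assoc_mult_mat[OF P V VT])
  finally show ?thesis .
qed

text \<open>Each of the sums is at most \<open>|W|\<^sup>2\<close> in absolute value. The three terms contribute \<open>1\<close>, \<open>4 \<sqdot> 2\<close> and
\<open>4 \<sqdot> 3\<close> to the constant.\<close>

lemma norm_contraction_remainder:
  assumes W: "W \<in> carrier_mat n n" and \<rho>: "\<bar>\<rho>1\<bar> \<le> 1" "\<bar>\<rho>2\<bar> \<le> 1"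
  shows "cmod (of_real \<rho>2 * (\<Sum>j<n. \<Sum>k<n. W $$ (j, k) * W $$ (k, j)) + 4 * of_real (\<rho>1 - \<rho>2) * (\<Sum>j<n. W $$ (j, j) * W $$ (j, j))
      + of_real (1 - 2 * \<rho>1 + \<rho>2) * ((\<Sum>i<n. \<Sum>j<n. W $$ (j, i) * W $$ (j, i)) - 2 * (\<Sum>j<n. W $$ (j, j) * W $$ (j, j))))
    \<le> 21 * (frob W)\<^sup>2"
proof -
  define F where "F = (frob W)\<^sup>2"
  have F: "F = (\<Sum>i<n. \<Sum>j<n. (cmod (W $$ (i, j)))\<^sup>2)" using W by (simp add: F_def frob_square)
  have 1: "cmod (\<Sum>j<n. \<Sum>k<n. W $$ (j, k) * W $$ (k, j)) \<le> F"
    using norm_mat_trace_mult_le[OF W W] by (simp add: mat_trace_mult[OF W W] F_def power2_eq_square)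
  have 2: "cmod (\<Sum>j<n. W $$ (j, j) * W $$ (j, j)) \<le> F"
  proof -
    have "cmod (\<Sum>j<n. W $$ (j, j) * W $$ (j, j)) \<le> (\<Sum>j<n. (cmod (W $$ (j, j)))\<^sup>2)"
      by (intro order.trans[OF norm_sum] sum_mono) (simp add: norm_mult power2_eq_square)
    also have "\<dots> \<le> F" unfolding F by (intro sum_mono member_le_sum) auto
    finally show ?thesis .
  qed
  have 3: "cmod (\<Sum>i<n. \<Sum>j<n. W $$ (j, i) * W $$ (j, i)) \<le> F"
  proof -
    have "cmod (\<Sum>i<n. \<Sum>j<n. W $$ (j, i) * W $$ (j, i)) \<le> (\<Sum>i<n. \<Sum>j<n. (cmod (W $$ (j, i)))\<^sup>2)"
      by (intro order.trans[OF norm_sum] sum_mono) (simp add: norm_mult power2_eq_square)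
    also have "\<dots> = F" unfolding F by (rule sum.swap)
    finally show ?thesis .
  qed
  have F0: "0 \<le> F" by (simp add: F_def)
  define a b c where "a = (\<Sum>j<n. \<Sum>k<n. W $$ (j, k) * W $$ (k, j))"
    and "b = (\<Sum>j<n. W $$ (j, j) * W $$ (j, j))" and "c = (\<Sum>i<n. \<Sum>j<n. W $$ (j, i) * W $$ (j, i))"
  have A: "cmod (of_real \<rho>2 * a) \<le> 1 * F"
    unfolding norm_mult norm_of_real using \<rho>(2) 1 by (intro mult_mono) (auto simp: a_def)
  have B: "cmod (4 * of_real (\<rho>1 - \<rho>2) * b) \<le> 8 * F"
  proof -
    have "cmod (4 * of_real (\<rho>1 - \<rho>2) * b) = (4 * \<bar>\<rho>1 - \<rho>2\<bar>) * cmod b"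
      unfolding norm_mult norm_of_real by simp
    also have "\<dots> \<le> 8 * F" using \<rho> 2 by (intro mult_mono) (auto simp: b_def)
    finally show ?thesis .
  qed
  have C: "cmod (of_real (1 - 2 * \<rho>1 + \<rho>2) * (c - 2 * b)) \<le> 4 * (3 * F)"
  proof -
    have "cmod (c - 2 * b) \<le> cmod c + cmod (2 * b)" by (rule norm_triangle_ineq4)
    also have "\<dots> \<le> 3 * F" using 2 3 by (simp add: norm_mult b_def c_def)
    finally show ?thesis
      unfolding norm_mult norm_of_real using \<rho> F0 by (intro mult_mono) auto
  qed
  have "cmod (of_real \<rho>2 * a + 4 * of_real (\<rho>1 - \<rho>2) * b + of_real (1 - 2 * \<rho>1 + \<rho>2) * (c - 2 * b)) \<le> 1 * F + 8 * F + 4 * (3 * F)"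
    by (intro order.trans[OF norm_triangle_ineq] add_mono A B C)
  thus ?thesis unfolding a_def b_def c_def F_def by simp
qed

lemma corr_bounds:
  assumes "2 \<le> r" "r \<le> n" "4 \<le> n"
  shows "\<bar>corr1 n r\<bar> \<le> 1" "\<bar>corr2 n r\<bar> \<le> 1"
proof -
  have 1: "\<bar>(real r - 2) / (real n - 2)\<bar> \<le> 1" using assms by (auto simp: abs_le_iff divide_simps)
  have 2: "\<bar>(real r - 3) / (real n - 3)\<bar> \<le> 1" using assms by (auto simp: abs_le_iff divide_simps)
  show "\<bar>corr1 n r\<bar> \<le> 1" using 1 by (simp add: corr1_def)
  have "corr2 n r = ((real r - 2) / (real n - 2)) * ((real r - 3) / (real n - 3))"
    by (simp add: corr2_def)
  thus "\<bar>corr2 n r\<bar> \<le> 1" using mult_mono[OF 1 2] by (simp add: abs_mult)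
qed

text \<open>Expanding \<open>tr (Q W Q W)\<close> into a sum over four vertices and exchanging it with the sum over the edges
replaces the products of entries of \<open>Q\<close> by the edge counts, after which \<open>contraction_total\<close>
evaluates the sum. The main term is the one with \<open>(tr W)\<^sup>2\<close>.\<close>

lemma sum_adjacency_traces:
  assumes r: "2 \<le> r" "r \<le> n" "4 \<le> n" and W: "W \<in> carrier_mat n n"
    and row0: "\<And>i. i < n \<Longrightarrow> (\<Sum>j<n. W $$ (i, j)) = 0" and col0: "\<And>j. j < n \<Longrightarrow> (\<Sum>i<n. W $$ (i, j)) = 0"
  shows "cmod ((\<Sum>E\<in>edge_sets n r. mat_trace (adjacency n E * W * (adjacency n E * W)))
      - of_nat (num_edges_pair n r) * (of_real (1 - 2 * corr1 n r + corr2 n r) * (mat_trace W)\<^sup>2))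
    \<le> num_edges_pair n r * (21 * (frob W)\<^sup>2)"
proof -
  let ?w = "\<lambda>i j. W $$ (i, j)"
  have QW: "adjacency n E * W \<in> carrier_mat n n" for E by (rule mult_carrier_mat[OF adjacency_carrier W])
  have tr: "mat_trace (adjacency n E * W * (adjacency n E * W))
      = (\<Sum>i<n. \<Sum>j<n. \<Sum>k<n. \<Sum>m<n. (edge_entry E i j * edge_entry E k m) * (?w j k * ?w m i))" for E
  proof -
    have e: "(adjacency n E * W) $$ (i, k) = (\<Sum>j<n. edge_entry E i j * ?w j k)" if "i < n" "k < n" for i k
      unfolding mat_mult_entry[OF adjacency_carrier W that] using that by (simp add: adjacency_def)
    have "mat_trace (adjacency n E * W * (adjacency n E * W))
        = (\<Sum>i<n. \<Sum>k<n. (\<Sum>j<n. edge_entry E i j * ?w j k) * (\<Sum>m<n. edge_entry E k m * ?w m i))"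
      unfolding mat_trace_mult[OF QW QW] by (intro sum.cong refl) (simp add: e del: index_mult_mat)
    also have "\<dots> = (\<Sum>i<n. \<Sum>k<n. \<Sum>j<n. \<Sum>m<n. (edge_entry E i j * edge_entry E k m) * (?w j k * ?w m i))"
      by (simp add: sum_product mult_ac)
    also have "\<dots> = (\<Sum>i<n. \<Sum>j<n. \<Sum>k<n. \<Sum>m<n. (edge_entry E i j * edge_entry E k m) * (?w j k * ?w m i))"
      by (intro sum.cong refl sum.swap)
    finally show ?thesis .
  qed
  let ?N = "of_nat (num_edges_pair n r) :: complex"
  let ?c = "\<lambda>i j k m. (if i \<noteq> j \<and> k \<noteq> m then
      of_real (corr2 n r) + of_real (corr1 n r - corr2 n r) *
        (of_bool (j = k) + of_bool (j = m) + of_bool (i = k) + of_bool (i = m))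
      + of_real (1 - 2 * corr1 n r + corr2 n r) * (of_bool (j = k \<and> i = m) + of_bool (j = m \<and> i = k)) else 0) :: complex"
  have "(\<Sum>E\<in>edge_sets n r. mat_trace (adjacency n E * W * (adjacency n E * W)))
     = (\<Sum>E\<in>edge_sets n r. \<Sum>i<n. \<Sum>j<n. \<Sum>k<n. \<Sum>m<n. (edge_entry E i j * edge_entry E k m) * (?w j k * ?w m i))"
    unfolding tr ..
  also have "\<dots> = (\<Sum>i<n. \<Sum>j<n. \<Sum>k<n. \<Sum>m<n. \<Sum>E\<in>edge_sets n r. (edge_entry E i j * edge_entry E k m) * (?w j k * ?w m i))"
    by (subst sum.swap, intro sum.cong refl, subst sum.swap, intro sum.cong refl, subst sum.swap, intro sum.cong refl, rule sum.swap)
  also have "\<dots> = (\<Sum>i<n. \<Sum>j<n. \<Sum>k<n. \<Sum>m<n. ?N * (?c i j k m * (?w j k * ?w m i)))"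
  proof (intro sum.cong refl)
    fix i j k m assume "i \<in> {..<n}" "j \<in> {..<n}" "k \<in> {..<n}" "m \<in> {..<n}"
    hence "(\<Sum>E\<in>edge_sets n r. edge_entry E i j * edge_entry E k m) = ?N * ?c i j k m"
      by (intro sum_edge_entry_products r) auto
    thus "(\<Sum>E\<in>edge_sets n r. (edge_entry E i j * edge_entry E k m) * (?w j k * ?w m i)) = ?N * (?c i j k m * (?w j k * ?w m i))"
      unfolding sum_distrib_right[symmetric] by (simp only: mult.assoc)
  qed
  also have "\<dots> = ?N * (\<Sum>i<n. \<Sum>j<n. \<Sum>k<n. \<Sum>m<n. ?c i j k m * (?w j k * ?w m i))"
    by (simp only: sum_distrib_left)
  also have "(\<Sum>i<n. \<Sum>j<n. \<Sum>k<n. \<Sum>m<n. ?c i j k m * (?w j k * ?w m i))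
    = (of_real (corr2 n r) * (\<Sum>j<n. \<Sum>k<n. ?w j k * ?w k j) + 4 * of_real (corr1 n r - corr2 n r) * (\<Sum>j<n. ?w j j * ?w j j)
      + of_real (1 - 2 * corr1 n r + corr2 n r) * ((\<Sum>j<n. ?w j j)\<^sup>2 + (\<Sum>i<n. \<Sum>j<n. ?w j i * ?w j i) - 2 * (\<Sum>j<n. ?w j j * ?w j j)))"
    by (rule contraction_total[of n ?w, OF row0 col0])
  also have "(\<Sum>j<n. ?w j j) = mat_trace W" using W by (simp add: mat_trace_def)
  finally have "(\<Sum>E\<in>edge_sets n r. mat_trace (adjacency n E * W * (adjacency n E * W)))
      - ?N * (of_real (1 - 2 * corr1 n r + corr2 n r) * (mat_trace W)\<^sup>2)
    = ?N * (of_real (corr2 n r) * (\<Sum>j<n. \<Sum>k<n. ?w j k * ?w k j) + 4 * of_real (corr1 n r - corr2 n r) * (\<Sum>j<n. ?w j j * ?w j j)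
      + of_real (1 - 2 * corr1 n r + corr2 n r) * ((\<Sum>i<n. \<Sum>j<n. ?w j i * ?w j i) - 2 * (\<Sum>j<n. ?w j j * ?w j j)))"
    by (simp add: algebra_simps)
  thus ?thesis
    using norm_contraction_remainder[OF W corr_bounds[OF r]] by (simp add: norm_mult mult_left_mono del: of_real_add of_real_diff)
qed

lemma smult_smult_mat: "a \<cdot>\<^sub>m (b \<cdot>\<^sub>m A) = (a * b) \<cdot>\<^sub>m (A :: complex Matrix.mat)"
  by (rule eq_matI) auto

section \<open>The centered hypergraph model\<close>

text \<open>The bound \<open>4 \<le> n\<close> keeps the denominators of the correlations away from 0.\<close>

locale hypergraph_model =
  fixes n r :: nat and L :: "nat set" and e :: "nat \<Rightarrow> nat set" and z :: complex
  assumes r: "2 \<le> r" "r \<le> n" "4 \<le> n" and L: "finite L" and e: "bij_betw e L (edge_sets n r)" and Imz: "0 < Im z"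
begin

definition "norm_const = 1 / sqrt (real n * real (num_edges_pair n r))"

lemma edge: "l \<in> L \<Longrightarrow> e l \<subseteq> {1..n}" "l \<in> L \<Longrightarrow> card (e l) = r"
  using bij_betwE[OF e] by (auto simp: edge_sets_def)

lemma n0: "0 < n" using r by simp

sublocale matrix_model n 1 n "L" "\<lambda>l. centering n * incidence_vec n (e l)" "\<lambda>l. centering n * incidence_diag n (e l)"
  norm_const "real r" z
proof
  fix l i j assume l: "l \<in> L"
  note cs = mult_carrier_mat[OF centering_carrier incidence_vec_carrier, of n "e l"]
    mult_carrier_mat[OF centering_carrier incidence_diag_carrier, of n "e l"]
  show "centering n * incidence_vec n (e l) \<in> carrier_mat n 1" "centering n * incidence_diag n (e l) \<in> carrier_mat n n"
    by (rule cs)+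
  have fr: "(frob (centering n * X))\<^sup>2 \<le> (frob X)\<^sup>2" if "X \<in> carrier_mat n k" for X k
    using frob_centering_mult_le[OF that n0] by (intro power_mono) auto
  show "(frob (centering n * incidence_vec n (e l)))\<^sup>2 \<le> real r" "(frob (centering n * incidence_diag n (e l)))\<^sup>2 \<le> real r"
    using fr[OF incidence_vec_carrier, of "e l"] fr[OF incidence_diag_carrier, of "e l"]
      frob_incidence[OF edge(1)[OF l]] edge(2)[OF l] by simp_all
  assume i: "i < n"
  show "(centering n * incidence_vec n (e l)) $$ (i, j) \<in> \<real>" if "j < 1"
    using i that unfolding centering_mult_entry[OF incidence_vec_carrier i that]
    by (intro Reals_diff Reals_divide sum_in_Reals) (auto simp: incidence_vec_def of_bool_def)
  show "(centering n * incidence_diag n (e l)) $$ (i, j) \<in> \<real>" if "j < n"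
    using i that unfolding centering_mult_entry[OF incidence_diag_carrier i that]
    by (intro Reals_diff Reals_divide sum_in_Reals) (auto simp: incidence_diag_def of_bool_def)
qed (use Imz r L in \<open>auto simp: norm_const_def\<close>)

text \<open>So \<open>model y\<close> is the compression by the centering projection of \<open>n\<^sup>-\<^sup>1\<^sup>/\<^sup>2 H\<^sub>n(y)\<close>.\<close>

lemma coef_eq: "coef l = of_real norm_const \<cdot>\<^sub>m (centering n * adjacency n (e l) * centering n)"
proof -
  let ?v = "incidence_vec n (e l)" and ?d = "incidence_diag n (e l)"
  have vv: "?v * ?v\<^sup>T \<in> carrier_mat n n"
    by (rule mult_carrier_mat[OF incidence_vec_carrier]) (simp add: incidence_vec_def)
  have dd: "?d * ?d\<^sup>T \<in> carrier_mat n n"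
    by (rule mult_carrier_mat[OF incidence_diag_carrier]) simp
  note P = centering_carrier[of n]
  have "centering n * (?v * ?v\<^sup>T) * centering n - centering n * (?d * ?d\<^sup>T) * centering n
      = centering n * adjacency n (e l) * centering n"
    unfolding adjacency_gram[symmetric] mult_minus_distrib_mat[OF P vv dd]
    by (rule minus_mult_distrib_mat[symmetric, OF mult_carrier_mat[OF P vv] mult_carrier_mat[OF P dd] P])
  thus ?thesis
    unfolding coef_def centered_gram[OF incidence_vec_carrier] centered_gram[OF incidence_diag_carrier] by simp
qed

text \<open>The two projections around each \<open>Q\<close> in \<open>tr (B\<^sub>l G B\<^sub>l G)\<close> are moved to the resolvents by
cyclicity of the trace. The resulting matrix has vanishing row and column sums, as the evaluation
of the contractions requires.\<close>

definition cres :: "(nat \<Rightarrow> real) \<Rightarrow> complex Matrix.mat" where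
  "cres y = centering n * res y * centering n"

lemma cres_carrier: "cres y \<in> carrier_mat n n"
  unfolding cres_def by (rule mult_carrier_mat[OF mult_carrier_mat[OF centering_carrier res_carrier] centering_carrier])

lemma cres_sums: "j < n \<Longrightarrow> (\<Sum>i<n. cres y $$ (i, j)) = 0" "i < n \<Longrightarrow> (\<Sum>j<n. cres y $$ (i, j)) = 0"
proof -
  have RP: "res y * centering n \<in> carrier_mat n n" by (rule mult_carrier_mat[OF res_carrier centering_carrier])
  have PR: "centering n * res y \<in> carrier_mat n n" by (rule mult_carrier_mat[OF centering_carrier res_carrier])
  have eq: "cres y = centering n * (res y * centering n)"
    unfolding cres_def by (rule assoc_mult_mat[OF centering_carrier res_carrier centering_carrier])
  show col: "(\<Sum>i<n. cres y $$ (i, j)) = 0" if "j < n" for j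
    unfolding eq by (rule centering_col_sum[OF RP that n0])
  have "(cres y)\<^sup>T = cres y"
    unfolding cres_def transpose_mult[OF PR centering_carrier] transpose_mult[OF centering_carrier res_carrier]
      centering_transpose
    using symmetric_resolvent.G_transpose[OF res, of y] assoc_mult_mat[OF centering_carrier res_carrier centering_carrier]
    by (simp add: res_def)
  hence sym: "cres y $$ (i, j) = cres y $$ (j, i)" if "i < n" "j < n" for i j
    using that cres_carrier[of y] by (metis carrier_matD index_transpose_mat(1))
  show "(\<Sum>j<n. cres y $$ (i, j)) = 0" if "i < n"
    using col[OF that] sym[OF that] by simp
qed

lemma frob_cres: "(frob (cres y))\<^sup>2 \<le> n / (Im z)\<^sup>2"
proof -
  have RP: "res y * centering n \<in> carrier_mat n n" by (rule mult_carrier_mat[OF res_carrier centering_carrier])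
  have eq: "cres y = centering n * (res y * centering n)"
    unfolding cres_def by (rule assoc_mult_mat[OF centering_carrier res_carrier centering_carrier])
  have "frob (cres y) \<le> frob (res y * centering n)" unfolding eq by (rule frob_centering_mult_le[OF RP n0])
  also have "\<dots> \<le> frob (res y)" by (rule frob_mult_centering_le[OF res_carrier n0])
  also have "\<dots> \<le> sqrt n / Im z"
    using symmetric_resolvent.frob_G_le[OF res, of y] Imz by (simp add: res_def pos_le_divide_eq mult.commute)
  finally have "(frob (cres y))\<^sup>2 \<le> (sqrt n / Im z)\<^sup>2" by (intro power_mono) auto
  thus ?thesis by (simp add: power_divide)
qed

lemma trace_coefres_square:
  "mat_trace (coefres l y * coefres l y)
    = of_real (norm_const\<^sup>2) * mat_trace (adjacency n (e l) * cres y * (adjacency n (e l) * cres y))"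
proof -
  let ?P = "centering n" and ?Q = "adjacency n (e l)" and ?G = "res y" and ?c = "complex_of_real norm_const"
  note P = centering_carrier[of n] and Q = adjacency_carrier[of n "e l"] and G = res_carrier[of y]
  note PQ = mult_carrier_mat[OF P Q] and PG = mult_carrier_mat[OF P G]
  note QPG = mult_carrier_mat[OF Q PG]
  let ?X = "?Q * (?P * ?G)"
  have "coefres l y = ?c \<cdot>\<^sub>m (?P * ?Q * ?P * ?G)"
    unfolding coefres_def coef_eq by (rule mult_smult_assoc_mat[OF mult_carrier_mat[OF PQ P] G])
  also have "?P * ?Q * ?P * ?G = ?P * ?X"
    unfolding assoc_mult_mat[OF PQ P G] by (rule assoc_mult_mat[OF P Q PG])
  finally have cr: "coefres l y = ?c \<cdot>\<^sub>m (?P * ?X)" .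
  note X = QPG and PX = mult_carrier_mat[OF P QPG]
  have "coefres l y * coefres l y = (?c * ?c) \<cdot>\<^sub>m (?P * ?X * (?P * ?X))"
    unfolding cr using mult_smult_distrib[OF smult_carrier_mat[OF PX] PX] mult_smult_assoc_mat[OF PX PX]
    by (simp add: smult_smult_mat)
  hence "mat_trace (coefres l y * coefres l y) = of_real (norm_const\<^sup>2) * mat_trace (?P * ?X * (?P * ?X))"
    using mat_trace_smult[OF mult_carrier_mat[OF PX PX]] by (simp add: power2_eq_square)
  also have "?P * ?X * (?P * ?X) = ?P * (?X * (?P * ?X))" by (rule assoc_mult_mat[OF P X PX])
  also have "mat_trace \<dots> = mat_trace (?X * (?P * ?X) * ?P)"
    by (rule mat_trace_mult_commute[OF P mult_carrier_mat[OF X PX]])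
  also have "?X * (?P * ?X) * ?P = ?X * ?P * (?X * ?P)"
    unfolding assoc_mult_mat[OF X P X, symmetric]
    by (rule assoc_mult_mat[OF mult_carrier_mat[OF X P] X P])
  also have "?X * ?P = ?Q * cres y"
    unfolding cres_def by (rule assoc_mult_mat[OF Q PG P])
  finally show ?thesis .
qed

text \<open>The centered model annihilates the constant vector \<open>1\<close>, so \<open>G 1 = 1/z\<close> and the entries of \<open>G\<close> sum
up to \<open>n / z\<close>. Centering therefore removes just \<open>1 / z\<close> from the trace.\<close>

lemma trace_cres: "mat_trace (cres y) = mat_trace (res y) - 1 / z"
proof -
  let ?P = "centering n" and ?G = "res y"
  note P = centering_carrier[of n] and G = res_carrier[of y]
  interpret R: symmetric_resolvent n "model y" z by (rule res)
  have z0: "z \<noteq> 0" using Imz by auto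
  have coef0: "(\<Sum>j<n. coef l $$ (i, j)) = 0" if "l \<in> L" "i < n" for l i
  proof -
    have AP: "adjacency n (e l) * ?P \<in> carrier_mat n n" by (rule mult_carrier_mat[OF adjacency_carrier P])
    have c: "coef l = of_real norm_const \<cdot>\<^sub>m (?P * (adjacency n (e l) * ?P))"
      unfolding coef_eq by (simp add: assoc_mult_mat[OF P adjacency_carrier P])
    have "(\<Sum>j<n. coef l $$ (j, i)) = of_real norm_const * (\<Sum>j<n. (?P * (adjacency n (e l) * ?P)) $$ (j, i))"
      unfolding c sum_distrib_left
      using that mult_carrier_mat[OF P AP] by (intro sum.cong refl index_smult_mat(1)) auto
    also have "\<dots> = 0" unfolding centering_col_sum[OF AP that(2) n0] by simp
    finally show ?thesis using symmatD(3)[OF symmat_coef[OF that(1)] _ that(2)] by simp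
  qed
  have model0: "(\<Sum>j<n. model y $$ (i, j)) = 0" if "i < n" for i
  proof -
    have "(\<Sum>j<n. model y $$ (i, j)) = (\<Sum>j<n. \<Sum>l\<in>L. of_real (y l) * coef l $$ (i, j))"
      using that by (simp add: model_def)
    also have "\<dots> = (\<Sum>l\<in>L. of_real (y l) * (\<Sum>j<n. coef l $$ (i, j)))"
      by (subst sum.swap) (simp add: sum_distrib_left)
    also have "\<dots> = 0" using coef0 that by simp
    finally show ?thesis .
  qed
  define S where "S = (\<Sum>i<n. \<Sum>j<n. ?G $$ (j, i))"
  have "of_nat n = (\<Sum>i<n. \<Sum>j<n. (1\<^sub>m n :: complex Matrix.mat) $$ (i, j))" by simp
  also have "\<dots> = (\<Sum>i<n. \<Sum>j<n. (R.Z * ?G) $$ (i, j))"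
    using R.Z_mult_G by (simp add: res_def)
  also have "\<dots> = (\<Sum>i<n. \<Sum>j<n. z * ?G $$ (i, j) - (\<Sum>l<n. model y $$ (i, l) * ?G $$ (l, j)))"
    using R.ZX_entry[OF G] by (intro sum.cong refl) auto
  also have "\<dots> = z * (\<Sum>i<n. \<Sum>j<n. ?G $$ (i, j)) - (\<Sum>j<n. \<Sum>l<n. (\<Sum>i<n. model y $$ (l, i)) * ?G $$ (l, j))"
  proof -
    have "(\<Sum>i<n. \<Sum>j<n. \<Sum>l<n. model y $$ (i, l) * ?G $$ (l, j)) = (\<Sum>j<n. \<Sum>i<n. \<Sum>l<n. model y $$ (i, l) * ?G $$ (l, j))"
      by (rule sum.swap)
    also have "\<dots> = (\<Sum>j<n. \<Sum>l<n. \<Sum>i<n. model y $$ (i, l) * ?G $$ (l, j))"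
      by (intro sum.cong refl sum.swap)
    also have "\<dots> = (\<Sum>j<n. \<Sum>l<n. (\<Sum>i<n. model y $$ (l, i)) * ?G $$ (l, j))"
      unfolding sum_distrib_right using symmatD(3)[OF symmat_model] by (intro sum.cong refl) auto
    finally show ?thesis by (simp add: sum_subtractf sum_distrib_left)
  qed
  also have "(\<Sum>j<n. \<Sum>l<n. (\<Sum>i<n. model y $$ (l, i)) * ?G $$ (l, j)) = 0" using model0 by simp
  also have "(\<Sum>i<n. \<Sum>j<n. ?G $$ (i, j)) = S" unfolding S_def by (rule sum.swap)
  finally have S: "S = of_nat n / z" using z0 by (simp add: field_simps)
  have "mat_trace (cres y) = mat_trace (?P * (?P * ?G))"
    unfolding cres_def by (rule mat_trace_mult_commute[OF mult_carrier_mat[OF P G] P])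
  also have "?P * (?P * ?G) = ?P * ?G"
    unfolding assoc_mult_mat[OF P P G, symmetric] centering_idem[OF n0] ..
  also have "mat_trace (?P * ?G) = (\<Sum>i<n. ?G $$ (i, i) - (\<Sum>j<n. ?G $$ (j, i)) / of_nat n)"
    unfolding mat_trace_def carrier_matD(1)[OF mult_carrier_mat[OF P G]]
    using centering_mult_entry[OF G] by (intro sum.cong refl) auto
  also have "\<dots> = mat_trace ?G - S / of_nat n"
    using G by (simp add: sum_subtractf sum_divide_distrib mat_trace_def S_def)
  finally show ?thesis using n0 by (simp add: S)
qed

text \<open>The variance that an entry of the matrix keeps after centering, to leading order; it tends to
\<open>(1 - c)\<^sup>2\<close>.\<close>

definition gam :: real where "gam = 1 - 2 * corr1 n r + corr2 n r"

lemma gam_bound: "\<bar>gam\<bar> \<le> 4"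
  using corr_bounds[OF r] by (auto simp: gam_def)

lemma N_pos: "0 < num_edges_pair n r"
  using r by (simp add: num_edges_pair_def)

text \<open>Of the constant, 21 comes from the contractions and 12 from replacing \<open>tr (P G P)\<close> by
\<open>tr G\<close>, which differ by \<open>1 / z\<close>.\<close>

lemma quadratic_term:
  "cmod ((\<Sum>l\<in>L. mat_trace (coefres l y * coefres l y)) / of_nat n - of_real gam * (stieltjes y)\<^sup>2)
    \<le> 33 / (real n * (Im z)\<^sup>2)"
proof -
  let ?N = "real (num_edges_pair n r)" and ?\<eta> = "Im z"
  define T where "T = (\<Sum>E\<in>edge_sets n r. mat_trace (adjacency n E * cres y * (adjacency n E * cres y)))"
  have sum: "(\<Sum>l\<in>L. mat_trace (coefres l y * coefres l y)) = of_real (norm_const\<^sup>2) * T"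
    unfolding trace_coefres_square T_def sum_distrib_left by (rule sum.reindex_bij_betw[OF e])
  have nc: "norm_const\<^sup>2 = 1 / (real n * ?N)" by (simp add: norm_const_def power_divide)
  have N: "0 < ?N" and n1: "1 \<le> real n" using N_pos r by simp_all
  define s where "s = mat_trace (cres y) / of_nat n"
  have "cmod (T - of_real ?N * (of_real gam * (mat_trace (cres y))\<^sup>2)) \<le> ?N * (21 * (frob (cres y))\<^sup>2)"
    using sum_adjacency_traces[OF r cres_carrier cres_sums(2,1), of y] unfolding T_def gam_def by simp
  also have "\<dots> \<le> ?N * (21 * (n / ?\<eta>\<^sup>2))" by (intro mult_left_mono frob_cres) auto
  finally have T: "cmod (T - of_real ?N * (of_real gam * (mat_trace (cres y))\<^sup>2)) \<le> ?N * (21 * (n / ?\<eta>\<^sup>2))" .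
  have "of_real (norm_const\<^sup>2) * T / of_nat n - of_real gam * s\<^sup>2
      = (T - of_real ?N * (of_real gam * (mat_trace (cres y))\<^sup>2)) / of_real ((real n)\<^sup>2 * ?N)"
    unfolding nc s_def using n0 N by (simp add: field_simps power2_eq_square)
  also have "cmod \<dots> \<le> ?N * (21 * (n / ?\<eta>\<^sup>2)) / ((real n)\<^sup>2 * ?N)"
  proof -
    have "cmod (T - of_real ?N * (of_real gam * (mat_trace (cres y))\<^sup>2)) / \<bar>(real n)\<^sup>2 * ?N\<bar>
        \<le> ?N * (21 * (n / ?\<eta>\<^sup>2)) / \<bar>(real n)\<^sup>2 * ?N\<bar>"
      by (rule divide_right_mono[OF T abs_ge_zero])
    thus ?thesis unfolding norm_divide norm_of_real by simp
  qed
  also have "\<dots> = 21 / (n * ?\<eta>\<^sup>2)" using N n0 by (simp add: power2_eq_square)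
  finally have 1: "cmod (of_real (norm_const\<^sup>2) * T / of_nat n - of_real gam * s\<^sup>2) \<le> 21 / (n * ?\<eta>\<^sup>2)" .
  have z1: "cmod (1 / z) \<le> 1 / ?\<eta>"
    using abs_Im_le_cmod[of z] Imz by (simp add: norm_divide frac_le)
  have ss: "stieltjes y - s = 1 / z / of_nat n"
    unfolding s_def trace_cres stieltjes_def by (simp add: diff_divide_distrib)
  have d: "cmod (stieltjes y - s) \<le> 1 / ?\<eta> / n"
    unfolding ss norm_divide[of "1 / z"] norm_of_nat by (intro divide_right_mono z1) simp
  also have "\<dots> \<le> 1 / ?\<eta>" using n1 Imz by (simp add: divide_le_eq)
  finally have d1: "cmod (stieltjes y - s) \<le> 1 / ?\<eta>" .
  have "s + stieltjes y = 2 * stieltjes y - (stieltjes y - s)" by simp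
  hence "cmod (s + stieltjes y) \<le> 2 * cmod (stieltjes y) + cmod (stieltjes y - s)"
    using norm_triangle_ineq4[of "2 * stieltjes y" "stieltjes y - s"] by (simp add: norm_mult add.commute)
  moreover have "3 / ?\<eta> = 2 * (1 / ?\<eta>) + 1 / ?\<eta>" by simp
  ultimately have t: "cmod (s + stieltjes y) \<le> 3 / ?\<eta>" using norm_stieltjes[of y] d1 by linarith
  have e: "of_real gam * s\<^sup>2 - of_real gam * (stieltjes y)\<^sup>2 = - (of_real gam * ((stieltjes y - s) * (s + stieltjes y)))"
    by (simp add: power2_eq_square algebra_simps)
  have "cmod (of_real gam * s\<^sup>2 - of_real gam * (stieltjes y)\<^sup>2) = \<bar>gam\<bar> * (cmod (stieltjes y - s) * cmod (s + stieltjes y))"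
    unfolding e norm_minus_cancel norm_mult norm_of_real ..
  also have "\<dots> \<le> 4 * ((1 / ?\<eta> / n) * (3 / ?\<eta>))"
    by (intro mult_mono gam_bound d t mult_nonneg_nonneg norm_ge_zero) (use Imz in simp_all)
  also have "\<dots> = 12 / (n * ?\<eta>\<^sup>2)" by (simp add: power2_eq_square)
  finally have 2: "cmod (of_real gam * s\<^sup>2 - of_real gam * (stieltjes y)\<^sup>2) \<le> 12 / (n * ?\<eta>\<^sup>2)" .
  show ?thesis unfolding sum
    using norm_triangle_mono[OF 1 2] by (simp add: add_divide_distrib[symmetric])
qed

end

section \<open>The approximate self-consistent equation\<close>

locale random_hypergraph_model = hypergraph_model n r L e z + product_real_prob \<mu>
  for n r L e z and \<mu> :: "nat \<Rightarrow> real measure" +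
  assumes square_integrable: "\<And>l. l \<in> L \<Longrightarrow> integrable (\<mu> l) (\<lambda>t. t\<^sup>2)"
    and second_moment: "\<And>l. l \<in> L \<Longrightarrow> (\<integral>t. t\<^sup>2 \<partial>\<mu> l) = 1"
    and first_moment: "\<And>l. l \<in> L \<Longrightarrow> (\<integral>t. t \<partial>\<mu> l) = 0"
begin

sublocale random_matrix_model n 1 n L "\<lambda>l. centering n * incidence_vec n (e l)" "\<lambda>l. centering n * incidence_diag n (e l)"
  norm_const "real r" z \<mu>
  by unfold_locales (auto simp: square_integrable second_moment first_moment)

text \<open>The quantity that the Lindeberg condition sends to 0 for each fixed \<open>\<epsilon>\<close>, in terms of the laws
\<open>\<mu> l\<close> of the variables.\<close>

definition lindeberg_sum :: "real \<Rightarrow> real" where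
  "lindeberg_sum \<epsilon> = real r ^ 4 / (real n ^ 2 * real (num_edges_pair n r)) *
    (\<Sum>l\<in>L. \<integral>t. t\<^sup>2 * indicator {y. \<bar>y\<bar> > \<epsilon> * K_trunc n r} t \<partial>\<mu> l)"

text \<open>Double counting of the pairs of an edge and an ordered pair of distinct vertices in it.\<close>

lemma edge_count: "real (card L) * (real r * (real r - 1)) = real (num_edges_pair n r) * (real n * (real n - 1))"
proof -
  have cardL: "card L = n choose r"
    using bij_betw_same_card[OF e] by (simp add: card_edge_sets)
  define a b where "a = r - 2" and "b = n - 2"
  have ab: "r = Suc (Suc a)" "n = Suc (Suc b)" using r by (auto simp: a_def b_def)
  have "real (Suc b choose Suc a) = real (Suc (Suc b) choose Suc (Suc a)) * ((real (Suc a) + 1) / (real (Suc b) + 1))"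
    by (rule binomial_ratio)
  moreover have "real (b choose a) = real (Suc b choose Suc a) * ((real a + 1) / (real b + 1))"
    by (rule binomial_ratio)
  ultimately have "real (b choose a) = real (Suc (Suc b) choose Suc (Suc a)) * (((real a + 2) * (real a + 1)) / ((real b + 2) * (real b + 1)))"
    by (simp add: add.commute mult.assoc times_divide_times_eq del: binomial_Suc_Suc)
  moreover define Q where "Q = (real b + 2) * (real b + 1)"
  moreover have "Q \<noteq> 0" by (auto simp: Q_def)
  ultimately have "real (b choose a) * Q = real (Suc (Suc b) choose Suc (Suc a)) * ((real a + 2) * (real a + 1))"
    by (simp add: nonzero_eq_divide_eq del: binomial_Suc_Suc)
  thus ?thesis unfolding cardL num_edges_pair_def ab Q_def by (simp del: binomial_Suc_Suc add: algebra_simps)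
qed

lemma edge_ratio: 
  "real (card L) * (real r)\<^sup>2 \<le> 2 * (real n ^ 2 * real (num_edges_pair n r))"
  "real (num_edges_pair n r) * (real n)\<^sup>2 \<le> 2 * (real (card L) * (real r)\<^sup>2)"
proof -
  have r2: "2 \<le> real r" "2 \<le> real n" using r by auto
  have "(real r)\<^sup>2 \<le> 2 * (real r * (real r - 1))" using r2 by (simp add: power2_eq_square algebra_simps)
  hence "real (card L) * (real r)\<^sup>2 \<le> real (card L) * (2 * (real r * (real r - 1)))" by (intro mult_left_mono) auto
  also have "\<dots> = 2 * (real (num_edges_pair n r) * (real n * (real n - 1)))" using edge_count by simp
  also have "\<dots> \<le> 2 * (real (num_edges_pair n r) * (real n)\<^sup>2)"
    by (intro mult_left_mono) (auto simp: power2_eq_square intro!: mult_left_mono)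
  finally show "real (card L) * (real r)\<^sup>2 \<le> 2 * (real n ^ 2 * real (num_edges_pair n r))" by (simp add: mult_ac)
  have "(real n)\<^sup>2 \<le> 2 * (real n * (real n - 1))" using r2 by (simp add: power2_eq_square algebra_simps)
  hence "real (num_edges_pair n r) * (real n)\<^sup>2 \<le> real (num_edges_pair n r) * (2 * (real n * (real n - 1)))"
    by (intro mult_left_mono) auto
  also have "\<dots> = 2 * (real (card L) * (real r * (real r - 1)))" using edge_count by simp
  also have "\<dots> \<le> 2 * (real (card L) * (real r)\<^sup>2)"
    by (intro mult_left_mono) (auto simp: power2_eq_square intro!: mult_left_mono)
  finally show "real (num_edges_pair n r) * (real n)\<^sup>2 \<le> 2 * (real (card L) * (real r)\<^sup>2)" .
qed

lemma K_pos: "0 < K_trunc n r"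
  using r N_pos by (simp add: K_trunc_def)

text \<open>The part of a unit variance below \<open>a\<close> is at most \<open>a\<^sup>2\<close>.\<close>

lemma tail_lower: 
  assumes l: "l \<in> L" and a: "0 < a"
  shows "1 - a\<^sup>2 \<le> (\<integral>t. t\<^sup>2 * indicator {y. \<bar>y\<bar> > a} t \<partial>\<mu> l)"
proof -
  interpret l: prob_space "\<mu> l" by simp
  have ind: "integrable (\<mu> l) (\<lambda>t. t\<^sup>2 * indicator {y. \<bar>y\<bar> > a} t)"
    by (rule Bochner_Integration.integrable_bound[OF square_integrable[OF l]]) (auto split: split_indicator)
  have "1 = (\<integral>t. t\<^sup>2 \<partial>\<mu> l)" using second_moment[OF l] by simp
  also have "\<dots> \<le> (\<integral>t. a\<^sup>2 + t\<^sup>2 * indicator {y. \<bar>y\<bar> > a} t \<partial>\<mu> l)"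
  proof (intro integral_mono)
    fix t :: real
    show "t\<^sup>2 \<le> a\<^sup>2 + t\<^sup>2 * indicator {y. \<bar>y\<bar> > a} t"
      using power_mono[of "\<bar>t\<bar>" a 2] by (cases "\<bar>t\<bar> > a") auto
  qed (use ind square_integrable[OF l] in auto)
  also have "\<dots> = a\<^sup>2 + (\<integral>t. t\<^sup>2 * indicator {y. \<bar>y\<bar> > a} t \<partial>\<mu> l)" using ind by simp
  finally show ?thesis by simp
qed

text \<open>If the truncation level \<open>\<epsilon> K\<close> were below \<open>1/2\<close>, every variable would have at least \<open>3/4\<close> of its
variance above it. As \<open>r\<^sup>4 M\<close> is at least twice \<open>n\<^sup>2 N\<close>, the normalised sum would then be at least
\<open>3/2\<close>.\<close>

lemma K_large:
  assumes \<epsilon>: "0 < \<epsilon>" and small: "lindeberg_sum \<epsilon> \<le> 1"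
  shows "1 / K_trunc n r \<le> 2 * \<epsilon>"
proof (rule ccontr)
  assume "\<not> 1 / K_trunc n r \<le> 2 * \<epsilon>"
  hence "\<epsilon> * K_trunc n r < 1 / 2" using K_pos by (simp add: field_simps)
  moreover have ek: "0 < \<epsilon> * K_trunc n r" using \<epsilon> K_pos by simp
  ultimately have "(\<epsilon> * K_trunc n r)\<^sup>2 < (1 / 2)\<^sup>2" by (intro power_strict_mono) auto
  hence 1: "3 / 4 < 1 - (\<epsilon> * K_trunc n r)\<^sup>2" by (simp add: power2_eq_square)
  define S where "S = (\<Sum>l\<in>L. \<integral>t. t\<^sup>2 * indicator {y. \<bar>y\<bar> > \<epsilon> * K_trunc n r} t \<partial>\<mu> l)"
  have "real (card L) * (3 / 4) = (\<Sum>l\<in>L. 3 / 4)" by simp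
  also have "\<dots> \<le> S" unfolding S_def using tail_lower[OF _ ek] 1 by (intro sum_mono) (meson less_eq_real_def order_trans)
  finally have S: "real (card L) * (3 / 4) \<le> S" .
  define Q where "Q = real n ^ 2 * real (num_edges_pair n r)"
  have Q: "0 < Q" using r N_pos by (simp add: Q_def)
  have "4 \<le> (real r)\<^sup>2" using power_mono[of 2 "real r" 2] r by simp
  have "4 * Q \<le> 4 * (2 * (real (card L) * (real r)\<^sup>2))" using edge_ratio(2) by (simp add: Q_def mult.commute)
  also have "\<dots> \<le> (real r)\<^sup>2 * (2 * (real (card L) * (real r)\<^sup>2))"
    by (rule mult_right_mono[OF \<open>4 \<le> (real r)\<^sup>2\<close>]) simp
  also have "\<dots> = 2 * (real r ^ 4 * real (card L))" by (simp add: power2_eq_square power4_eq_xxxx)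
  finally have "2 * Q \<le> real r ^ 4 * real (card L)" by linarith
  hence "3 / 2 * Q \<le> (real r ^ 4 * real (card L)) * (3 / 4)" by linarith
  also have "\<dots> = real r ^ 4 * (real (card L) * (3 / 4))" by (rule mult.assoc)
  also have "\<dots> \<le> real r ^ 4 * S" by (intro mult_left_mono S) simp
  finally have "3 / 2 \<le> real r ^ 4 * S / Q" using Q by (simp add: pos_le_divide_eq)
  moreover have "real r ^ 4 * S / Q = lindeberg_sum \<epsilon>" by (simp add: lindeberg_sum_def S_def Q_def)
  ultimately show False using small by simp
qed

text \<open>Three approximations are chained: integration by parts, with errors \<open>80 \<epsilon> / \<eta>\<^sup>3\<close> below and
\<open>8 \<epsilon> / \<eta>\<^sup>2\<close> above the truncation level \<open>\<epsilon> K\<close>; evaluation of the quadratic term; and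
concentration, whose error \<open>64 / (n \<eta>\<^sup>4)\<close> combines \<open>\<bar>gam\<bar> \<le> 4\<close>, the factor 2 for real and imaginary
parts and \<open>M scale\<^sup>2 / n \<le> 8\<close>.\<close>

theorem self_consistent_equation:
  assumes \<epsilon>: "0 < \<epsilon>" "\<epsilon> \<le> 1" and small: "lindeberg_sum \<epsilon> \<le> \<epsilon>"
  shows "cmod (z * PI.expectation stieltjes - 1 - of_real gam * (PI.expectation stieltjes)\<^sup>2)
    \<le> (80 / Im z ^ 3 + 8 / (Im z)\<^sup>2) * \<epsilon> + (33 / (Im z)\<^sup>2 + 64 / Im z ^ 4) / n"
proof -
  let ?g = "PI.expectation stieltjes" and ?N = "real (num_edges_pair n r)" and ?\<eta> = "Im z" and ?K = "K_trunc n r"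
  let ?tail = "\<lambda>l. \<integral>t. t\<^sup>2 * indicator {y. \<bar>y\<bar> > \<epsilon> * ?K} t \<partial>\<mu> l"
  define D where "D = (\<lambda>l y. mat_trace (coefres l y * coefres l y))"
  define m where "m = real (card L)"
  define c where "c = norm_const"
  have n1: "1 \<le> real n" and r1: "1 \<le> real r" and N: "0 < ?N" using r N_pos by simp_all
  have c2: "c\<^sup>2 = 1 / (real n * ?N)" by (simp add: c_def norm_const_def power_divide)
  have c0: "0 < c" using n1 N by (simp add: c_def norm_const_def)
  have scale: "scale = 2 * c * r" by (simp add: scale_def c_def)
  have ek: "0 < \<epsilon> * ?K" using \<epsilon> K_pos by simp
  have cK: "c * r ^ 4 = 1 / ?K" by (simp add: c_def norm_const_def K_trunc_def)
  \<comment> \<open>\<open>scale = 2 c r\<close>, so the coefficients are of size at most \<open>2 / K\<close>.\<close>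
  have cr: "c * r \<le> 1 / ?K"
  proof -
    have "c * r \<le> c * r ^ 4" using c0 r1 self_le_power[of "real r" 4] by (intro mult_left_mono) auto
    thus ?thesis using cK by simp
  qed
  \<comment> \<open>The total squared norm of the coefficients is of the order of the dimension.\<close>
  have mr: "m * (2 * c * r)\<^sup>2 / n \<le> 8"
  proof -
    have "m * (2 * c * r)\<^sup>2 / n = 4 * (m * (real r)\<^sup>2) / (real n ^ 2 * ?N)"
      unfolding power_mult_distrib c2 by (simp add: power2_eq_square mult_ac)
    also have "\<dots> \<le> 8"
    proof -
      have q: "0 < real n ^ 2 * ?N" using n1 N by simp
      show ?thesis using edge_ratio(1) unfolding pos_divide_le_eq[OF q] m_def by linarith
    qed
    finally show ?thesis .
  qed
  have cards: "(\<Sum>l\<in>L. (\<epsilon> * ?K + 2) * (scale / ?\<eta>) ^ 3 + 2 * (scale / ?\<eta>)\<^sup>2 * ?tail l) / n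
      = (m * (2 * c * r)\<^sup>2 / n) * ((\<epsilon> * ?K + 2) * (2 * (c * r))) / ?\<eta> ^ 3
        + 2 * (2 * c * r)\<^sup>2 / ?\<eta>\<^sup>2 * (\<Sum>l\<in>L. ?tail l) / n"
  proof -
    have "(\<Sum>l\<in>L. (\<epsilon> * ?K + 2) * (scale / ?\<eta>) ^ 3 + 2 * (scale / ?\<eta>)\<^sup>2 * ?tail l)
        = m * ((\<epsilon> * ?K + 2) * (scale / ?\<eta>) ^ 3) + 2 * (scale / ?\<eta>)\<^sup>2 * (\<Sum>l\<in>L. ?tail l)"
      unfolding sum.distrib sum_distrib_left[symmetric] m_def by simp
    thus ?thesis
      unfolding scale
      by (simp only: add_divide_distrib power_divide power2_eq_square power3_eq_cube times_divide_eq_left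
          times_divide_eq_right divide_divide_eq_left mult_ac)
  qed
  \<comment> \<open>Second order Taylor terms: a factor \<open>scale\<^sup>2\<close> is absorbed by \<open>mr\<close>, and the remaining one turns
    \<open>\<epsilon> K + 2\<close> into a multiple of \<open>\<epsilon>\<close> because \<open>1 / K \<le> 2 \<epsilon>\<close>.\<close>
  have A1: "(m * (2 * c * r)\<^sup>2 / n) * ((\<epsilon> * ?K + 2) * (2 * (c * r))) / ?\<eta> ^ 3 \<le> 8 * (10 * \<epsilon>) / ?\<eta> ^ 3"
  proof -
    have "(\<epsilon> * ?K + 2) * (2 * (c * r)) \<le> (\<epsilon> * ?K + 2) * (2 * (1 / ?K))"
      using cr ek by (intro mult_left_mono) auto
    also have "\<dots> = 2 * \<epsilon> + 4 * (1 / ?K)" using K_pos by (simp add: field_simps)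
    also have "\<dots> \<le> 10 * \<epsilon>" using K_large[OF \<epsilon>(1)] small \<epsilon>(2) by simp
    finally have "(\<epsilon> * ?K + 2) * (2 * (c * r)) \<le> 10 * \<epsilon>" .
    moreover have "0 \<le> (\<epsilon> * ?K + 2) * (2 * (c * r))" using ek c0 by simp
    ultimately have "(m * (2 * c * r)\<^sup>2 / n) * ((\<epsilon> * ?K + 2) * (2 * (c * r))) \<le> 8 * (10 * \<epsilon>)"
      by (intro mult_mono[OF mr]) auto
    thus ?thesis using Imz by (intro divide_right_mono) auto
  qed
  \<comment> \<open>Tails: up to \<open>r\<^sup>2 \<le> r\<^sup>4\<close> this is the Lindeberg sum.\<close>
  have A2: "2 * (2 * c * r)\<^sup>2 / ?\<eta>\<^sup>2 * (\<Sum>l\<in>L. ?tail l) / n \<le> 8 * \<epsilon> / ?\<eta>\<^sup>2"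
  proof -
    have t0: "0 \<le> (\<Sum>l\<in>L. ?tail l)" by (intro sum_nonneg integral_nonneg_AE) auto
    have "2 * (2 * c * r)\<^sup>2 / ?\<eta>\<^sup>2 * (\<Sum>l\<in>L. ?tail l) / n
        = 8 * ((real r)\<^sup>2 / (real n ^ 2 * ?N) * (\<Sum>l\<in>L. ?tail l)) / ?\<eta>\<^sup>2"
      unfolding power_mult_distrib c2 by (simp add: power2_eq_square mult_ac)
    also have "\<dots> \<le> 8 * (real r ^ 4 / (real n ^ 2 * ?N) * (\<Sum>l\<in>L. ?tail l)) / ?\<eta>\<^sup>2"
      using t0 power_increasing[of 2 4 "real r"] r1
      by (intro divide_right_mono mult_left_mono mult_right_mono) auto
    also have "\<dots> \<le> 8 * \<epsilon> / ?\<eta>\<^sup>2"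
      using small unfolding lindeberg_sum_def by (intro divide_right_mono mult_left_mono) auto
    finally show ?thesis .
  qed
  have E1: "cmod (z * ?g - 1 - (\<Sum>l\<in>L. PI.expectation (D l)) / of_nat n) \<le> 8 * (10 * \<epsilon>) / ?\<eta> ^ 3 + 8 * \<epsilon> / ?\<eta>\<^sup>2"
    using expected_resolvent_equation[OF ek] A1 A2 unfolding cards D_def by linarith
  have iD: "integrable (PiM L \<mu>) (D l)" if "l \<in> L" for l
    unfolding D_def
    by (rule PI.integrable_const_bound[where B = "(scale / ?\<eta>)\<^sup>2"])
      (use norm_trace_coefres[OF that] measurable_trace_coefres(2)[OF that] in auto)
  have is2: "integrable (PiM L \<mu>) (\<lambda>y. (stieltjes y)\<^sup>2)"
  proof (rule PI.integrable_const_bound[where B = "(1 / ?\<eta>)\<^sup>2"])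
    show "AE y in PiM L \<mu>. norm ((stieltjes y)\<^sup>2) \<le> (1 / ?\<eta>)\<^sup>2"
      unfolding norm_power by (intro AE_I2 power_mono norm_stieltjes) auto
  qed (use measurable_stieltjes in measurable)
  have mean: "(\<Sum>l\<in>L. PI.expectation (D l)) / of_nat n - of_real gam * PI.expectation (\<lambda>y. (stieltjes y)\<^sup>2)
      = PI.expectation (\<lambda>y. (\<Sum>l\<in>L. D l y) / of_nat n - of_real gam * (stieltjes y)\<^sup>2)"
    using iD is2 by simp
  have "cmod ((\<Sum>l\<in>L. PI.expectation (D l)) / of_nat n - of_real gam * PI.expectation (\<lambda>y. (stieltjes y)\<^sup>2))
      \<le> PI.expectation (\<lambda>y. cmod ((\<Sum>l\<in>L. D l y) / of_nat n - of_real gam * (stieltjes y)\<^sup>2))"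
    unfolding mean by (rule integral_norm_bound)
  also have "\<dots> \<le> PI.expectation (\<lambda>y. 33 / (real n * ?\<eta>\<^sup>2))"
    using iD is2 quadratic_term by (intro integral_mono) (auto simp: D_def)
  also have "\<dots> = 33 / (real n * ?\<eta>\<^sup>2)" by (simp add: PI.prob_space)
  finally have E2: "cmod ((\<Sum>l\<in>L. PI.expectation (D l)) / of_nat n - of_real gam * PI.expectation (\<lambda>y. (stieltjes y)\<^sup>2))
      \<le> 33 / (real n * ?\<eta>\<^sup>2)" .
  have "cmod (of_real gam * PI.expectation (\<lambda>y. (stieltjes y)\<^sup>2) - of_real gam * ?g\<^sup>2)
      = \<bar>gam\<bar> * cmod (PI.expectation (\<lambda>y. (stieltjes y)\<^sup>2) - ?g\<^sup>2)"
    unfolding right_diff_distrib[symmetric] norm_mult by simp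
  also have "\<dots> \<le> 4 * (2 * (m * (scale / (real n * ?\<eta>\<^sup>2))\<^sup>2))"
    using stieltjes_concentration gam_bound unfolding m_def by (intro mult_mono) auto
  also have "\<dots> = 8 * (m * (2 * c * r)\<^sup>2 / n) / (real n * ?\<eta> ^ 4)"
    unfolding scale by (simp add: power_divide power_mult_distrib power2_eq_square power4_eq_xxxx mult_ac)
  also have "\<dots> \<le> 8 * 8 / (real n * ?\<eta> ^ 4)"
    using mr by (intro divide_right_mono mult_left_mono) auto
  finally have E3: "cmod (of_real gam * PI.expectation (\<lambda>y. (stieltjes y)\<^sup>2) - of_real gam * ?g\<^sup>2) \<le> 8 * 8 / (real n * ?\<eta> ^ 4)" .
  have "cmod (z * ?g - 1 - of_real gam * ?g\<^sup>2)
      \<le> (8 * (10 * \<epsilon>) / ?\<eta> ^ 3 + 8 * \<epsilon> / ?\<eta>\<^sup>2) + 33 / (real n * ?\<eta>\<^sup>2) + 8 * 8 / (real n * ?\<eta> ^ 4)"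
    using norm_triangle_mono[OF norm_triangle_mono[OF E1 E2] E3] by (simp only: diff_add_cancel add_diff_eq add.assoc diff_add_eq)
  also have "\<dots> = (80 / ?\<eta> ^ 3 + 8 / ?\<eta>\<^sup>2) * \<epsilon> + (33 / ?\<eta>\<^sup>2 + 64 / ?\<eta> ^ 4) / n"
    by (simp add: distrib_right distrib_left add_divide_distrib mult.commute)
  finally show ?thesis .
qed

end

section \<open>Cauchy transforms and weak convergence\<close>

definition cauchy_transform :: "real measure \<Rightarrow> complex \<Rightarrow> complex" where
  "cauchy_transform \<mu> z = (\<integral>x. 1 / (z - of_real x) \<partial>\<mu>)"

lemma norm_cauchy_kernel: "Im z \<noteq> 0 \<Longrightarrow> cmod (1 / (z - of_real x)) \<le> 1 / \<bar>Im z\<bar>"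
  using abs_Im_le_cmod[of "z - of_real x"] by (simp add: norm_divide frac_le)

lemma cauchy_kernel_measurable [measurable]: "(\<lambda>x. 1 / (z - complex_of_real x)) \<in> borel_measurable borel"
  by measurable

lemma Im_cauchy_kernel: "- Im (1 / (Complex u \<eta> - of_real x)) = \<eta> / ((u - x)\<^sup>2 + \<eta>\<^sup>2)"
  by (simp add: Im_divide cmod_power2 power2_eq_square)

context real_distribution
begin

lemma integrable_cauchy_kernel: "Im z \<noteq> 0 \<Longrightarrow> integrable M (\<lambda>x. 1 / (z - of_real x))"
  by (rule integrable_const_bound[where B = "1 / \<bar>Im z\<bar>"]) (use norm_cauchy_kernel in auto)

lemma norm_cauchy_transform: 
  assumes "Im z \<noteq> 0" shows "cmod (cauchy_transform M z) \<le> 1 / \<bar>Im z\<bar>"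
proof -
  have "cmod (cauchy_transform M z) \<le> (\<integral>x. cmod (1 / (z - of_real x)) \<partial>M)"
    unfolding cauchy_transform_def by (rule integral_norm_bound)
  also have "\<dots> \<le> (\<integral>x. 1 / \<bar>Im z\<bar> \<partial>M)"
    using integrable_cauchy_kernel[OF assms] norm_cauchy_kernel[OF assms] by (intro integral_mono) auto
  finally show ?thesis by (simp add: prob_space[unfolded space_eq_univ])
qed

lemma Im_cauchy_transform:
  assumes "0 < Im z" shows "Im (cauchy_transform M z) \<le> 0"
proof -
  have z: "Im z \<noteq> 0" using assms by simp
  have "Im (cauchy_transform M z) = (\<integral>x. Im (1 / (z - of_real x)) \<partial>M)"
    unfolding cauchy_transform_def using integrable_cauchy_kernel[OF z] by simp
  also have "\<dots> \<le> (\<integral>x. 0 \<partial>M)"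
    using integrable_cauchy_kernel[OF z] assms
    by (intro integral_mono integrable_Im) (auto simp: Im_divide divide_nonpos_nonneg)
  finally show ?thesis by simp
qed

text \<open>Stieltjes inversion at a positive height \<open>\<eta>\<close>: minus the imaginary part of the Cauchy transform is
the integral of the Poisson kernel, whose primitive is an arctangent, and the order of integration
can be exchanged.\<close>

lemma smoothed_indicator_eq:
  assumes \<eta>: "0 < \<eta>" and ab: "a \<le> b"
  shows "(\<integral>x. arctan ((b - x) / \<eta>) - arctan ((a - x) / \<eta>) \<partial>M)
    = (\<integral>u. indicator {a..b} u * - Im (cauchy_transform M (Complex u \<eta>)) \<partial>lborel)"
proof -
  interpret P: pair_sigma_finite lborel M ..
  let ?f = "\<lambda>u x. indicator {a..b} u * (\<eta> / ((u - x)\<^sup>2 + \<eta>\<^sup>2))"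
  have pos: "0 < (u - x)\<^sup>2 + \<eta>\<^sup>2" for u x :: real using \<eta> by (simp add: add_nonneg_pos)
  have bd: "\<bar>\<eta> / ((u - x)\<^sup>2 + \<eta>\<^sup>2)\<bar> \<le> 1 / \<eta>" for u x
    using \<eta> pos[of u x] by (simp add: divide_simps power2_eq_square)
  have inner: "(\<integral>u. ?f u x \<partial>lborel) = arctan ((b - x) / \<eta>) - arctan ((a - x) / \<eta>)" for x
  proof -
    have "(\<integral>u. indicator {a..b} u *\<^sub>R (\<eta> / ((u - x)\<^sup>2 + \<eta>\<^sup>2)) \<partial>lborel)
        = arctan ((b - x) / \<eta>) - arctan ((a - x) / \<eta>)"
    proof (rule integral_FTC_Icc[OF ab])
      fix u
      have "((\<lambda>u. arctan ((u - x) / \<eta>)) has_real_derivative inverse (1 + ((u - x) / \<eta>)\<^sup>2) * (1 / \<eta>)) (at u within {a..b})"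
        using \<eta> by (auto intro!: derivative_eq_intros)
      moreover have "inverse (1 + ((u - x) / \<eta>)\<^sup>2) * (1 / \<eta>) = \<eta> / ((u - x)\<^sup>2 + \<eta>\<^sup>2)"
        using \<eta> pos[of u x] by (simp add: field_simps power2_eq_square)
      ultimately show "((\<lambda>u. arctan ((u - x) / \<eta>)) has_vector_derivative \<eta> / ((u - x)\<^sup>2 + \<eta>\<^sup>2)) (at u within {a..b})"
        by (simp add: has_real_derivative_iff_has_vector_derivative)
    next
      show "continuous_on {a..b} (\<lambda>u. \<eta> / ((u - x)\<^sup>2 + \<eta>\<^sup>2))"
        using pos by (intro continuous_intros) (metis less_irrefl)
    qed
    thus ?thesis by simp
  qed
  have ix: "integrable M (\<lambda>x. \<eta> / ((u - x)\<^sup>2 + \<eta>\<^sup>2))" for u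
    by (rule integrable_const_bound[where B = "1 / \<eta>"]) (use bd in auto)
  have iu: "integrable lborel (\<lambda>u. indicator {a..b} u * (1 / \<eta>))"
    by (intro integrable_mult_left integrable_real_indicator) (auto simp: emeasure_lborel_Icc_eq)
  have "integrable (lborel \<Otimes>\<^sub>M M) (\<lambda>(u, x). ?f u x)"
  proof (rule P.Fubini_integrable)
    show "(\<lambda>(u, x). ?f u x) \<in> borel_measurable (lborel \<Otimes>\<^sub>M M)" by measurable
    show "integrable lborel (\<lambda>u. \<integral>x. norm (case (u, x) of (u, x) \<Rightarrow> ?f u x) \<partial>M)"
    proof (rule Bochner_Integration.integrable_bound[OF iu])
      show "(\<lambda>u. \<integral>x. norm (case (u, x) of (u, x) \<Rightarrow> ?f u x) \<partial>M) \<in> borel_measurable lborel" by measurable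
      have "(\<integral>x. norm (?f u x) \<partial>M) \<le> indicator {a..b} u * (1 / \<eta>)" for u
      proof -
        have "(\<integral>x. norm (?f u x) \<partial>M) \<le> (\<integral>x. indicator {a..b} u * (1 / \<eta>) \<partial>M)"
          using bd[of u] ix[of u] \<eta> by (intro integral_mono) (auto simp: abs_mult abs_of_pos split: split_indicator)
        thus ?thesis by (simp add: prob_space[unfolded space_eq_univ])
      qed
      thus "AE u in lborel. norm (\<integral>x. norm (case (u, x) of (u, x) \<Rightarrow> ?f u x) \<partial>M) \<le> norm (indicator {a..b} u * (1 / \<eta>))"
        by (intro AE_I2) (use \<eta> in \<open>auto intro: order.trans[OF _ abs_ge_self]\<close>)
    qed
    show "AE u in lborel. integrable M (\<lambda>x. case (u, x) of (u, x) \<Rightarrow> ?f u x)"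
      unfolding prod.case by (intro AE_I2 integrable_mult_right ix)
  qed
  hence "(\<integral>x. (\<integral>u. ?f u x \<partial>lborel) \<partial>M) = (\<integral>u. (\<integral>x. ?f u x \<partial>M) \<partial>lborel)"
    by (rule P.Fubini_integral)
  moreover have "(\<integral>x. ?f u x \<partial>M) = indicator {a..b} u * - Im (cauchy_transform M (Complex u \<eta>))" for u
  proof -
    have "- Im (cauchy_transform M (Complex u \<eta>)) = (\<integral>x. - Im (1 / (Complex u \<eta> - of_real x)) \<partial>M)"
      unfolding cauchy_transform_def using integrable_cauchy_kernel[of "Complex u \<eta>"] \<eta> by simp
    thus ?thesis unfolding Im_cauchy_kernel by (simp only: integral_mult_right_zero)
  qed
  ultimately show ?thesis unfolding inner by simp
qed

end

text \<open>The smoothed indicator of \<open>(a, b)\<close> on the scale \<open>\<eta> = 1 / m\<^sup>2\<close>, moved inside the interval by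
\<open>1 / m\<close>. The shift is large against \<open>\<eta>\<close>, so that outside \<open>(a, b)\<close> the arctangents are taken at
distance at least \<open>m\<close> from 0. Thus the window exceeds the indicator by a uniformly small amount,
and it converges to the indicator of the open interval at the end points too.\<close>

definition smooth_window :: "real \<Rightarrow> real \<Rightarrow> nat \<Rightarrow> real \<Rightarrow> real" where
  "smooth_window a b m x = (arctan ((b - 1 / real m - x) * real m ^ 2) - arctan ((a + 1 / real m - x) * real m ^ 2)) / pi"

lemma smooth_window_bounded: "\<bar>smooth_window a b m x\<bar> \<le> 1"
proof -
  have "\<bar>arctan s - arctan t\<bar> \<le> pi" for s t
    using arctan_bounded[of s] arctan_bounded[of t] by (auto simp: abs_le_iff)
  thus ?thesis unfolding smooth_window_def by (simp add: abs_div_pos[symmetric])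
qed

lemma smooth_window_le:
  assumes m: "0 < m"
  shows "smooth_window a b m x \<le> indicator {a<..<b} x + (1 / 2 - arctan m / pi)"
proof -
  have k: "arctan m / pi \<le> 1 / 2" using arctan_ubound[of m] by (simp add: divide_simps)
  have mm: "1 / real m * real m ^ 2 = real m" using m by (simp add: power2_eq_square)
  consider "x \<in> {a<..<b}" | "x \<le> a" | "b \<le> x" by force
  thus ?thesis
  proof cases
    case 1
    hence i: "indicator {a<..<b} x = (1 :: real)" by simp
    show ?thesis unfolding i using smooth_window_bounded[of a b m x] k by linarith
  next
    case 2
    have "real m \<le> (a + 1 / real m - x) * real m ^ 2"
      using 2 mm mult_right_mono[of "1 / real m" "a + 1 / real m - x" "real m ^ 2"] by simp
    hence "arctan (real m) \<le> arctan ((a + 1 / real m - x) * real m ^ 2)" by (simp add: arctan_monotone')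
    hence "arctan ((b - 1 / real m - x) * real m ^ 2) - arctan ((a + 1 / real m - x) * real m ^ 2) \<le> pi / 2 - arctan m"
      using arctan_ubound[of "(b - 1 / real m - x) * real m ^ 2"] by linarith
    hence "smooth_window a b m x \<le> (pi / 2 - arctan m) / pi" unfolding smooth_window_def by (intro divide_right_mono) auto
    thus ?thesis using 2 by (simp add: diff_divide_distrib)
  next
    case 3
    have "(b - 1 / real m - x) * real m ^ 2 \<le> - real m"
      using 3 mm mult_right_mono[of "b - 1 / real m - x" "- (1 / real m)" "real m ^ 2"] by simp
    hence "arctan ((b - 1 / real m - x) * real m ^ 2) \<le> arctan (- real m)" by (simp add: arctan_monotone')
    hence "arctan ((b - 1 / real m - x) * real m ^ 2) - arctan ((a + 1 / real m - x) * real m ^ 2) \<le> pi / 2 - arctan m"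
      using arctan_lbound[of "(a + 1 / real m - x) * real m ^ 2"] by (simp add: arctan_minus)
    hence "smooth_window a b m x \<le> (pi / 2 - arctan m) / pi" unfolding smooth_window_def by (intro divide_right_mono) auto
    thus ?thesis using 3 by (simp add: diff_divide_distrib)
  qed
qed

lemma filterlim_window_edge:
  assumes "0 \<le> (d::real)" 
  shows "filterlim (\<lambda>m::nat. (d + 1 / real m) * real m ^ 2) at_top sequentially"
proof (rule filterlim_at_top_mono[OF filterlim_real_sequentially])
  show "\<forall>\<^sub>F m in sequentially. real m \<le> (d + 1 / real m) * real m ^ 2"
    using eventually_gt_at_top[of 0]
  proof eventually_elim
    case (elim m)
    have "real m = 1 / real m * real m ^ 2" using elim by (simp add: power2_eq_square)
    also have "\<dots> \<le> (d + 1 / real m) * real m ^ 2" using assms by (intro mult_right_mono) auto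
    finally show ?case .
  qed
qed

lemma filterlim_window_inside:
  assumes "0 < (d::real)" 
  shows "filterlim (\<lambda>m::nat. (d - 1 / real m) * real m ^ 2) at_top sequentially"
  using assms by real_asymp

lemma smooth_window_tendsto:
  assumes ab: "a < b"
  shows "(\<lambda>m. smooth_window a b m x) \<longlonglongrightarrow> indicator {a<..<b} x"
proof -
  have top: "(\<lambda>m. arctan (f m)) \<longlonglongrightarrow> pi / 2" if "filterlim f at_top sequentially" for f :: "nat \<Rightarrow> real"
    by (rule filterlim_compose[OF tendsto_arctan_at_top that])
  have bot: "(\<lambda>m. arctan (f m)) \<longlonglongrightarrow> - (pi / 2)" if "filterlim (\<lambda>m. - f m) at_top sequentially" for f :: "nat \<Rightarrow> real"
    using tendsto_minus[OF top[OF that]] by (simp add: arctan_minus)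
  consider "x \<in> {a<..<b}" | "x \<le> a" | "b \<le> x" by force
  thus ?thesis
  proof cases
    case 1
    have "(\<lambda>m. smooth_window a b m x) \<longlonglongrightarrow> (pi / 2 - - (pi / 2)) / pi"
      unfolding smooth_window_def using filterlim_window_inside[of "b - x"] filterlim_window_inside[of "x - a"] 1
      by (intro tendsto_intros top bot) (simp_all add: algebra_simps)
    thus ?thesis using 1 by simp
  next
    case 2
    have "(\<lambda>m. smooth_window a b m x) \<longlonglongrightarrow> (pi / 2 - pi / 2) / pi"
      unfolding smooth_window_def using filterlim_window_inside[of "b - x"] filterlim_window_edge[of "a - x"] 2 ab
      by (intro tendsto_intros top) (simp_all add: algebra_simps)
    thus ?thesis using 2 by simp
  next
    case 3
    have "(\<lambda>m. smooth_window a b m x) \<longlonglongrightarrow> (- (pi / 2) - - (pi / 2)) / pi"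
      unfolding smooth_window_def using filterlim_window_inside[of "x - a"] filterlim_window_edge[of "x - b"] 3 ab
      by (intro tendsto_intros bot) (simp_all add: algebra_simps)
    thus ?thesis using 3 by simp
  qed
qed

lemma smooth_window_measurable [measurable]: "smooth_window a b m \<in> borel_measurable borel"
  unfolding smooth_window_def by measurable

context real_distribution
begin

lemma integrable_smooth_window: "integrable M (smooth_window a b m)"
  by (rule integrable_const_bound[where B = 1]) (use smooth_window_bounded in auto)

lemma smooth_window_integral_tendsto:
  assumes "a < b"
  shows "(\<lambda>m. \<integral>x. smooth_window a b m x \<partial>M) \<longlonglongrightarrow> prob {a<..<b}"
proof -
  have "(\<lambda>m. \<integral>x. smooth_window a b m x \<partial>M) \<longlonglongrightarrow> (\<integral>x. indicator {a<..<b} x \<partial>M)"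
    by (rule integral_dominated_convergence[where w = "\<lambda>_. 1"])
      (use smooth_window_bounded smooth_window_tendsto[OF assms] in auto)
  thus ?thesis by simp
qed

lemma smooth_window_integral_eq:
  assumes ab: "a + 1 / real m \<le> b - 1 / real m" and m: "0 < m"
  shows "(\<integral>x. smooth_window a b m x \<partial>M)
    = (\<integral>u. indicator {a + 1 / real m..b - 1 / real m} u * - Im (cauchy_transform M (Complex u (1 / real m ^ 2))) \<partial>lborel) / pi"
  using smoothed_indicator_eq[OF _ ab, of "1 / real m ^ 2"] m
  by (simp add: smooth_window_def[abs_def])

end

lemma cauchy_transform_imp_window_limit:
  assumes \<mu>: "\<And>n. real_distribution (\<mu> n)" and \<nu>: "real_distribution \<nu>"
    and lim: "\<And>z. 0 < Im z \<Longrightarrow> (\<lambda>n. cauchy_transform (\<mu> n) z) \<longlonglongrightarrow> cauchy_transform \<nu> z"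
    and ab: "a + 1 / real m \<le> b - 1 / real m" and m: "0 < m"
  shows "(\<lambda>n. \<integral>x. smooth_window a b m x \<partial>\<mu> n) \<longlonglongrightarrow> (\<integral>x. smooth_window a b m x \<partial>\<nu>)"
proof -
  let ?\<eta> = "1 / real m ^ 2"
  have \<eta>: "0 < ?\<eta>" using m by simp
  have eq: "(\<integral>x. smooth_window a b m x \<partial>\<kappa>)
    = (\<integral>u. indicator {a + 1 / real m..b - 1 / real m} u * - Im (cauchy_transform \<kappa> (Complex u ?\<eta>)) \<partial>lborel) / pi"
    if "real_distribution \<kappa>" for \<kappa>
    by (rule real_distribution.smooth_window_integral_eq[OF that ab m])
  have meas: "(\<lambda>u. cauchy_transform \<kappa> (Complex u ?\<eta>)) \<in> borel_measurable lborel" if "real_distribution \<kappa>" for \<kappa>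
  proof -
    interpret \<kappa>: real_distribution \<kappa> by (rule that)
    have "(\<lambda>(u, x). 1 / (of_real u + \<i> * of_real ?\<eta> - complex_of_real x)) \<in> borel_measurable (lborel \<Otimes>\<^sub>M \<kappa>)"
      by measurable
    from \<kappa>.borel_measurable_lebesgue_integral[OF this]
    show ?thesis by (simp add: cauchy_transform_def Complex_eq)
  qed
  have nb: "\<bar>Im (cauchy_transform \<kappa> (Complex u ?\<eta>))\<bar> \<le> 1 / ?\<eta>" if "real_distribution \<kappa>" for \<kappa> u
    using real_distribution.norm_cauchy_transform[OF that, of "Complex u ?\<eta>"] abs_Im_le_cmod[of "cauchy_transform \<kappa> (Complex u ?\<eta>)"] \<eta>
    by simp
  have "(\<lambda>n. \<integral>u. indicator {a + 1 / real m..b - 1 / real m} u * - Im (cauchy_transform (\<mu> n) (Complex u ?\<eta>)) \<partial>lborel)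
    \<longlonglongrightarrow> (\<integral>u. indicator {a + 1 / real m..b - 1 / real m} u * - Im (cauchy_transform \<nu> (Complex u ?\<eta>)) \<partial>lborel)"
  proof (rule integral_dominated_convergence[where w = "\<lambda>u. indicator {a + 1 / real m..b - 1 / real m} u * (1 / ?\<eta>)"])
    show "integrable lborel (\<lambda>u. indicator {a + 1 / real m..b - 1 / real m} u * (1 / ?\<eta>))"
      by (intro integrable_mult_left integrable_real_indicator) (auto simp: emeasure_lborel_Icc_eq)
    show "AE u in lborel. (\<lambda>n. indicator {a + 1 / real m..b - 1 / real m} u * - Im (cauchy_transform (\<mu> n) (Complex u ?\<eta>)))
      \<longlonglongrightarrow> indicator {a + 1 / real m..b - 1 / real m} u * - Im (cauchy_transform \<nu> (Complex u ?\<eta>))"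
      using \<eta> by (intro AE_I2 tendsto_intros lim) simp
    show "AE u in lborel. norm (indicator {a + 1 / real m..b - 1 / real m} u * - Im (cauchy_transform (\<mu> n) (Complex u ?\<eta>)))
        \<le> indicator {a + 1 / real m..b - 1 / real m} u * (1 / ?\<eta>)" for n
      using nb[OF \<mu>] by (intro AE_I2) (auto simp: abs_mult split: split_indicator)
  qed (use meas[OF \<mu>] meas[OF \<nu>] in measurable)
  thus ?thesis unfolding eq[OF \<mu>] eq[OF \<nu>] by (intro tendsto_divide) auto
qed

text \<open>A lower bound on open intervals, as in the portmanteau theorem. The window is fixed first, close to
the indicator for \<open>\<nu>\<close>; for the measures \<open>\<mu> n\<close> it suffices that the window is at most slightly larger
than the indicator.\<close>

lemma window_limit_open_interval:
  assumes \<mu>: "\<And>n. real_distribution (\<mu> n)" and \<nu>: "real_distribution \<nu>"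
    and lim: "\<And>z. 0 < Im z \<Longrightarrow> (\<lambda>n. cauchy_transform (\<mu> n) z) \<longlonglongrightarrow> cauchy_transform \<nu> z"
    and ab: "a < b" and \<epsilon>: "0 < \<epsilon>"
  shows "\<forall>\<^sub>F n in sequentially. measure \<nu> {a<..<b} - \<epsilon> < measure (\<mu> n) {a<..<b}"
proof -
  interpret \<nu>: real_distribution \<nu> by (rule \<nu>)
  have "(\<lambda>m. (\<integral>x. smooth_window a b m x \<partial>\<nu>) - (1 / 2 - arctan (real m) / pi)) \<longlonglongrightarrow> measure \<nu> {a<..<b} - (1 / 2 - (pi / 2) / pi)"
    by (intro tendsto_intros \<nu>.smooth_window_integral_tendsto[OF ab] filterlim_compose[OF tendsto_arctan_at_top filterlim_real_sequentially]) simp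
  hence "\<forall>\<^sub>F m in sequentially. measure \<nu> {a<..<b} - \<epsilon> / 2 < (\<integral>x. smooth_window a b m x \<partial>\<nu>) - (1 / 2 - arctan (real m) / pi)"
    by (rule order_tendstoD(1)) (use \<epsilon> in simp)
  moreover have "\<forall>\<^sub>F m in sequentially. a + 1 / real m \<le> b - 1 / real m" using ab by real_asymp
  ultimately have "\<forall>\<^sub>F m in sequentially. measure \<nu> {a<..<b} - \<epsilon> / 2 < (\<integral>x. smooth_window a b m x \<partial>\<nu>) - (1 / 2 - arctan (real m) / pi)
      \<and> a + 1 / real m \<le> b - 1 / real m \<and> 0 < m"
    using eventually_gt_at_top[of 0] by eventually_elim auto
  then obtain m where m: "measure \<nu> {a<..<b} - \<epsilon> / 2 < (\<integral>x. smooth_window a b m x \<partial>\<nu>) - (1 / 2 - arctan (real m) / pi)"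
    "a + 1 / real m \<le> b - 1 / real m" "0 < m"
    using eventually_happens'[OF sequentially_bot] by blast
  have "\<forall>\<^sub>F n in sequentially. (\<integral>x. smooth_window a b m x \<partial>\<nu>) - \<epsilon> / 2 < (\<integral>x. smooth_window a b m x \<partial>\<mu> n)"
    by (rule order_tendstoD(1)[OF cauchy_transform_imp_window_limit[OF \<mu> \<nu> lim m(2,3)]]) (use \<epsilon> in auto)
  thus ?thesis
  proof eventually_elim
    case (elim n)
    interpret \<mu>: real_distribution "\<mu> n" by (rule \<mu>)
    have "(\<integral>x. smooth_window a b m x \<partial>\<mu> n) \<le> (\<integral>x. indicator {a<..<b} x + (1 / 2 - arctan m / pi) \<partial>\<mu> n)"
      by (intro integral_mono \<mu>.integrable_smooth_window smooth_window_le m(3) Bochner_Integration.integrable_add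
          integrable_real_indicator) (auto simp: \<mu>.emeasure_eq_measure)
    also have "\<dots> = measure (\<mu> n) {a<..<b} + (1 / 2 - arctan m / pi)"
      by (subst Bochner_Integration.integral_add)
        (auto simp: \<mu>.emeasure_eq_measure \<mu>.prob_space[unfolded \<mu>.space_eq_univ])
    finally show ?case using elim m(1) by simp
  qed
qed

text \<open>Lower bounds on bounded intervals exhausting \<open>(-\<infinity>, x)\<close> and \<open>(x, \<infinity>)\<close> bound the distribution functions
from below and from above, as no mass of the limit \<open>\<nu>\<close> is lost at infinity.\<close>

theorem weak_conv_of_cauchy_transform:
  assumes \<mu>: "\<And>n. real_distribution (\<mu> n)" and \<nu>: "real_distribution \<nu>"
    and lim: "\<And>z. 0 < Im z \<Longrightarrow> (\<lambda>n. cauchy_transform (\<mu> n) z) \<longlonglongrightarrow> cauchy_transform \<nu> z"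
  shows "weak_conv_m \<mu> \<nu>"
  unfolding weak_conv_m_def weak_conv_def
proof (intro allI impI)
  fix x
  assume "isCont (cdf \<nu>) x"
  interpret \<nu>: real_distribution \<nu> by (rule \<nu>)
  have atom: "measure \<nu> {x} = 0" using \<open>isCont (cdf \<nu>) x\<close> \<nu>.isCont_cdf by simp
  have "(\<lambda>k::nat. measure \<nu> {x - real (Suc k)<..<x}) \<longlonglongrightarrow> measure \<nu> (\<Union>k. {x - real (Suc k)<..<x})"
    by (rule \<nu>.finite_Lim_measure_incseq) (auto simp: incseq_def)
  also have "(\<Union>k. {x - real (Suc k)<..<x}) = {..<x}"
  proof (intro equalityI subsetI)
    fix y assume "y \<in> {..<x}"
    moreover obtain k where "x - y < real k" using reals_Archimedean2 by blast
    ultimately show "y \<in> (\<Union>k. {x - real (Suc k)<..<x})" by (auto intro!: exI[of _ k])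
  qed auto
  finally have left: "(\<lambda>k::nat. measure \<nu> {x - real (Suc k)<..<x}) \<longlonglongrightarrow> measure \<nu> {..<x}" .
  have "(\<lambda>k::nat. measure \<nu> {x<..<x + real (Suc k)}) \<longlonglongrightarrow> measure \<nu> (\<Union>k. {x<..<x + real (Suc k)})"
    by (rule \<nu>.finite_Lim_measure_incseq) (auto simp: incseq_def)
  also have "(\<Union>k. {x<..<x + real (Suc k)}) = {x<..}"
  proof (intro equalityI subsetI)
    fix y assume "y \<in> {x<..}"
    moreover obtain k where "y - x < real k" using reals_Archimedean2 by blast
    ultimately show "y \<in> (\<Union>k. {x<..<x + real (Suc k)})" by (auto intro!: exI[of _ k])
  qed auto
  finally have right: "(\<lambda>k::nat. measure \<nu> {x<..<x + real (Suc k)}) \<longlonglongrightarrow> measure \<nu> {x<..}" .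
  have cdf_left: "measure \<nu> {..<x} = cdf \<nu> x"
  proof -
    have "{..x} = {..<x} \<union> {x}" by auto
    thus ?thesis unfolding cdf_def using \<nu>.finite_measure_Union[of "{..<x}" "{x}"] atom by simp
  qed
  have compl: "measure \<kappa> {x<..} = 1 - cdf \<kappa> x" if "real_distribution \<kappa>" for \<kappa>
  proof -
    interpret \<kappa>: real_distribution \<kappa> by (rule that)
    have "{x<..} = space \<kappa> - {..x}" by auto
    thus ?thesis unfolding cdf_def using \<kappa>.prob_compl[of "{..x}"] by simp
  qed
  show "(\<lambda>n. cdf (\<mu> n) x) \<longlonglongrightarrow> cdf \<nu> x"
  proof (rule order_tendstoI)
    fix y assume "y < cdf \<nu> x"
    then obtain k where k: "y < measure \<nu> {x - real (Suc k)<..<x}"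
      using order_tendstoD(1)[OF left] cdf_left eventually_happens'[OF sequentially_bot] by metis
    have "\<forall>\<^sub>F n in sequentially. measure \<nu> {x - real (Suc k)<..<x} - (measure \<nu> {x - real (Suc k)<..<x} - y)
        < measure (\<mu> n) {x - real (Suc k)<..<x}"
      by (rule window_limit_open_interval[OF \<mu> \<nu> lim]) (use k in auto)
    thus "\<forall>\<^sub>F n in sequentially. y < cdf (\<mu> n) x"
    proof eventually_elim
      case (elim n)
      interpret \<mu>: real_distribution "\<mu> n" by (rule \<mu>)
      have "measure (\<mu> n) {x - real (Suc k)<..<x} \<le> cdf (\<mu> n) x"
        unfolding cdf_def by (intro \<mu>.finite_measure_mono) auto
      thus ?case using elim by simp
    qed
  next
    fix y assume "cdf \<nu> x < y"
    hence "1 - y < measure \<nu> {x<..}" using compl[OF \<nu>] by simp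
    then obtain k where k: "1 - y < measure \<nu> {x<..<x + real (Suc k)}"
      using order_tendstoD(1)[OF right] eventually_happens'[OF sequentially_bot] by metis
    have "\<forall>\<^sub>F n in sequentially. measure \<nu> {x<..<x + real (Suc k)} - (measure \<nu> {x<..<x + real (Suc k)} - (1 - y))
        < measure (\<mu> n) {x<..<x + real (Suc k)}"
      by (rule window_limit_open_interval[OF \<mu> \<nu> lim]) (use k in auto)
    thus "\<forall>\<^sub>F n in sequentially. cdf (\<mu> n) x < y"
    proof eventually_elim
      case (elim n)
      interpret \<mu>: real_distribution "\<mu> n" by (rule \<mu>)
      have "measure (\<mu> n) {x<..<x + real (Suc k)} \<le> measure (\<mu> n) {x<..}"
        by (intro \<mu>.finite_measure_mono) auto
      thus ?case using elim compl[OF \<mu>, of n] by simp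
    qed
  qed
qed

section \<open>The semicircle law\<close>

text \<open>The derivative is needed in the open interval only: \<open>\<surd>(4 v - x\<^sup>2)\<close> has none at the end points.\<close>

lemma lebesgue_FTC_interior:
  fixes F f :: "real \<Rightarrow> complex"
  assumes ab: "a \<le> b" and F: "continuous_on {a..b} F" and f: "continuous_on {a..b} f"
    and deriv: "\<And>x. a < x \<Longrightarrow> x < b \<Longrightarrow> (F has_vector_derivative f x) (at x)"
  shows "integrable lborel (\<lambda>x. indicator {a..b} x *\<^sub>R f x)"
    and "(\<integral>x. indicator {a..b} x *\<^sub>R f x \<partial>lborel) = F b - F a"
proof -
  show int: "integrable lborel (\<lambda>x. indicator {a..b} x *\<^sub>R f x)"
    using borel_integrable_compact[OF compact_Icc f] by (simp add: indicator_scaleR_eq_if)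
  have "(f has_integral F b - F a) {a..b}"
    by (rule fundamental_theorem_of_calculus_interior[OF ab F deriv]) auto
  moreover have "(f has_integral (\<integral>x. indicator {a..b} x *\<^sub>R f x \<partial>lborel)) {a..b}"
    using has_integral_integral_lborel[OF int] has_integral_restrict_UNIV[of "{a..b}" f]
    by (simp add: indicator_scaleR_eq_if)
  ultimately show "(\<integral>x. indicator {a..b} x *\<^sub>R f x \<partial>lborel) = F b - F a"
    by (rule has_integral_unique[symmetric])
qed

locale semicircle_law =
  fixes v :: real
  assumes v: "0 < v"
begin

definition R :: real where "R = 2 * sqrt v"

lemma R: "0 < R" "R\<^sup>2 = 4 * v" using v by (simp_all add: R_def power_mult_distrib)

definition dens :: "real \<Rightarrow> real" where
  "dens x = indicator {- R..R} x * (1 / (2 * pi * v) * sqrt (4 * v - x\<^sup>2))"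

lemma semicircle_dens: "semicircle v = density lborel (\<lambda>x. ennreal (dens x))"
  by (simp add: semicircle_def dens_def R_def)

lemma sqrt_nonneg_support: "x \<in> {- R..R} \<Longrightarrow> 0 \<le> 4 * v - x\<^sup>2"
  using power_mono[of "\<bar>x\<bar>" R 2] R by auto

lemma sqrt_pos_interior: "- R < x \<Longrightarrow> x < R \<Longrightarrow> 0 < 4 * v - x\<^sup>2"
  using power_strict_mono[of "\<bar>x\<bar>" R 2] R by auto

lemma dens_nonneg: "0 \<le> dens x"
  using sqrt_nonneg_support[of x] v by (auto simp: dens_def split: split_indicator)

lemma dens_measurable [measurable]: "dens \<in> borel_measurable borel"
  unfolding dens_def by measurable

lemma integral_semicircle:
  fixes h :: "real \<Rightarrow> complex"
  assumes [measurable]: "h \<in> borel_measurable borel"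
  shows "(\<integral>x. h x \<partial>semicircle v) = (1 / (2 * pi * v)) *\<^sub>R (\<integral>x. indicator {- R..R} x *\<^sub>R (sqrt (4 * v - x\<^sup>2) *\<^sub>R h x) \<partial>lborel)"
proof -
  have "(\<integral>x. h x \<partial>semicircle v) = (\<integral>x. dens x *\<^sub>R h x \<partial>lborel)"
    unfolding semicircle_dens by (rule integral_density) (use dens_nonneg in auto)
  also have "\<dots> = (\<integral>x. (1 / (2 * pi * v)) *\<^sub>R (indicator {- R..R} x *\<^sub>R (sqrt (4 * v - x\<^sup>2) *\<^sub>R h x)) \<partial>lborel)"
    by (intro Bochner_Integration.integral_cong refl) (simp add: dens_def)
  finally show ?thesis unfolding integral_scaleR_right .
qed

lemma semicircle_mass: "(\<integral>x. indicator {- R..R} x *\<^sub>R complex_of_real (sqrt (4 * v - x\<^sup>2)) \<partial>lborel) = complex_of_real (2 * pi * v)"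
proof -
  define F where "F = (\<lambda>x. x * sqrt (4 * v - x\<^sup>2) / 2 + 2 * v * arcsin (x / R))"
  have "(\<integral>x. indicator {- R..R} x *\<^sub>R complex_of_real (sqrt (4 * v - x\<^sup>2)) \<partial>lborel)
      = complex_of_real (F R) - complex_of_real (F (- R))"
  proof (rule lebesgue_FTC_interior(2))
    show "- R \<le> R" using R by simp
    show "continuous_on {- R..R} (\<lambda>x. complex_of_real (F x))"
      unfolding F_def using R
      by (intro continuous_intros) (auto simp: field_simps)
    show "continuous_on {- R..R} (\<lambda>x. complex_of_real (sqrt (4 * v - x\<^sup>2)))"
      by (intro continuous_intros)
    fix x assume x: "- R < x" "x < R"
    define s where "s = sqrt (4 * v - x\<^sup>2)"
    have s: "0 < s" "s\<^sup>2 = 4 * v - x\<^sup>2" using sqrt_pos_interior[OF x] by (simp_all add: s_def)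
    have d1: "((\<lambda>x. sqrt (4 * v - x\<^sup>2)) has_real_derivative - x / s) (at x)"
      using sqrt_pos_interior[OF x] by (auto intro!: derivative_eq_intros simp: s_def field_simps)
    have d2: "((\<lambda>x. arcsin (x / R)) has_real_derivative 1 / s) (at x)"
    proof -
      have 1: "sqrt (1 - (x / R)\<^sup>2) = s / R"
      proof -
        have "1 - (x / R)\<^sup>2 = (4 * v - x\<^sup>2) / R\<^sup>2"
          unfolding R(2)[symmetric] using R(1) by (simp add: power_divide diff_divide_distrib)
        thus ?thesis using R(1) by (simp add: real_sqrt_divide s_def)
      qed
      have "((\<lambda>x. arcsin (x / R)) has_real_derivative inverse (sqrt (1 - (x / R)\<^sup>2)) * (1 / R)) (at x)"
        using x R by (auto intro!: derivative_eq_intros simp: field_simps)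
      thus ?thesis unfolding 1 using R by simp
    qed
    have "(F has_real_derivative (x * (- x / s) + 1 * s) / 2 + 2 * v * (1 / s)) (at x)"
      unfolding F_def s_def
      by (rule DERIV_add[OF DERIV_cdivide[OF DERIV_mult'[OF DERIV_ident d1[unfolded s_def]]] DERIV_cmult[OF d2[unfolded s_def]]])
    moreover have "(x * (- x / s) + 1 * s) / 2 + 2 * v * (1 / s) = s"
      using s by (simp add: field_simps power2_eq_square)
    ultimately have "(F has_real_derivative s) (at x)" by simp
    thus "((\<lambda>x. complex_of_real (F x)) has_vector_derivative complex_of_real (sqrt (4 * v - x\<^sup>2))) (at x)"
      unfolding s_def by (rule has_vector_derivative_of_real)
  qed
  also have "F R = 2 * v * (pi / 2)" using R by (simp add: F_def)
  also have "F (- R) = - (2 * v * (pi / 2))" using R by (simp add: F_def)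
  finally show ?thesis by simp
qed

lemma real_distribution_semicircle: "real_distribution (semicircle v)"
proof -
  have int: "integrable lborel (\<lambda>x. indicator {- R..R} x *\<^sub>R complex_of_real (sqrt (4 * v - x\<^sup>2)))"
    using borel_integrable_compact[of "{- R..R}" "\<lambda>x. complex_of_real (sqrt (4 * v - x\<^sup>2))"]
    by (simp add: indicator_scaleR_eq_if continuous_intros)
  have dens: "complex_of_real (dens x) = (1 / (2 * pi * v)) *\<^sub>R (indicator {- R..R} x *\<^sub>R complex_of_real (sqrt (4 * v - x\<^sup>2)))" for x
    by (simp add: dens_def scaleR_conv_of_real)
  have "integrable lborel (\<lambda>x. complex_of_real (dens x))" unfolding dens by (intro integrable_scaleR_right int)
  hence "integrable lborel (\<lambda>x. Re (complex_of_real (dens x)))" by (rule integrable_Re)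
  hence id: "integrable lborel dens" by simp
  have "complex_of_real (\<integral>x. dens x \<partial>lborel) = (\<integral>x. complex_of_real (dens x) \<partial>lborel)" by simp
  also have "\<dots> = (1 / (2 * pi * v)) *\<^sub>R complex_of_real (2 * pi * v)"
    unfolding dens integral_scaleR_right semicircle_mass ..
  also have "\<dots> = complex_of_real (1 / (2 * pi * v) * (2 * pi * v))" by (simp only: scaleR_conv_of_real of_real_mult)
  also have "\<dots> = 1" using v by simp
  finally have 1: "(\<integral>x. dens x \<partial>lborel) = 1" by simp
  have "prob_space (semicircle v)"
  proof
    have "emeasure (semicircle v) (space (semicircle v)) = (\<integral>\<^sup>+x. ennreal (dens x) \<partial>lborel)"
      unfolding semicircle_dens by (simp add: emeasure_density)
    also have "\<dots> = ennreal (\<integral>x. dens x \<partial>lborel)"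
      by (rule nn_integral_eq_integral[OF id]) (simp add: dens_nonneg)
    finally show "emeasure (semicircle v) (space (semicircle v)) = 1" using 1 by simp
  qed
  thus ?thesis
    by (simp add: real_distribution_def real_distribution_axioms_def semicircle_def)
qed

sublocale real_distribution "semicircle v" by (rule real_distribution_semicircle)

text \<open>An instance of the identity \<open>E (4 v - X\<^sup>2) f'(X) = 3 E X f(X)\<close> that characterises the semicircle law:
\<open>(4 v - x\<^sup>2)\<^sup>3\<^sup>/\<^sup>2 f(x)\<close> vanishes at both ends of the support, and its derivative is the density times the
integrand.\<close>

lemma semicircle_stein:
  fixes z :: complex
  assumes z: "0 < Im z"
  shows "(\<integral>x. (4 * v - x\<^sup>2) * (1 / (z - x))\<^sup>2 - 3 * complex_of_real x * (1 / (z - x)) \<partial>semicircle v) = 0"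
proof -
  have nz: "z - complex_of_real x \<noteq> 0" for x using z by (auto simp: complex_eq_iff)
  define H where "H = (\<lambda>x. complex_of_real (sqrt (4 * v - x\<^sup>2) * (4 * v - x\<^sup>2)) * (1 / (z - x)))"
  let ?h = "\<lambda>x. complex_of_real (4 * v - x\<^sup>2) * (1 / (z - x))\<^sup>2 - 3 * complex_of_real x * (1 / (z - x))"
  have "(\<integral>x. indicator {- R..R} x *\<^sub>R (sqrt (4 * v - x\<^sup>2) *\<^sub>R ?h x) \<partial>lborel) = H R - H (- R)"
  proof (rule lebesgue_FTC_interior(2))
    show "- R \<le> R" using R by simp
    show "continuous_on {- R..R} H" unfolding H_def using nz by (intro continuous_intros) auto
    show "continuous_on {- R..R} (\<lambda>x. sqrt (4 * v - x\<^sup>2) *\<^sub>R ?h x)" using nz by (intro continuous_intros) auto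
    fix x assume x: "- R < x" "x < R"
    define s where "s = sqrt (4 * v - x\<^sup>2)"
    have s: "0 < s" "s\<^sup>2 = 4 * v - x\<^sup>2" using sqrt_pos_interior[OF x] by (simp_all add: s_def)
    have d1: "((\<lambda>x. sqrt (4 * v - x\<^sup>2)) has_real_derivative - x / s) (at x)"
      using sqrt_pos_interior[OF x] by (auto intro!: derivative_eq_intros simp: s_def field_simps)
    have d2: "((\<lambda>x. 4 * v - x\<^sup>2) has_real_derivative - 2 * x) (at x)"
      by (auto intro!: derivative_eq_intros)
    have "((\<lambda>x. sqrt (4 * v - x\<^sup>2) * (4 * v - x\<^sup>2)) has_real_derivative s * (- 2 * x) + (- x / s) * (4 * v - x\<^sup>2)) (at x)"
      using DERIV_mult'[OF d1 d2] by (simp add: s_def)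
    moreover have e: "s * (- 2 * x) + (- x / s) * (4 * v - x\<^sup>2) = - 3 * x * s"
      unfolding s(2)[symmetric] using s(1) by (simp add: power2_eq_square)
    ultimately have "((\<lambda>x. sqrt (4 * v - x\<^sup>2) * (4 * v - x\<^sup>2)) has_real_derivative - 3 * x * s) (at x)"
      unfolding e by blast
    hence a: "((\<lambda>x. complex_of_real (sqrt (4 * v - x\<^sup>2) * (4 * v - x\<^sup>2))) has_vector_derivative complex_of_real (- 3 * x * s)) (at x)"
      by (rule has_vector_derivative_of_real)
    have "((\<lambda>w. 1 / (z - w)) has_field_derivative (1 / (z - x))\<^sup>2) (at (complex_of_real x))"
      using nz[of x] by (auto intro!: derivative_eq_intros simp: power2_eq_square)
    hence b: "((\<lambda>x. 1 / (z - complex_of_real x)) has_vector_derivative (1 / (z - x))\<^sup>2) (at x)"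
      by (rule has_vector_derivative_real_field)
    have "(H has_vector_derivative (complex_of_real (sqrt (4 * v - x\<^sup>2) * (4 * v - x\<^sup>2)) * (1 / (z - x))\<^sup>2
        + complex_of_real (- 3 * x * s) * (1 / (z - x)))) (at x)"
      unfolding H_def by (rule has_vector_derivative_mult[OF a b])
    moreover have "complex_of_real (s * (4 * v - x\<^sup>2)) * (1 / (z - x))\<^sup>2 + complex_of_real (- 3 * x * s) * (1 / (z - x))
        = s *\<^sub>R ?h x"
      unfolding scaleR_conv_of_real of_real_mult by (simp add: algebra_simps)
    ultimately show "(H has_vector_derivative sqrt (4 * v - x\<^sup>2) *\<^sub>R ?h x) (at x)"
      unfolding s_def by simp
  qed
  also have "H R - H (- R) = 0" using R(2) by (simp add: H_def)
  finally show ?thesis by (subst integral_semicircle) auto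
qed

text \<open>The differential equation \<open>(z\<^sup>2 - 4 v) g' = z g - 2\<close>, obtained from the preceding identity by
writing \<open>x = z - (z - x)\<close> in the numerators.\<close>

lemma semicircle_cauchy_identity:
  fixes z :: complex
  assumes z: "0 < Im z"
  shows "(z\<^sup>2 - 4 * complex_of_real v) * - (\<integral>x. (1 / (z - x))\<^sup>2 \<partial>semicircle v) = z * cauchy_transform (semicircle v) z - 2"
proof -
  let ?k = "\<lambda>x. 1 / (z - complex_of_real x)"
  define g where "g = cauchy_transform (semicircle v) z"
  have nz: "z - complex_of_real x \<noteq> 0" for x using z by (auto simp: complex_eq_iff)
  have i1: "integrable (semicircle v) ?k" using z by (intro integrable_cauchy_kernel) simp
  have i2: "integrable (semicircle v) (\<lambda>x. (?k x)\<^sup>2)"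
  proof (rule integrable_const_bound[where B = "(1 / \<bar>Im z\<bar>)\<^sup>2"])
    show "AE x in semicircle v. norm ((?k x)\<^sup>2) \<le> (1 / \<bar>Im z\<bar>)\<^sup>2"
      unfolding norm_power using z by (intro AE_I2 power_mono norm_cauchy_kernel) auto
  qed simp
  have "(4 * v - x\<^sup>2) * (?k x)\<^sup>2 - 3 * complex_of_real x * ?k x = (4 * v - z\<^sup>2) * (?k x)\<^sup>2 + 2 * z * ?k x - 1 - 3 * (z * ?k x - 1)" for x
  proof -
    have gen: "b = a - 1" if "a - b = 1" for a b :: complex using that by (simp add: algebra_simps)
    have "(z - x) * ?k x = 1" using nz[of x] by simp
    hence k: "x * ?k x = z * ?k x - 1" unfolding left_diff_distrib by (rule gen)
    have "complex_of_real (x\<^sup>2) * (?k x)\<^sup>2 = (x * ?k x)\<^sup>2" by (simp only: power_mult_distrib of_real_power)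
    also have "\<dots> = z\<^sup>2 * (?k x)\<^sup>2 - 2 * z * ?k x + 1" unfolding k by (simp add: power2_eq_square algebra_simps)
    finally have k2: "complex_of_real (x\<^sup>2) * (?k x)\<^sup>2 = z\<^sup>2 * (?k x)\<^sup>2 - 2 * z * ?k x + 1" .
    have alg: "(a - X) * K2 - 3 * y * K = (a - Z) * K2 + 2 * z * K - 1 - 3 * (z * K - 1)"
      if "X * K2 = Z * K2 - 2 * z * K + 1" "y * K = z * K - 1" for a X K2 y K Z :: complex
    proof -
      have "(a - X) * K2 - 3 * y * K = a * K2 - X * K2 - 3 * (y * K)" by (simp add: algebra_simps)
      thus ?thesis unfolding that by (simp add: algebra_simps)
    qed
    show ?thesis unfolding of_real_diff[of "4 * v"] by (rule alg[OF k2 k])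
  qed
  hence "(\<integral>x. (4 * v - x\<^sup>2) * (?k x)\<^sup>2 - 3 * complex_of_real x * ?k x \<partial>semicircle v)
      = (\<integral>x. (4 * v - z\<^sup>2) * (?k x)\<^sup>2 + 2 * z * ?k x - 1 - 3 * (z * ?k x - 1) \<partial>semicircle v)"
    by (simp only:)
  also have "\<dots> = (4 * v - z\<^sup>2) * (\<integral>x. (?k x)\<^sup>2 \<partial>semicircle v) + 2 * z * g - 1 - 3 * (z * g - 1)"
  proof -
    have i1': "integrable (semicircle v) (\<lambda>x. c * ?k x)" for c by (intro integrable_mult_right i1)
    have i2': "integrable (semicircle v) (\<lambda>x. c * (?k x)\<^sup>2)" for c by (intro integrable_mult_right i2)
    have ic: "integrable (semicircle v) (\<lambda>x. c)" for c :: complex by simp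
    note ints = i1' i2' ic Bochner_Integration.integrable_add Bochner_Integration.integrable_diff integrable_mult_right
    have one: "(\<integral>x. c \<partial>semicircle v) = c" for c :: complex
      using prob_space by simp
    show ?thesis
      unfolding g_def cauchy_transform_def
      by (subst Bochner_Integration.integral_diff Bochner_Integration.integral_add, (intro ints)+)+
        (simp only: integral_mult_right_zero one, subst Bochner_Integration.integral_diff, (intro ints)+,
         simp only: integral_mult_right_zero one)
  qed
  finally show ?thesis using semicircle_stein[OF z] unfolding g_def by (simp add: algebra_simps)
qed

lemma (in real_distribution) cauchy_transform_deriv:
  fixes z :: complex
  assumes z: "0 < Im z"
  shows "(cauchy_transform M has_field_derivative - (\<integral>x. (1 / (z - x))\<^sup>2 \<partial>M)) (at z)"
proof -
  define \<eta> where "\<eta> = Im z"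
  have \<eta>: "0 < \<eta>" using z by (simp add: \<eta>_def)
  let ?D = "\<integral>x. (1 / (z - x))\<^sup>2 \<partial>M"
  have i2: "integrable M (\<lambda>x. (1 / (z - complex_of_real x))\<^sup>2)"
  proof (rule integrable_const_bound[where B = "(1 / \<bar>Im z\<bar>)\<^sup>2"])
    show "AE x in M. norm ((1 / (z - complex_of_real x))\<^sup>2) \<le> (1 / \<bar>Im z\<bar>)\<^sup>2"
      unfolding norm_power using z by (intro AE_I2 power_mono norm_cauchy_kernel) auto
  qed simp
  have est: "cmod ((cauchy_transform M w - cauchy_transform M z) / (w - z) - - ?D) \<le> cmod (w - z) * (2 / \<eta> ^ 3)"
    if w: "w \<noteq> z" "cmod (w - z) < \<eta> / 2" for w
  proof -
    have "\<bar>Im (w - z)\<bar> < \<eta> / 2" using w(2) abs_Im_le_cmod[of "w - z"] by linarith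
    hence Imw: "\<eta> / 2 < Im w" unfolding \<eta>_def minus_complex.simps by linarith
    have kw: "cmod (1 / (w - of_real x)) \<le> 2 / \<eta>" for x
    proof -
      have "cmod (1 / (w - of_real x)) \<le> 1 / \<bar>Im w\<bar>" using Imw \<eta> by (intro norm_cauchy_kernel) auto
      also have "\<dots> \<le> 1 / (\<eta> / 2)" using Imw \<eta> by (intro divide_left_mono) auto
      finally show ?thesis by simp
    qed
    have kz: "cmod (1 / (z - of_real x)) \<le> 1 / \<eta>" for x
      using norm_cauchy_kernel[of z x] z by (simp add: \<eta>_def)
    have nz: "z - complex_of_real x \<noteq> 0" "w - complex_of_real x \<noteq> 0" for x
      using z Imw \<eta> by (auto simp: complex_eq_iff)
    have pt: "(1 / (w - of_real x) - 1 / (z - of_real x)) / (w - z) - - (1 / (z - of_real x))\<^sup>2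
        = (w - z) * (1 / (w - of_real x) * (1 / (z - of_real x))\<^sup>2)" for x
      using nz[of x] w(1) by (simp add: divide_simps) (simp add: power2_eq_square algebra_simps)
    have iw: "integrable M (\<lambda>x. 1 / (w - complex_of_real x))" using Imw \<eta> by (intro integrable_cauchy_kernel) auto
    have iz: "integrable M (\<lambda>x. 1 / (z - complex_of_real x))" using z by (intro integrable_cauchy_kernel) auto
    have id: "integrable M (\<lambda>x. (1 / (w - complex_of_real x) - 1 / (z - of_real x)) / (w - z) - - (1 / (z - of_real x))\<^sup>2)"
      using iw iz i2 by (intro Bochner_Integration.integrable_diff integrable_divide integrable_minus)
    have quot: "(cauchy_transform M w - cauchy_transform M z) / (w - z) - - ?D
        = (\<integral>x. (1 / (w - of_real x) - 1 / (z - of_real x)) / (w - z) - - (1 / (z - of_real x))\<^sup>2 \<partial>M)"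
      unfolding cauchy_transform_def using iw iz i2 by simp
    have "cmod ((cauchy_transform M w - cauchy_transform M z) / (w - z) - - ?D)
        \<le> (\<integral>x. cmod ((1 / (w - of_real x) - 1 / (z - of_real x)) / (w - z) - - (1 / (z - of_real x))\<^sup>2) \<partial>M)"
      unfolding quot by (rule integral_norm_bound)
    also have "\<dots> \<le> (\<integral>x. cmod (w - z) * (2 / \<eta> ^ 3) \<partial>M)"
    proof (intro integral_mono integrable_norm id)
      fix x
      have "cmod ((w - z) * (1 / (w - of_real x) * (1 / (z - of_real x))\<^sup>2))
          = cmod (w - z) * (cmod (1 / (w - of_real x)) * (cmod (1 / (z - of_real x)))\<^sup>2)"
        by (simp only: norm_mult norm_power)
      also have "\<dots> \<le> cmod (w - z) * (2 / \<eta> * (1 / \<eta>)\<^sup>2)"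
        using kw[of x] kz[of x] \<eta> by (intro mult_left_mono mult_mono power_mono) auto
      also have "2 / \<eta> * (1 / \<eta>)\<^sup>2 = 2 / \<eta> ^ 3" by (simp add: power2_eq_square power3_eq_cube)
      finally show "cmod ((1 / (w - of_real x) - 1 / (z - of_real x)) / (w - z) - - (1 / (z - of_real x))\<^sup>2)
          \<le> cmod (w - z) * (2 / \<eta> ^ 3)" unfolding pt .
    qed auto
    also have "\<dots> = cmod (w - z) * (2 / \<eta> ^ 3)" by (simp add: prob_space[unfolded space_eq_univ])
    finally show ?thesis .
  qed
  have "((\<lambda>w. (cauchy_transform M w - cauchy_transform M z) / (w - z)) \<longlongrightarrow> - ?D) (at z)"
  proof (rule Lim_transform_bound[of _ "\<lambda>w. cmod (w - z) * (2 / \<eta> ^ 3)", THEN LIM_zero_cancel])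
    show "\<forall>\<^sub>F w in at z. norm ((cauchy_transform M w - cauchy_transform M z) / (w - z) - - ?D) \<le> norm (cmod (w - z) * (2 / \<eta> ^ 3))"
      unfolding eventually_at using est \<eta>
      by (intro exI[of _ "\<eta> / 2"]) (auto simp: dist_norm intro: order.trans[OF _ abs_ge_self])
    have "((\<lambda>w. cmod (w - z) * (2 / \<eta> ^ 3)) \<longlongrightarrow> cmod (z - z) * (2 / \<eta> ^ 3)) (at z)"
      by (intro tendsto_intros)
    thus "((\<lambda>w. cmod (w - z) * (2 / \<eta> ^ 3)) \<longlongrightarrow> 0) (at z)" by simp
  qed
  thus ?thesis by (simp add: has_field_derivative_iff)
qed

text \<open>The differential equation for \<open>g\<close> gives \<open>(z\<^sup>2 - 4 v) q' = 2 z q\<close> for \<open>q = z g - 1 - v g\<^sup>2\<close>, so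
\<open>q / (z\<^sup>2 - 4 v)\<close> is constant on the upper half plane. On the imaginary axis \<open>q\<close> stays bounded
while the denominator tends to infinity, so the constant is 0. No branch of the square root has
to be chosen on this way.\<close>

theorem semicircle_cauchy_equation:
  assumes z: "0 < Im z"
  shows "z * cauchy_transform (semicircle v) z - 1 = v * (cauchy_transform (semicircle v) z)\<^sup>2"
proof -
  let ?S = "{z. 0 < Im z}"
  define g where "g = cauchy_transform (semicircle v)"
  define q where "q = (\<lambda>z. z * g z - 1 - v * (g z)\<^sup>2)"
  define h where "h = (\<lambda>z. q z / (z\<^sup>2 - 4 * complex_of_real v))"
  have nz: "w\<^sup>2 - 4 * complex_of_real v \<noteq> 0" if w: "0 < Im w" for w
  proof
    assume "w\<^sup>2 - 4 * complex_of_real v = 0"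
    moreover have "(complex_of_real (2 * sqrt v))\<^sup>2 = 4 * complex_of_real v"
      unfolding of_real_power[symmetric] using v by (simp add: power_mult_distrib)
    ultimately have "w\<^sup>2 = (complex_of_real (2 * sqrt v))\<^sup>2" by simp
    hence "w = of_real (2 * sqrt v) \<or> w = - of_real (2 * sqrt v)" by (rule power2_eq_iff[THEN iffD1])
    thus False using w by auto
  qed
  have dg: "\<exists>g'. (g has_field_derivative g') (at w) \<and> (w\<^sup>2 - 4 * complex_of_real v) * g' = w * g w - 2" if w: "0 < Im w" for w
    using cauchy_transform_deriv[OF w] semicircle_cauchy_identity[OF w] unfolding g_def by blast
  have dh: "(h has_field_derivative 0) (at w within ?S)" if w: "w \<in> ?S" for w
  proof -
    obtain g' where g': "(g has_field_derivative g') (at w)" "(w\<^sup>2 - 4 * complex_of_real v) * g' = w * g w - 2"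
      using dg w by auto
    have dq: "(q has_field_derivative (g w + w * g' - 2 * complex_of_real v * g w * g')) (at w)"
      unfolding q_def by (auto intro!: derivative_eq_intros g'(1) simp: algebra_simps)
    have "(w\<^sup>2 - 4 * complex_of_real v) * (g w + w * g' - 2 * complex_of_real v * g w * g')
        = (w\<^sup>2 - 4 * complex_of_real v) * g w + (w - 2 * complex_of_real v * g w) * ((w\<^sup>2 - 4 * complex_of_real v) * g')" by (simp add: algebra_simps)
    also have "\<dots> = 2 * w * q w" unfolding g'(2) q_def by (simp add: power2_eq_square algebra_simps)
    finally have e: "(g w + w * g' - 2 * complex_of_real v * g w * g') * (w\<^sup>2 - 4 * complex_of_real v) - q w * (2 * w) = 0" by (simp add: mult_ac)
    have dp: "((\<lambda>w. w\<^sup>2 - 4 * complex_of_real v) has_field_derivative 2 * w) (at w)"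
      by (auto intro!: derivative_eq_intros)
    have "(h has_field_derivative ((g w + w * g' - 2 * complex_of_real v * g w * g') * (w\<^sup>2 - 4 * complex_of_real v) - q w * (2 * w)) / ((w\<^sup>2 - 4 * complex_of_real v) * (w\<^sup>2 - 4 * complex_of_real v))) (at w)"
      unfolding h_def using w by (intro DERIV_divide[OF dq dp nz]) auto
    thus ?thesis unfolding e by (auto intro: has_field_derivative_at_within)
  qed
  have "\<exists>c. \<forall>w\<in>?S. h w = c"
    by (rule has_field_derivative_zero_constant[OF convex_halfspace_Im_gt dh])
  then obtain c where c: "\<And>w. 0 < Im w \<Longrightarrow> h w = c" by auto
  have bound: "cmod c \<le> (2 + v) / (real y)\<^sup>2" if y: "1 \<le> y" for y :: nat
  proof -
    let ?w = "Complex 0 y"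
    have w: "0 < Im ?w" "Im ?w \<noteq> 0" "cmod ?w = y" using y by (auto simp: complex_norm)
    have gb: "cmod (g ?w) \<le> 1 / y" using norm_cauchy_transform[OF w(2)] by (simp add: g_def)
    have "cmod (q ?w) \<le> cmod (?w * g ?w - 1) + cmod (v * (g ?w)\<^sup>2)"
      unfolding q_def by (rule norm_triangle_ineq4)
    also have "\<dots> \<le> (cmod (?w * g ?w) + 1) + v * (cmod (g ?w))\<^sup>2"
      using norm_triangle_ineq4[of "?w * g ?w" 1] v by (simp add: norm_mult norm_power)
    also have "\<dots> \<le> (1 + 1) + v * 1"
    proof -
      have "cmod (?w * g ?w) \<le> y * (1 / y)" unfolding norm_mult w(3) by (intro mult_left_mono gb) auto
      moreover have "1 / real y \<le> 1" using y by simp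
      hence "(cmod (g ?w))\<^sup>2 \<le> 1" using gb by (intro power_le_one) auto
      ultimately show ?thesis using y v by (intro add_mono mult_left_mono) auto
    qed
    finally have qb: "cmod (q ?w) \<le> 2 + v" by simp
    have "?w\<^sup>2 - 4 * complex_of_real v = - complex_of_real ((real y)\<^sup>2 + 4 * v)"
      by (simp add: complex_eq_iff power2_eq_square)
    hence d: "cmod (?w\<^sup>2 - 4 * complex_of_real v) = (real y)\<^sup>2 + 4 * v" using v by (simp only: norm_minus_cancel norm_of_real) simp
    have "cmod c = cmod (q ?w) / ((real y)\<^sup>2 + 4 * v)"
      unfolding c[OF w(1), symmetric] h_def norm_divide d ..
    also have "\<dots> \<le> (2 + v) / (real y)\<^sup>2"
      using qb v y by (intro frac_le) auto
    finally show ?thesis .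
  qed
  have "(\<lambda>y::nat. (2 + v) / (real y)\<^sup>2) \<longlonglongrightarrow> 0" by real_asymp
  hence "cmod c \<le> 0" by (rule tendsto_lowerbound) (auto intro!: eventually_sequentiallyI[of 1] bound)
  hence "h z = 0" using c[OF z] by simp
  hence "q z = 0" using nz[OF z] by (simp add: h_def)
  thus ?thesis by (simp add: q_def g_def)
qed

end

section \<open>Expected spectral distributions\<close>

definition symreal :: "nat \<Rightarrow> real Matrix.mat \<Rightarrow> bool" where
  "symreal n A \<longleftrightarrow> A \<in> carrier_mat n n \<and> (\<forall>i<n. \<forall>j<n. A $$ (j, i) = A $$ (i, j))"

lemma symreal_symmat: "symreal n A \<Longrightarrow> symmat n (map_mat complex_of_real A)"
  by (auto simp: symreal_def symmat_def)

lemma sum_mset_count: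
  fixes f :: "'a \<Rightarrow> complex"
  shows "(\<Sum>x\<in>#m. f x) = (\<Sum>x\<in>set_mset m. of_nat (count m x) * f x)"
proof (induction m)
  case (add y m)
  have "(\<Sum>x\<in>set_mset (add_mset y m). of_nat (count (add_mset y m) x) * f x)
      = (\<Sum>x\<in>insert y (set_mset m). of_nat (count m x) * f x + (if x = y then f x else 0))"
    by (intro sum.cong) (auto simp: algebra_simps)
  also have "\<dots> = (\<Sum>x\<in>insert y (set_mset m). of_nat (count m x) * f x) + f y"
    by (simp add: sum.distrib)
  also have "(\<Sum>x\<in>insert y (set_mset m). of_nat (count m x) * f x) = (\<Sum>x\<in>set_mset m. of_nat (count m x) * f x)"
    by (cases "y \<in> set_mset m") (auto simp: insert_absorb not_in_iff)
  finally show ?case using add by simp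
qed simp

lemma real_distribution_esd: "real_distribution (esd A)"
  unfolding esd_def
  by (intro real_distribution.intro prob_space.prob_space_distr measure_pmf.prob_space_axioms real_distribution_axioms.intro) auto

lemma cauchy_transform_esd:
  assumes A: "symreal n A" and n: "0 < n" and z: "Im z \<noteq> 0"
  shows "cauchy_transform (esd A) z = mat_trace (resolvent (map_mat complex_of_real A) z) / of_nat n"
proof -
  let ?m = "proots (char_poly A)"
  have c: "A \<in> carrier_mat n n" and s: "\<And>i j. i < n \<Longrightarrow> j < n \<Longrightarrow> A $$ (j, i) = A $$ (i, j)"
    using A by (auto simp: symreal_def)
  have sz: "size ?m = n" by (rule size_proots_symmetric[OF c s])
  hence ne: "?m \<noteq> {#}" using n by auto
  have "cauchy_transform (esd A) z = (\<integral>x. 1 / (z - of_real x) \<partial>measure_pmf (pmf_of_multiset ?m))"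
    unfolding cauchy_transform_def esd_def by (rule integral_distr) auto
  also have "\<dots> = (\<Sum>x\<in>set_mset ?m. pmf (pmf_of_multiset ?m) x *\<^sub>R (1 / (z - of_real x)))"
    by (rule integral_measure_pmf) (use ne in auto)
  also have "\<dots> = (\<Sum>x\<in>set_mset ?m. of_nat (count ?m x) * (1 / (z - of_real x))) / of_nat n"
    unfolding sum_divide_distrib using ne sz by (intro sum.cong refl) (simp add: scaleR_conv_of_real)
  also have "(\<Sum>x\<in>set_mset ?m. of_nat (count ?m x) * (1 / (z - of_real x))) = (\<Sum>x\<in>#?m. 1 / (z - of_real x))"
    by (rule sum_mset_count[symmetric])
  also have "\<dots> = mat_trace (resolvent (map_mat complex_of_real A) z)"
    by (rule mat_trace_resolvent_eigenvalues[OF c s z, symmetric])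
  finally show ?thesis .
qed

locale random_symmetric_matrix = prob_space P for P :: "'a measure" +
  fixes n :: nat and A :: "'a \<Rightarrow> real Matrix.mat"
  assumes n: "0 < n" and sym: "\<And>\<omega>. symreal n (A \<omega>)"
    and entry: "\<And>i j. i < n \<Longrightarrow> j < n \<Longrightarrow> (\<lambda>\<omega>. A \<omega> $$ (i, j)) \<in> borel_measurable P"
begin

lemma carrier_A: "A \<omega> \<in> carrier_mat n n"
  using sym[of \<omega>] by (simp add: symreal_def)

lemma measurable_trace_resolvent:
  assumes g: "g \<in> borel_measurable (P \<Otimes>\<^sub>M N)"
  shows "(\<lambda>p. mat_trace (resolvent (map_mat complex_of_real (A (fst p))) (g p))) \<in> borel_measurable (P \<Otimes>\<^sub>M N)"
proof -
  have e: "(\<lambda>p. map_mat complex_of_real (A (fst p)) $$ (i, j)) \<in> borel_measurable (P \<Otimes>\<^sub>M N)" if "i < n" "j < n" for i j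
  proof -
    have [measurable]: "(\<lambda>\<omega>. A \<omega> $$ (i, j)) \<in> borel_measurable P" by (rule entry[OF that])
    have eq: "map_mat complex_of_real (A (fst p)) $$ (i, j) = complex_of_real (A (fst p) $$ (i, j))" for p
      using carrier_A[of "fst p"] that by auto
    show ?thesis unfolding eq by measurable
  qed
  have d: "dim_row (resolvent (map_mat complex_of_real (A \<omega>)) w) = n" for \<omega> w
  proof -
    have "w \<cdot>\<^sub>m 1\<^sub>m n - map_mat complex_of_real (A \<omega>) \<in> carrier_mat n n"
      using carrier_A[of \<omega>] by (intro minus_carrier_mat) simp
    from carrier_matD(1)[OF adj_mat(1)[OF this]] show ?thesis
      using carrier_A[of \<omega>] by (simp add: resolvent_def Let_def)
  qed
  show ?thesis unfolding mat_trace_def d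
    by (intro borel_measurable_sum borel_measurable_resolvent[where n = n] e g) (use carrier_A in auto)
qed

text \<open>Eigenvalues need not be ordered or chosen measurably: Stieltjes inversion expresses the
mass of an interval as a limit of integrals of the trace of the resolvent, which is a
measurable function of the matrix.\<close>

lemma measurable_esd_interval: "(\<lambda>\<omega>. measure (esd (A \<omega>)) {a<..<b}) \<in> borel_measurable P"
proof (cases "a < b")
  case True
  define u where "u = (\<lambda>m \<omega>. (\<integral>x. indicator {a + 1 / real m..b - 1 / real m} x
      * - Im (mat_trace (resolvent (map_mat complex_of_real (A \<omega>)) (Complex x (1 / real m ^ 2))) / of_nat n) \<partial>lborel) / pi)"
  show ?thesis
  proof (rule borel_measurable_LIMSEQ_real[where u = u])
    fix \<omega> assume "\<omega> \<in> space P"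
    interpret E: real_distribution "esd (A \<omega>)" by (rule real_distribution_esd)
    have "\<forall>\<^sub>F m in sequentially. a + 1 / real m \<le> b - 1 / real m" using True by real_asymp
    hence "\<forall>\<^sub>F m in sequentially. (\<integral>x. smooth_window a b m x \<partial>esd (A \<omega>)) = u m \<omega>"
      using eventually_gt_at_top[of 0]
    proof eventually_elim
      case (elim m)
      show ?case
        unfolding E.smooth_window_integral_eq[OF elim] u_def
        using elim by (simp add: cauchy_transform_esd[OF sym n])
    qed
    with E.smooth_window_integral_tendsto[OF True]
    show "(\<lambda>m. u m \<omega>) \<longlonglongrightarrow> measure (esd (A \<omega>)) {a<..<b}" by (rule Lim_transform_eventually)
  next
    fix m
    have [measurable]: "(\<lambda>p. Complex (snd p) (1 / real m ^ 2)) \<in> borel_measurable (P \<Otimes>\<^sub>M lborel)"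
      unfolding Complex_eq by measurable
    have [measurable]: "(\<lambda>p. mat_trace (resolvent (map_mat complex_of_real (A (fst p))) (Complex (snd p) (1 / real m ^ 2))))
        \<in> borel_measurable (P \<Otimes>\<^sub>M lborel)"
      by (rule measurable_trace_resolvent) measurable
    have "(\<lambda>(\<omega>, x). indicator {a + 1 / real m..b - 1 / real m} x
      * - Im (mat_trace (resolvent (map_mat complex_of_real (A \<omega>)) (Complex x (1 / real m ^ 2))) / of_nat n))
      \<in> borel_measurable (P \<Otimes>\<^sub>M lborel)"
      unfolding case_prod_beta' by measurable
    from lborel.borel_measurable_lebesgue_integral[OF this]
    show "u m \<in> borel_measurable P" unfolding u_def by measurable
  qed
qed auto

text \<open>The kernel property that gives the mixture in \<open>expected_esd\<close> its meaning.\<close>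

lemma measurable_esd: "(\<lambda>\<omega>. esd (A \<omega>)) \<in> P \<rightarrow>\<^sub>M prob_algebra borel"
proof (rule measurable_prob_algebra_generated[where \<Omega> = UNIV and G = "range (\<lambda>(a, b). box a b)"])
  show "sets borel = sigma_sets UNIV (range (\<lambda>(a, b). box a b :: real set))"
    by (subst borel_eq_box) simp
  show "Int_stable (range (\<lambda>(a, b). box a b :: real set))"
  proof (rule Int_stableI)
    fix X Y :: "real set" assume "X \<in> range (\<lambda>(a, b). box a b)" "Y \<in> range (\<lambda>(a, b). box a b)"
    then obtain a b c d where "X = {a<..<b}" "Y = {c<..<d}" by auto
    hence "X \<inter> Y = box (max a c) (min b d)" by auto
    thus "X \<inter> Y \<in> range (\<lambda>(a, b). box a b)" by auto
  qed
  have em: "emeasure (esd (A \<omega>)) X = ennreal (measure (esd (A \<omega>)) X)" for \<omega> X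
  proof -
    interpret E: real_distribution "esd (A \<omega>)" by (rule real_distribution_esd)
    show ?thesis by (rule E.emeasure_eq_measure)
  qed
  show "(\<lambda>\<omega>. emeasure (esd (A \<omega>)) X) \<in> borel_measurable P" if rX: "X \<in> range (\<lambda>(a, b). box a b)" for X
  proof -
    obtain a b where X: "X = {a<..<b}" using rX by auto
    show ?thesis unfolding X em using measurable_esd_interval[of a b] by measurable
  qed
  show "prob_space (esd (A \<omega>))" for \<omega> by (rule real_distribution.axioms(1)[OF real_distribution_esd])
  show "sets (esd (A \<omega>)) = sets borel" for \<omega> by (simp add: esd_def)
qed auto

lemma measurable_esd_subprob: "(\<lambda>\<omega>. esd (A \<omega>)) \<in> P \<rightarrow>\<^sub>M subprob_algebra borel"
  by (rule measurable_prob_algebraD[OF measurable_esd])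

lemma real_distribution_expected_esd: "real_distribution (expected_esd P A)"
proof -
  have "prob_space (expected_esd P A)"
    unfolding expected_esd_def
    by (rule prob_space_bind[OF _ measurable_esd_subprob])
      (auto intro: real_distribution.axioms(1)[OF real_distribution_esd])
  moreover have "sets (expected_esd P A) = sets borel"
    unfolding expected_esd_def by (rule sets_bind) (auto simp: esd_def not_empty)
  ultimately show ?thesis by (simp add: real_distribution_def real_distribution_axioms_def)
qed

lemma measurable_cauchy_transform_esd:
  assumes "Im z \<noteq> 0" shows "(\<lambda>\<omega>. cauchy_transform (esd (A \<omega>)) z) \<in> borel_measurable P"
proof -
  have "(\<lambda>p. mat_trace (resolvent (map_mat complex_of_real (A (fst p))) z)) \<in> borel_measurable (P \<Otimes>\<^sub>M (borel :: real measure))"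
    by (rule measurable_trace_resolvent) simp
  hence "(\<lambda>\<omega>. (\<lambda>p. mat_trace (resolvent (map_mat complex_of_real (A (fst p))) z)) (\<omega>, 0 :: real)) \<in> borel_measurable P"
    by (rule measurable_compose[OF measurable_Pair2'[of 0 borel], rotated]) simp
  thus ?thesis unfolding cauchy_transform_esd[OF sym n assms] by simp
qed

theorem cauchy_transform_expected_esd:
  assumes z: "Im z \<noteq> 0"
  shows "cauchy_transform (expected_esd P A) z = expectation (\<lambda>\<omega>. cauchy_transform (esd (A \<omega>)) z)"
proof -
  interpret X: real_distribution "expected_esd P A" by (rule real_distribution_expected_esd)
  have iE: "integrable (esd (A \<omega>)) (\<lambda>x. 1 / (z - of_real x))" for \<omega>
    by (rule real_distribution.integrable_cauchy_kernel[OF real_distribution_esd z])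
  have ic: "integrable P (\<lambda>\<omega>. cauchy_transform (esd (A \<omega>)) z)"
    by (rule integrable_const_bound[where B = "1 / \<bar>Im z\<bar>"])
      (use real_distribution.norm_cauchy_transform[OF real_distribution_esd z] measurable_cauchy_transform_esd[OF z] in auto)
  have bind: "(\<integral>x. f x \<partial>expected_esd P A) = (\<integral>\<omega>. (\<integral>x. f x \<partial>esd (A \<omega>)) \<partial>P)"
    if f: "f \<in> borel_measurable borel" "\<And>x. \<bar>f x\<bar> \<le> 1 / \<bar>Im z\<bar>" for f :: "real \<Rightarrow> real"
    unfolding expected_esd_def
  proof (rule integral_bind[OF f(1) f(2) measurable_esd_subprob, where B' = 1])
    show "AE \<omega> in P. emeasure (esd (A \<omega>)) (space (esd (A \<omega>))) \<le> ennreal 1"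
      using prob_space.emeasure_space_1[OF real_distribution.axioms(1)[OF real_distribution_esd]] by simp
  qed (unfold_locales)
  have b: "\<bar>Re (1 / (z - of_real x))\<bar> \<le> 1 / \<bar>Im z\<bar>" "\<bar>Im (1 / (z - of_real x))\<bar> \<le> 1 / \<bar>Im z\<bar>" for x
    using norm_cauchy_kernel[OF z, of x] abs_Re_le_cmod[of "1 / (z - of_real x)"] abs_Im_le_cmod[of "1 / (z - of_real x)"]
    by linarith+
  have "Re (cauchy_transform (expected_esd P A) z) = (\<integral>x. Re (1 / (z - of_real x)) \<partial>expected_esd P A)"
    unfolding cauchy_transform_def by (rule integral_Re[symmetric, OF X.integrable_cauchy_kernel[OF z]])
  also have "\<dots> = (\<integral>\<omega>. (\<integral>x. Re (1 / (z - of_real x)) \<partial>esd (A \<omega>)) \<partial>P)"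
    by (rule bind[OF _ b(1)]) measurable
  also have "\<dots> = (\<integral>\<omega>. Re (cauchy_transform (esd (A \<omega>)) z) \<partial>P)"
    unfolding cauchy_transform_def by (simp only: integral_Re[OF iE])
  also have "\<dots> = Re (expectation (\<lambda>\<omega>. cauchy_transform (esd (A \<omega>)) z))" by (rule integral_Re[OF ic])
  finally have 1: "Re (cauchy_transform (expected_esd P A) z) = Re (expectation (\<lambda>\<omega>. cauchy_transform (esd (A \<omega>)) z))" .
  have "Im (cauchy_transform (expected_esd P A) z) = (\<integral>x. Im (1 / (z - of_real x)) \<partial>expected_esd P A)"
    unfolding cauchy_transform_def by (rule integral_Im[symmetric, OF X.integrable_cauchy_kernel[OF z]])
  also have "\<dots> = (\<integral>\<omega>. (\<integral>x. Im (1 / (z - of_real x)) \<partial>esd (A \<omega>)) \<partial>P)"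
    by (rule bind[OF _ b(2)]) measurable
  also have "\<dots> = (\<integral>\<omega>. Im (cauchy_transform (esd (A \<omega>)) z) \<partial>P)"
    unfolding cauchy_transform_def by (simp only: integral_Im[OF iE])
  also have "\<dots> = Im (expectation (\<lambda>\<omega>. cauchy_transform (esd (A \<omega>)) z))" by (rule integral_Im[OF ic])
  finally show ?thesis using 1 by (simp add: complex_eq_iff)
qed

end

section \<open>Generalised hypergraph adjacency matrices\<close>

abbreviation (input) gham :: "nat \<Rightarrow> nat \<Rightarrow> (nat \<Rightarrow> nat set) \<Rightarrow> (nat \<Rightarrow> real) \<Rightarrow> real Matrix.mat" where
  "gham n r e x \<equiv> (1 / sqrt (real n)) \<cdot>\<^sub>m H_mat n r e x"

lemma edge_mat_entry:
  "i < n \<Longrightarrow> j < n \<Longrightarrow> edge_mat n E $$ (i, j) = (if i \<noteq> j \<and> Suc i \<in> E \<and> Suc j \<in> E then 1 else 0)"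
  by (auto simp: edge_mat_def outer_prod_def ind_vec_def mat_diag_def)

lemma gham_entry:
  "i < n \<Longrightarrow> j < n \<Longrightarrow> gham n r e x $$ (i, j)
    = 1 / sqrt (real n) * (1 / sqrt (real (num_edges_pair n r)) * (\<Sum>l = 1..num_edges n r. x l * edge_mat n (e l) $$ (i, j)))"
  by (simp add: H_mat_def)

lemma symreal_gham: "symreal n (gham n r e x)"
proof -
  have "gham n r e x $$ (j, i) = gham n r e x $$ (i, j)" if "i < n" "j < n" for i j
    unfolding gham_entry[OF that] gham_entry[OF that(2,1)] edge_mat_entry[OF that] edge_mat_entry[OF that(2,1)]
    by (intro arg_cong2[of _ _ _ _ "(*)"] sum.cong refl) auto
  thus ?thesis by (simp add: symreal_def H_mat_def)
qed

lemma (in hypergraph_model) model_eq: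
  assumes A: "A \<in> carrier_mat n n"
    and entry: "\<And>i j. i < n \<Longrightarrow> j < n \<Longrightarrow> A $$ (i, j) = of_real norm_const * (\<Sum>l\<in>L. of_real (y l) * edge_entry (e l) i j)"
  shows "model y = centering n * A * centering n"
proof (rule eq_matI)
  have c: "centering n * A * centering n \<in> carrier_mat n n"
    by (rule mult_carrier_mat[OF mult_carrier_mat[OF centering_carrier A] centering_carrier])
  show "dim_row (model y) = dim_row (centering n * A * centering n)" "dim_col (model y) = dim_col (centering n * A * centering n)"
    using carrier_matD[OF c] by (simp_all add: model_def)
  fix i j assume "i < dim_row (centering n * A * centering n)" "j < dim_col (centering n * A * centering n)"
  hence ij: "i < n" "j < n" unfolding carrier_matD[OF c] .
  let ?P = "\<lambda>i j. centering n $$ (i, j)"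
  have coef: "coef l $$ (i, j) = (\<Sum>k<n. \<Sum>m<n. ?P i m * (of_real norm_const * edge_entry (e l) m k) * ?P k j)" if "l \<in> L" for l
  proof -
    have "coef l $$ (i, j) = of_real norm_const * (centering n * adjacency n (e l) * centering n) $$ (i, j)"
      unfolding coef_eq using ij carrier_matD[OF mult_carrier_mat[OF mult_carrier_mat[OF centering_carrier adjacency_carrier] centering_carrier]]
      by (intro index_smult_mat(1)) auto
    also have "(centering n * adjacency n (e l) * centering n) $$ (i, j)
        = (\<Sum>k<n. \<Sum>m<n. ?P i m * adjacency n (e l) $$ (m, k) * ?P k j)"
      by (rule centering_sandwich_sum[OF adjacency_carrier ij])
    finally show ?thesis by (simp add: sum_distrib_left adjacency_def mult_ac)
  qed
  have "model y $$ (i, j) = (\<Sum>l\<in>L. of_real (y l) * coef l $$ (i, j))" using ij by (simp add: model_def)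
  also have "\<dots> = (\<Sum>l\<in>L. \<Sum>k<n. \<Sum>m<n. ?P i m * (of_real norm_const * (of_real (y l) * edge_entry (e l) m k)) * ?P k j)"
    by (intro sum.cong refl) (simp add: coef sum_distrib_left mult_ac)
  also have "\<dots> = (\<Sum>k<n. \<Sum>l\<in>L. \<Sum>m<n. ?P i m * (of_real norm_const * (of_real (y l) * edge_entry (e l) m k)) * ?P k j)"
    by (rule sum.swap)
  also have "\<dots> = (\<Sum>k<n. \<Sum>m<n. \<Sum>l\<in>L. ?P i m * (of_real norm_const * (of_real (y l) * edge_entry (e l) m k)) * ?P k j)"
    by (intro sum.cong refl sum.swap)
  also have "\<dots> = (\<Sum>k<n. \<Sum>m<n. ?P i m * A $$ (m, k) * ?P k j)"
    by (intro sum.cong refl) (simp add: entry sum_distrib_left sum_distrib_right)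
  also have "\<dots> = (centering n * A * centering n) $$ (i, j)" by (rule centering_sandwich_sum[OF A ij, symmetric])
  finally show "model y $$ (i, j) = (centering n * A * centering n) $$ (i, j)" .
qed

lemma random_symmetric_gham:
  assumes P: "prob_space P" and n: "0 < n"
    and indep: "prob_space.indep_vars P (\<lambda>_. borel) Y {1..num_edges n r}"
  shows "random_symmetric_matrix P n (\<lambda>\<omega>. gham n r e (\<lambda>l. Y l \<omega>))"
proof -
  interpret prob_space P by (rule P)
  have Y: "Y l \<in> borel_measurable P" if "l \<in> {1..num_edges n r}" for l
    using indep that by (auto simp: indep_vars_def2)
  show ?thesis
  proof
    fix i j assume ij: "i < n" "j < n"
    show "(\<lambda>\<omega>. gham n r e (\<lambda>l. Y l \<omega>) $$ (i, j)) \<in> borel_measurable P"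
      unfolding gham_entry[OF ij]
      by (intro borel_measurable_times borel_measurable_const borel_measurable_sum Y)
  qed (use n symreal_gham in auto)
qed

text \<open>The equation for the compressed model, transported to the original matrix. By independence the law
of the variables is a product measure, and undoing the compression costs \<open>2 / (n Im z)\<close> in the
Cauchy transform.\<close>

lemma gham_self_consistent:
  fixes P :: "'a measure" and Y :: "nat \<Rightarrow> 'a \<Rightarrow> real" and z :: complex
  assumes r: "2 \<le> r" "r \<le> n" "4 \<le> n" and e: "enumerates_edges n r e" and P: "prob_space P"
    and indep: "prob_space.indep_vars P (\<lambda>_. borel) Y {1..num_edges n r}"
    and square_integrable: "\<And>l. l \<in> {1..num_edges n r} \<Longrightarrow> integrable P (\<lambda>\<omega>. (Y l \<omega>)\<^sup>2)"
    and mean: "\<And>l. l \<in> {1..num_edges n r} \<Longrightarrow> prob_space.expectation P (Y l) = 0"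
    and variance: "\<And>l. l \<in> {1..num_edges n r} \<Longrightarrow> prob_space.variance P (Y l) = 1"
    and \<epsilon>: "0 < \<epsilon>" "\<epsilon> \<le> 1"
    and lindeberg: "real r ^ 4 / (real n ^ 2 * real (num_edges_pair n r)) *
        (\<Sum>l = 1..num_edges n r. prob_space.expectation P
            (\<lambda>\<omega>. (Y l \<omega>)\<^sup>2 * indicator {y. \<bar>y\<bar> > \<epsilon> * K_trunc n r} (Y l \<omega>))) \<le> \<epsilon>"
    and z: "0 < Im z"
  defines "s \<equiv> cauchy_transform (expected_esd P (\<lambda>\<omega>. gham n r e (\<lambda>l. Y l \<omega>))) z"
  shows "cmod (z * s - 1 - of_real (1 - 2 * corr1 n r + corr2 n r) * s\<^sup>2)
    \<le> (80 / Im z ^ 3 + 8 / (Im z)\<^sup>2) * \<epsilon> + (33 / (Im z)\<^sup>2 + 64 / Im z ^ 4) / n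
      + 2 / (n * Im z) * (cmod z + 8 / Im z)"
proof -
  interpret P: prob_space P by (rule P)
  define L where "L = {1..num_edges n r}"
  have L: "finite L" "L \<noteq> {}"
    using zero_less_binomial[OF r(2)] by (auto simp: L_def num_edges_def Suc_le_eq)
  have Y: "Y l \<in> borel_measurable P" if "l \<in> L" for l
    using indep that by (auto simp: P.indep_vars_def2 L_def)
  \<comment> \<open>The point mass is a default law for the indices outside \<open>L\<close>, where \<open>Y\<close> need not be measurable.\<close>
  define \<mu> where "\<mu> = (\<lambda>l. if l \<in> L then distr P borel (Y l) else return borel 0)"
  have prob: "prob_space (\<mu> l)" for l
    using Y by (auto simp: \<mu>_def intro: P.prob_space_distr prob_space_return)
  have mom: "integrable (\<mu> l) (\<lambda>t. t\<^sup>2)" "(\<integral>t. t\<^sup>2 \<partial>\<mu> l) = 1" "(\<integral>t. t \<partial>\<mu> l) = 0" if l: "l \<in> L" for l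
  proof -
    show "integrable (\<mu> l) (\<lambda>t. t\<^sup>2)"
      using square_integrable[of l] l Y[OF l] by (simp add: \<mu>_def L_def integrable_distr_eq)
    show "(\<integral>t. t \<partial>\<mu> l) = 0"
      using mean[of l] l Y[OF l] by (simp add: \<mu>_def L_def integral_distr)
    show "(\<integral>t. t\<^sup>2 \<partial>\<mu> l) = 1"
      using variance[of l] mean[of l] l Y[OF l] by (simp add: \<mu>_def L_def integral_distr)
  qed
  have product: "product_real_prob \<mu>"
    by (rule product_real_prob.intro[OF prob]) (simp add: \<mu>_def)
  have graph: "hypergraph_model n r L e z"
    using r L z e by (simp add: hypergraph_model_def enumerates_edges_def edge_sets_def L_def)
  interpret M: random_hypergraph_model n r L e z \<mu>
    by (intro random_hypergraph_model.intro random_hypergraph_model_axioms.intro graph product mom)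
  have lind: "M.lindeberg_sum \<epsilon> \<le> \<epsilon>"
  proof -
    have "(\<integral>t. t\<^sup>2 * indicator {y. \<bar>y\<bar> > \<epsilon> * K_trunc n r} t \<partial>\<mu> l)
        = P.expectation (\<lambda>\<omega>. (Y l \<omega>)\<^sup>2 * indicator {y. \<bar>y\<bar> > \<epsilon> * K_trunc n r} (Y l \<omega>))" if "l \<in> L" for l
      using Y[OF that] that by (simp add: \<mu>_def integral_distr)
    thus ?thesis using lindeberg unfolding M.lindeberg_sum_def L_def[symmetric] by simp
  qed
  define g where "g = M.PI.expectation M.stieltjes"
  have self: "cmod (z * g - 1 - of_real M.gam * g\<^sup>2)
      \<le> (80 / Im z ^ 3 + 8 / (Im z)\<^sup>2) * \<epsilon> + (33 / (Im z)\<^sup>2 + 64 / Im z ^ 4) / n"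
    unfolding g_def by (rule M.self_consistent_equation[OF \<epsilon> lind])
  have n0: "0 < n" using r by simp
  let ?A = "\<lambda>\<omega>. gham n r e (\<lambda>l. Y l \<omega>)"
  interpret A: random_symmetric_matrix P n ?A
    by (rule random_symmetric_gham[OF P n0 indep])
  have PiM: "distr P (PiM L (\<lambda>_. borel)) (\<lambda>\<omega>. \<lambda>l\<in>L. Y l \<omega>) = PiM L \<mu>"
  proof -
    have "P.indep_vars (\<lambda>_. borel) Y L" using indep by (simp add: L_def)
    hence "distr P (PiM L (\<lambda>_. borel)) (\<lambda>\<omega>. \<lambda>l\<in>L. Y l \<omega>) = PiM L (\<lambda>l. distr P borel (Y l))"
      using P.indep_vars_iff_distr_eq_PiM'[OF L(2), where M' = "\<lambda>_. borel" and X = Y] Y by simp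
    also have "\<dots> = PiM L \<mu>" by (rule PiM_cong) (auto simp: \<mu>_def)
    finally show ?thesis .
  qed
  have mY: "(\<lambda>\<omega>. \<lambda>l\<in>L. Y l \<omega>) \<in> P \<rightarrow>\<^sub>M PiM L (\<lambda>_. borel)"
    by (rule measurable_restrict) (rule Y)
  have restr: "M.stieltjes (restrict y L) = M.stieltjes y" for y
    by (simp add: M.stieltjes_def M.res_def M.model_def)
  have ms: "M.stieltjes \<in> borel_measurable (PiM L (\<lambda>_. borel))"
    using M.measurable_stieltjes sets_PiM_cong[OF refl, of L \<mu> "\<lambda>_. borel"] M.sets_mu
    by (simp cong: measurable_cong_sets)
  have gP: "g = P.expectation (\<lambda>\<omega>. M.stieltjes (\<lambda>l. Y l \<omega>))"
    unfolding g_def PiM[symmetric] by (subst integral_distr[OF mY ms]) (simp add: restr)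
  have mst: "(\<lambda>\<omega>. M.stieltjes (\<lambda>l. Y l \<omega>)) \<in> borel_measurable P"
    using measurable_compose[OF mY ms] by (simp add: restr)
  have model: "M.model (\<lambda>l. Y l \<omega>) = centering n * map_mat complex_of_real (?A \<omega>) * centering n" for \<omega>
  proof (rule M.model_eq)
    show c: "map_mat complex_of_real (?A \<omega>) \<in> carrier_mat n n" using A.carrier_A by simp
    fix i j assume ij: "i < n" "j < n"
    have "map_mat complex_of_real (?A \<omega>) $$ (i, j) = complex_of_real (?A \<omega> $$ (i, j))"
      using c ij by (intro index_map_mat(1)) auto
    also have "\<dots> = complex_of_real (M.norm_const * (\<Sum>l\<in>L. Y l \<omega> * edge_mat n (e l) $$ (i, j)))"
      unfolding gham_entry[OF ij] M.norm_const_def L_def[symmetric] by (simp add: real_sqrt_mult)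
    also have "\<dots> = of_real M.norm_const * (\<Sum>l\<in>L. of_real (Y l \<omega>) * edge_entry (e l) i j)"
      by (simp add: edge_mat_entry[OF ij] edge_entry_def) (intro disjI2 sum.cong refl, simp)
    finally show "map_mat complex_of_real (?A \<omega>) $$ (i, j) = of_real M.norm_const * (\<Sum>l\<in>L. of_real (Y l \<omega>) * edge_entry (e l) i j)" .
  qed
  have pt: "cmod (cauchy_transform (esd (?A \<omega>)) z - M.stieltjes (\<lambda>l. Y l \<omega>)) \<le> 2 / (n * Im z)" for \<omega>
  proof -
    have zn: "Im z \<noteq> 0" using z by simp
    have eq: "cauchy_transform (esd (?A \<omega>)) z - M.stieltjes (\<lambda>l. Y l \<omega>)
        = (mat_trace (resolvent (map_mat complex_of_real (?A \<omega>)) z)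
          - mat_trace (resolvent (centering n * map_mat complex_of_real (?A \<omega>) * centering n) z)) / of_nat n"
      unfolding cauchy_transform_esd[OF symreal_gham n0 zn] M.stieltjes_def M.res_def model
      by (simp add: diff_divide_distrib)
    have "cmod (mat_trace (resolvent (map_mat complex_of_real (?A \<omega>)) z)
          - mat_trace (resolvent (centering n * map_mat complex_of_real (?A \<omega>) * centering n) z)) \<le> 2 / Im z"
      using trace_resolvent_centering[OF symreal_symmat[OF symreal_gham] zn n0, of r e "\<lambda>l. Y l \<omega>"] z
      by (simp add: pos_le_divide_eq mult.commute)
    hence "cmod (cauchy_transform (esd (?A \<omega>)) z - M.stieltjes (\<lambda>l. Y l \<omega>)) \<le> 2 / Im z / n"
      unfolding eq norm_divide norm_of_nat by (intro divide_right_mono) auto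
    thus ?thesis by (simp add: mult.commute)
  qed
  have zn: "Im z \<noteq> 0" using z by simp
  have ic: "integrable P (\<lambda>\<omega>. cauchy_transform (esd (?A \<omega>)) z)"
    by (rule P.integrable_const_bound[where B = "1 / \<bar>Im z\<bar>"])
      (use real_distribution.norm_cauchy_transform[OF real_distribution_esd zn] A.measurable_cauchy_transform_esd[OF zn] in auto)
  have is': "integrable P (\<lambda>\<omega>. M.stieltjes (\<lambda>l. Y l \<omega>))"
    by (rule P.integrable_const_bound[where B = "1 / Im z"]) (use M.norm_stieltjes mst in auto)
  have diff: "cmod (s - g) \<le> 2 / (n * Im z)"
  proof -
    have sg: "s - g = P.expectation (\<lambda>\<omega>. cauchy_transform (esd (?A \<omega>)) z - M.stieltjes (\<lambda>l. Y l \<omega>))"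
      unfolding s_def gP A.cauchy_transform_expected_esd[OF zn] using ic is' by simp
    have "cmod (s - g) \<le> P.expectation (\<lambda>\<omega>. cmod (cauchy_transform (esd (?A \<omega>)) z - M.stieltjes (\<lambda>l. Y l \<omega>)))"
      unfolding sg by (rule integral_norm_bound)
    also have "\<dots> \<le> P.expectation (\<lambda>\<omega>. 2 / (n * Im z))"
      using ic is' pt by (intro integral_mono integrable_norm Bochner_Integration.integrable_diff) auto
    finally show ?thesis by (simp add: P.prob_space)
  qed
  have sb: "cmod s \<le> 1 / Im z"
    using real_distribution.norm_cauchy_transform[OF A.real_distribution_expected_esd zn] z by (simp add: s_def)
  have gb: "cmod g \<le> 1 / Im z"
  proof -
    have "cmod g \<le> P.expectation (\<lambda>\<omega>. cmod (M.stieltjes (\<lambda>l. Y l \<omega>)))" unfolding gP by (rule integral_norm_bound)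
    also have "\<dots> \<le> P.expectation (\<lambda>\<omega>. 1 / Im z)" using is' M.norm_stieltjes by (intro integral_mono) auto
    finally show ?thesis by (simp add: P.prob_space)
  qed
  have gam: "M.gam = 1 - 2 * corr1 n r + corr2 n r" by (simp add: M.gam_def)
  have split: "z * s - 1 - of_real M.gam * s\<^sup>2 = (z * g - 1 - of_real M.gam * g\<^sup>2) + (s - g) * (z - of_real M.gam * (s + g))"
    by (simp add: power2_eq_square algebra_simps)
  have "cmod (z - of_real M.gam * (s + g)) \<le> cmod z + \<bar>M.gam\<bar> * (cmod s + cmod g)"
    using norm_triangle_ineq4[of z "of_real M.gam * (s + g)"] mult_left_mono[OF norm_triangle_ineq[of s g], of "\<bar>M.gam\<bar>"]
    by (simp add: norm_mult)
  also have "\<dots> \<le> cmod z + 4 * (1 / Im z + 1 / Im z)"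
    using M.gam_bound sb gb z by (intro add_left_mono mult_mono add_mono) auto
  finally have f: "cmod (z - of_real M.gam * (s + g)) \<le> cmod z + 8 / Im z" by simp
  have "cmod ((s - g) * (z - of_real M.gam * (s + g))) \<le> 2 / (n * Im z) * (cmod z + 8 / Im z)"
    unfolding norm_mult using diff f z by (intro mult_mono) auto
  from norm_triangle_mono[OF self this] show ?thesis unfolding gam[symmetric] split .
qed

lemma corr_limit:
  assumes lim: "(\<lambda>n. real (r n) / real n) \<longlonglongrightarrow> c"
  shows "(\<lambda>n. 1 - 2 * corr1 n (r n) + corr2 n (r n)) \<longlonglongrightarrow> (1 - c)\<^sup>2"
proof -
  have shift: "(\<lambda>n. (real (r n) - k) / (real n - k)) \<longlonglongrightarrow> c" for k :: real
  proof -
    have "(\<lambda>n. (real (r n) / real n - k / real n) * (real n / (real n - k))) \<longlonglongrightarrow> (c - 0) * 1"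
    proof (intro tendsto_mult tendsto_diff lim)
      show "(\<lambda>n. k / real n) \<longlonglongrightarrow> 0" by real_asymp
      show "(\<lambda>n. real n / (real n - k)) \<longlonglongrightarrow> 1" by real_asymp
    qed
    moreover have "\<forall>\<^sub>F n in sequentially. (real (r n) / real n - k / real n) * (real n / (real n - k)) = (real (r n) - k) / (real n - k)"
      using eventually_gt_at_top[of 0] by eventually_elim (simp add: diff_divide_distrib[symmetric])
    ultimately have "(\<lambda>n. (real (r n) - k) / (real n - k)) \<longlonglongrightarrow> (c - 0) * 1"
      by (rule Lim_transform_eventually)
    thus ?thesis by simp
  qed
  have "(\<lambda>n. 1 - 2 * ((real (r n) - 2) / (real n - 2)) + ((real (r n) - 2) / (real n - 2)) * ((real (r n) - 3) / (real n - 3)))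
      \<longlonglongrightarrow> 1 - 2 * c + c * c"
    by (intro tendsto_intros shift)
  thus ?thesis by (simp add: corr1_def corr2_def power2_eq_square algebra_simps)
qed

text \<open>The difference of the two quadratic expressions factors as \<open>(s - g) (z - v (s + g))\<close>, and as \<open>s\<close>
and \<open>g\<close> lie in the closed lower half plane, the second factor has imaginary part at least
\<open>Im z\<close>.\<close>

lemma quadratic_root_stability:
  fixes s g z :: complex and v :: real
  assumes z: "0 < Im z" and v: "0 \<le> v" and s: "Im s \<le> 0" and g: "Im g \<le> 0"
    and eq: "z * g - 1 = v * g\<^sup>2"
  shows "Im z * cmod (s - g) \<le> cmod (z * s - 1 - v * s\<^sup>2)"
proof -
  have "z * s - 1 - v * s\<^sup>2 = (z * s - 1 - v * s\<^sup>2) - (z * g - 1 - v * g\<^sup>2)" using eq by simp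
  also have "\<dots> = (s - g) * (z - v * (s + g))" by (simp add: power2_eq_square algebra_simps)
  finally have e: "z * s - 1 - v * s\<^sup>2 = (s - g) * (z - v * (s + g))" .
  have "v * (Im s + Im g) \<le> 0" using v s g by (intro mult_nonneg_nonpos) auto
  hence "Im z \<le> Im (z - v * (s + g))" by simp
  also have "\<dots> \<le> cmod (z - v * (s + g))" using abs_Im_le_cmod[of "z - v * (s + g)"] by linarith
  finally show ?thesis unfolding e norm_mult by (simp add: mult.commute[of "cmod (s - g)"] mult_right_mono)
qed

theorem theorem1p1:
  fixes c :: real
    and r :: "nat \<Rightarrow> nat"
    and e :: "nat \<Rightarrow> nat \<Rightarrow> nat set"
    and P :: "nat \<Rightarrow> 'a measure"
    and Y :: "nat \<Rightarrow> nat \<Rightarrow> 'a \<Rightarrow> real"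
  assumes c: "0 \<le> c" "c < 1"
    and r: "\<And>n. n \<ge> 2 \<Longrightarrow> 2 \<le> r n \<and> r n \<le> n"
    and r_lim: "(\<lambda>n. real (r n) / real n) \<longlonglongrightarrow> c"
    and e: "\<And>n. n \<ge> 2 \<Longrightarrow> enumerates_edges n (r n) (e n)"
    and P: "\<And>n. n \<ge> 2 \<Longrightarrow> prob_space (P n)"
    and indep: "\<And>n. n \<ge> 2 \<Longrightarrow>
      prob_space.indep_vars (P n) (\<lambda>_. borel) (Y n) {1..num_edges n (r n)}"
    and square_integrable: "\<And>n l. n \<ge> 2 \<Longrightarrow> l \<in> {1..num_edges n (r n)} \<Longrightarrow>
      integrable (P n) (\<lambda>\<omega>. (Y n l \<omega>)\<^sup>2)"
    and mean: "\<And>n l. n \<ge> 2 \<Longrightarrow> l \<in> {1..num_edges n (r n)} \<Longrightarrow>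
      prob_space.expectation (P n) (Y n l) = 0"
    and variance: "\<And>n l. n \<ge> 2 \<Longrightarrow> l \<in> {1..num_edges n (r n)} \<Longrightarrow>
      prob_space.variance (P n) (Y n l) = 1"
    and lindeberg: "\<And>\<epsilon>. \<epsilon> > 0 \<Longrightarrow>
      (\<lambda>n. real (r n) ^ 4 / (real n ^ 2 * real (num_edges_pair n (r n))) *
        (\<Sum>l = 1..num_edges n (r n).
          prob_space.expectation (P n)
            (\<lambda>\<omega>. (Y n l \<omega>)\<^sup>2 * indicator {y. \<bar>y\<bar> > \<epsilon> * K_trunc n (r n)} (Y n l \<omega>))))
      \<longlonglongrightarrow> 0"
  shows "weak_conv_m
    (\<lambda>n. expected_esd (P n)
      (\<lambda>\<omega>. (1 / sqrt (real n)) \<cdot>\<^sub>m H_mat n (r n) (e n) (\<lambda>l. Y n l \<omega>)))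
    (semicircle ((1 - c)\<^sup>2))"
proof -
  define \<mu> where "\<mu> = (\<lambda>n. expected_esd (P n) (\<lambda>\<omega>. gham n (r n) (e n) (\<lambda>l. Y n l \<omega>)))"
  define v where "v = (1 - c)\<^sup>2"
  define \<gamma> where "\<gamma> = (\<lambda>n. 1 - 2 * corr1 n (r n) + corr2 n (r n))"
  have v: "0 < v" using c by (simp add: v_def)
  interpret S: semicircle_law v by unfold_locales (rule v)
  have dist: "real_distribution (\<mu> n)" if n: "2 \<le> n" for n
    unfolding \<mu>_def
    by (rule random_symmetric_matrix.real_distribution_expected_esd[OF random_symmetric_gham[OF P[OF n] _ indep[OF n]]])
      (use n in simp)
  have lim: "(\<lambda>n. cauchy_transform (\<mu> n) z) \<longlonglongrightarrow> cauchy_transform (semicircle v) z" if z: "0 < Im z" for z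
  proof -
    define s where "s = (\<lambda>n. cauchy_transform (\<mu> n) z)"
    define g where "g = cauchy_transform (semicircle v) z"
    define C where "C = 80 / Im z ^ 3 + 8 / (Im z)\<^sup>2"
    define C' where "C' = 33 / (Im z)\<^sup>2 + 64 / Im z ^ 4"
    define C'' where "C'' = cmod z + 8 / Im z"
    have C0: "0 < C" using z by (simp add: C_def add_pos_pos)
    have self: "(\<lambda>n. z * s n - 1 - of_real (\<gamma> n) * (s n)\<^sup>2) \<longlonglongrightarrow> 0"
    proof (rule tendstoI)
      fix d :: real assume d: "0 < d"
      \<comment> \<open>The Lindeberg condition is used at one level only, chosen so that the part of the error that
        does not vanish with \<open>n\<close> is at most \<open>d / 2\<close>.\<close>
      define \<epsilon> where "\<epsilon> = min 1 (d / (2 * C))"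
      have \<epsilon>: "0 < \<epsilon>" "\<epsilon> \<le> 1" "C * \<epsilon> \<le> d / 2"
        using d C0 by (auto simp: \<epsilon>_def min_def field_simps)
      have "\<forall>\<^sub>F n in sequentially. real (r n) ^ 4 / (real n ^ 2 * real (num_edges_pair n (r n))) *
        (\<Sum>l = 1..num_edges n (r n). prob_space.expectation (P n)
            (\<lambda>\<omega>. (Y n l \<omega>)\<^sup>2 * indicator {y. \<bar>y\<bar> > \<epsilon> * K_trunc n (r n)} (Y n l \<omega>))) < \<epsilon>"
        by (rule order_tendstoD(2)[OF lindeberg[OF \<epsilon>(1)] \<epsilon>(1)])
      moreover have "(\<lambda>n. C' / real n + 2 / (real n * Im z) * C'') \<longlonglongrightarrow> 0"
        using z by real_asymp
      hence "\<forall>\<^sub>F n in sequentially. C' / real n + 2 / (real n * Im z) * C'' < d / 2"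
        by (rule order_tendstoD(2)) (use d in simp)
      ultimately show "\<forall>\<^sub>F n in sequentially. dist (z * s n - 1 - of_real (\<gamma> n) * (s n)\<^sup>2) 0 < d"
        using eventually_ge_at_top[of 4]
      proof eventually_elim
        case (elim n)
        hence n: "2 \<le> n" by simp
        have "cmod (z * s n - 1 - of_real (\<gamma> n) * (s n)\<^sup>2) \<le> C * \<epsilon> + C' / n + 2 / (n * Im z) * C''"
          unfolding s_def \<mu>_def \<gamma>_def C_def C'_def C''_def
          by (rule gham_self_consistent[where Y = "Y n"])
            (use elim r[OF n] e[OF n] P[OF n] indep[OF n] square_integrable[OF n] mean[OF n] variance[OF n] \<epsilon> z in auto)
        thus ?case unfolding dist_norm diff_zero using elim(2) \<epsilon>(3) by linarith
      qed
    qed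
    have sb: "cmod (s n) \<le> 1 / Im z" "Im (s n) \<le> 0" if "2 \<le> n" for n
      using real_distribution.norm_cauchy_transform[OF dist[OF that], of z]
        real_distribution.Im_cauchy_transform[OF dist[OF that] z] z by (simp_all add: s_def)
    have geq: "z * g - 1 = v * g\<^sup>2" unfolding g_def by (rule S.semicircle_cauchy_equation[OF z])
    have gI: "Im g \<le> 0" unfolding g_def by (rule S.Im_cauchy_transform[OF z])
    have \<gamma>: "\<gamma> \<longlonglongrightarrow> v" unfolding \<gamma>_def v_def by (rule corr_limit[OF r_lim])
    \<comment> \<open>Replacing the finite variance \<open>\<gamma> n\<close> by its limit \<open>v\<close> is harmless because \<open>s n\<close> is bounded.\<close>
    have up: "(\<lambda>n. (cmod (z * s n - 1 - of_real (\<gamma> n) * (s n)\<^sup>2) + \<bar>\<gamma> n - v\<bar> * (1 / Im z)\<^sup>2) / Im z) \<longlonglongrightarrow> (0 + 0 * (1 / Im z)\<^sup>2) / Im z"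
      by (intro tendsto_intros tendsto_norm_zero self tendsto_rabs_zero LIM_zero \<gamma>) (use z in simp)
    have "(\<lambda>n. s n - g) \<longlonglongrightarrow> 0"
    proof (rule Lim_null_comparison)
      show "\<forall>\<^sub>F n in sequentially. cmod (s n - g) \<le> (cmod (z * s n - 1 - of_real (\<gamma> n) * (s n)\<^sup>2) + \<bar>\<gamma> n - v\<bar> * (1 / Im z)\<^sup>2) / Im z"
        using eventually_ge_at_top[of 2]
      proof eventually_elim
        case (elim n)
        have replace: "z * s n - 1 - v * (s n)\<^sup>2 = (z * s n - 1 - of_real (\<gamma> n) * (s n)\<^sup>2) + of_real (\<gamma> n - v) * (s n)\<^sup>2"
          by (simp add: algebra_simps)
        have "cmod (z * s n - 1 - v * (s n)\<^sup>2) \<le> cmod (z * s n - 1 - of_real (\<gamma> n) * (s n)\<^sup>2) + \<bar>\<gamma> n - v\<bar> * (cmod (s n))\<^sup>2"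
          unfolding replace using norm_triangle_ineq[of "z * s n - 1 - of_real (\<gamma> n) * (s n)\<^sup>2" "of_real (\<gamma> n - v) * (s n)\<^sup>2"]
          by (simp only: norm_mult norm_power norm_of_real)
        also have "\<bar>\<gamma> n - v\<bar> * (cmod (s n))\<^sup>2 \<le> \<bar>\<gamma> n - v\<bar> * (1 / Im z)\<^sup>2"
          by (intro mult_left_mono power_mono sb elim) auto
        finally have "Im z * cmod (s n - g) \<le> cmod (z * s n - 1 - of_real (\<gamma> n) * (s n)\<^sup>2) + \<bar>\<gamma> n - v\<bar> * (1 / Im z)\<^sup>2"
          using quadratic_root_stability[OF z _ sb(2)[OF elim] gI geq] v by simp
        thus ?case using z by (simp add: pos_le_divide_eq mult.commute)
      qed
      show "(\<lambda>n. (cmod (z * s n - 1 - of_real (\<gamma> n) * (s n)\<^sup>2) + \<bar>\<gamma> n - v\<bar> * (1 / Im z)\<^sup>2) / Im z) \<longlonglongrightarrow> 0"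
        using up by simp
    qed
    thus ?thesis unfolding s_def g_def by (rule LIM_zero_cancel)
  qed
  \<comment> \<open>The first two terms are not known to be probability measures, as nothing is assumed for \<open>n < 2\<close>.\<close>
  have "weak_conv_m (\<lambda>n. \<mu> (n + 2)) (semicircle v)"
    by (rule weak_conv_of_cauchy_transform[OF dist S.real_distribution_semicircle LIMSEQ_ignore_initial_segment[OF lim]]) auto
  hence "weak_conv_m \<mu> (semicircle v)"
    unfolding weak_conv_m_def weak_conv_def by (blast intro: LIMSEQ_offset[of _ 2])
  thus ?thesis unfolding \<mu>_def v_def .
qed

end
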